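(* There exist universal constants $C,C_1\ge2$ and $0<\gamma<1$ such that the following holds. Let $1\le k\le n<N$ be integers, let $0<\varepsilon\le1/(2C)$, let $1\le p<\infty$, and let $\sigma=\{\sigma_i\}_{i=1}^N$ be a non-increasing sequence of non-negative numbers with associated $p$-ellipsoid $\mathcal{E}_p\subset\mathbb{R}^N$. Then with probability at least $$1-3(C\varepsilon)^{n-k+1}-ke^{-\gamma n}$$ we have the following. (1) If $2<p<\infty$, then $$\mathcal{R}_n(\mathcal{E}_p)\le\frac{8\sqrt{\log(1/\varepsilon)}}{\varepsilon}\sqrt{\frac{2n}{n-k+1}}\left(\sum_{i>k}\sigma_i^{\frac{2p}{p-2}}\right)^{\frac{p-2}{2p}}+\frac{2\sqrt n}{\varepsilon(n-k+1)}\left(\sum_{i>n}\sigma_i^{p'}\right)^{1/p'}.$$ (2) If $1<p\le2$, then $$\mathcal{R}_n(\mathcal{E}_p)\le\frac{8\sqrt{\log(1/\varepsilon)}}{\varepsilon}\sqrt{\frac{2n}{n-k+1}}\;\sigma_{k+1}+\frac{2\sqrt{p'\,n}}{\varepsilon(n-k+1)}\left(\sum_{i>k}\sigma_i^{p'}\right)^{1/p'}.$$ (3) If $p=1$, then $$\mathcal{R}_n(\mathcal{E}_1)\le\frac{C_1\sqrt{\log(1/\varepsilon)}}{\varepsilon}\sqrt{\frac{n}{n-k+1}}\;\sigma_{k+1}+\frac{2\sqrt n}{\varepsilon(n-k+1)}\,\sup_{i>k}\sigma_i\sqrt{\log(2(i-k))}.$$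
   Context: $p'$ is the conjugate exponent of $p$ ($1/p+1/p'=1$). $\mathcal{E}_p=\{x\in\mathbb{R}^N:\sum_{i=1}^N(|x_i|/\sigma_i)^p\le1\}$ (if $\sigma_i=0$ the condition is understood as $x_i=0$). Sums and suprema over $i>k$ or $i>n$ are over indices $i\le N$. The $n$-th random radius is $\mathcal{R}_n(\mathcal{E}_p)=\max_{y\in E_n\cap\mathcal{E}_p}|y|$, where $|\cdot|$ is the Euclidean norm and $E_n$ is a random $n$-codimensional linear subspace of $\mathbb{R}^N$ distributed according to the normalized Haar measure on the Grassmannian; probability is with respect to $E_n$. *)

theory Defs
  imports "HOL-Probability.Probability" "HOL-Library.Function_Algebras"
begin

text \<open>
  The dimension \<open>N\<close> has to be quantified inside the statement (the constants do not depend on it), so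
  \<open>\<real>\<^sup>N\<close> is not a type but the linear subspace \<open>rn N\<close> of \<open>nat \<Rightarrow> real\<close>, with coordinates indexed by
  \<open>{1..N}\<close>. With pointwise scalar multiplication, the library notions \<^const>\<open>subspace\<close>,
  \<^const>\<open>dim\<close> and \<^const>\<open>linear\<close> apply to it. The Euclidean norm of \<open>x\<close> is \<open>L2_set x {1..N}\<close>.
\<close>

instantiation "fun" :: (type, real_vector) real_vector
begin

definition scaleR_fun :: "real \<Rightarrow> ('a \<Rightarrow> 'b) \<Rightarrow> 'a \<Rightarrow> 'b"
  where "scaleR_fun r f = (\<lambda>i. r *\<^sub>R f i)"

instance
  by standard (simp_all add: scaleR_fun_def fun_eq_iff scaleR_add_right scaleR_add_left)

end

definition rn :: "nat \<Rightarrow> (nat \<Rightarrow> real) set"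
  where "rn N = {x. \<forall>i. i \<notin> {1..N} \<longrightarrow> x i = 0}"

definition inner_rn :: "nat \<Rightarrow> (nat \<Rightarrow> real) \<Rightarrow> (nat \<Rightarrow> real) \<Rightarrow> real"
  where "inner_rn N x y = (\<Sum>i = 1..N. x i * y i)"

text \<open>
  Only the restriction of a map to \<open>rn N\<close> is relevant; every linear map of \<open>rn N\<close> into itself extends
  to a linear map on all of \<open>nat \<Rightarrow> real\<close>.
\<close>

definition orthogonal_rn :: "nat \<Rightarrow> ((nat \<Rightarrow> real) \<Rightarrow> (nat \<Rightarrow> real)) \<Rightarrow> bool"
  where "orthogonal_rn N U \<longleftrightarrow> linear U \<and> U ` rn N \<subseteq> rn N \<and>
    (\<forall>x\<in>rn N. \<forall>y\<in>rn N. inner_rn N (U x) (U y) = inner_rn N x y)"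

definition grassmannian :: "nat \<Rightarrow> nat \<Rightarrow> (nat \<Rightarrow> real) set set"
  where "grassmannian N n = {E. subspace E \<and> E \<subseteq> rn N \<and> dim E + n = N}"

definition orth_proj :: "nat \<Rightarrow> (nat \<Rightarrow> real) set \<Rightarrow> (nat \<Rightarrow> real) \<Rightarrow> nat \<Rightarrow> real"
  where "orth_proj N E x = (THE y. y \<in> E \<and> (\<forall>z\<in>E. inner_rn N (x - y) z = 0))"

definition proj_matrix :: "nat \<Rightarrow> (nat \<Rightarrow> real) set \<Rightarrow> nat \<Rightarrow> nat \<Rightarrow> real"
  where "proj_matrix N E i j = orth_proj N E (\<lambda>l. if l = j then 1 else 0) i"

text \<open>
  The Grassmannian carries the topology for which \<open>E \<mapsto> P\<^sub>E\<close> (the matrix of the orthogonal projection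
  onto \<open>E\<close>) is an embedding, i.e. that of the metric \<open>\<parallel>P\<^sub>E - P\<^sub>F\<parallel>\<close>. Its Borel sets are the preimages
  of the Borel sets of matrices.
\<close>

definition borel_grassmannian :: "nat \<Rightarrow> nat \<Rightarrow> (nat \<Rightarrow> real) set measure"
  where "borel_grassmannian N n = vimage_algebra (grassmannian N n) (proj_matrix N) borel"

text \<open>The normalized Haar measure is the Borel probability measure invariant under the orthogonal group.\<close>

definition haar_grassmannian :: "nat \<Rightarrow> nat \<Rightarrow> (nat \<Rightarrow> real) set measure \<Rightarrow> bool"
  where "haar_grassmannian N n \<mu> \<longleftrightarrow> prob_space \<mu> \<and> sets \<mu> = sets (borel_grassmannian N n) \<and>
    (\<forall>U. orthogonal_rn N U \<longrightarrow> distr \<mu> (borel_grassmannian N n) (\<lambda>E. U ` E) = \<mu>)"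

definition p_ellipsoid :: "nat \<Rightarrow> real \<Rightarrow> (nat \<Rightarrow> real) \<Rightarrow> (nat \<Rightarrow> real) set"
  where "p_ellipsoid N p \<sigma> = {x \<in> rn N.
    (\<forall>i\<in>{1..N}. \<sigma> i = 0 \<longrightarrow> x i = 0) \<and> (\<Sum>i = 1..N. (\<bar>x i\<bar> / \<sigma> i) powr p) \<le> 1}"

text \<open>
  The supremum is a maximum if \<open>p \<ge> 1\<close> and \<open>\<sigma> \<ge> 0\<close>: the intersection is then compact and contains \<open>0\<close>.
\<close>

definition section_radius :: "nat \<Rightarrow> (nat \<Rightarrow> real) set \<Rightarrow> (nat \<Rightarrow> real) set \<Rightarrow> real"
  where "section_radius N E K = (SUP y\<in>E \<inter> K. L2_set y {1..N})"

definition conj_exponent :: "real \<Rightarrow> real"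
  where "conj_exponent p = p / (p - 1)"

lemma conj_exponent: "1 < p \<Longrightarrow> 1 / p + 1 / conj_exponent p = 1"
  by (simp add: conj_exponent_def field_simps)

end

theory Submission
  imports Defs
begin

text \<open>
  Put \<open>d = n - k + 1\<close> and split \<open>x \<in> E \<inter> \<E>\<^sub>p\<close> into its head (coordinates up to \<open>k\<close>) and its tail. The norm of the tail is
  bounded for all of \<open>\<E>\<^sub>p\<close>. For the head, let \<open>v\<close> be the orthogonal projection of \<open>e\<^sub>k\<close> onto the vectors orthogonal
  to \<open>E\<close> that are supported in \<open>{k..N}\<close>. As \<open>v \<bottom> x\<close>, the coordinate \<open>x\<^sub>k\<close> is at most the support function \<open>h\<close> of the
  tail at \<open>v / \<bar>v\<bar>\<^sup>2\<close>. By invariance the direction of the tail of \<open>v\<close> is that of a Gaussian vector \<open>g\<close> and independent of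
  its length, and \<open>\<bar>v\<bar>\<close> has a small ball estimate of order \<open>d\<close>, so the probability that \<open>x\<^sub>k\<close> can exceed \<open>s\<close> is at
  most \<open>(C / s)\<^sup>d d\<^bsup>-d/2\<^esup> E h(g)\<^sup>d\<close>. Reflections turn \<open>e\<^sub>k\<close> into any direction of the head, and averaging over
  a Gaussian direction gives the same kind of bound for the norm of the head. In this way only the \<open>d\<close>-th moment of \<open>h(g)\<close> is
  needed. For \<open>\<ell>\<^sub>q\<close>-type functions \<open>h\<close> with \<open>q \<ge> 2\<close> it is computed by Gaussian integration by parts, for the weighted
  maximum (\<open>p = 1\<close>) from the excess of \<open>\<bar>g\<^sub>i\<bar>\<close> over \<open>2 (ln (2 (i - k)))\<^bsup>1/2\<^esup>\<close>.
\<close>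

text \<open>The vectors orthogonal to \<open>E\<close> and supported in \<open>{k..N}\<close> form a
  space of dimension at least \<open>n - (k - 1) = d\<close>; this is the order of the small ball
  estimate. For a fixed direction of \<open>g\<close> the bad event reads
  \<open>|v| \<le> h(g) / (s |g|)\<close> and has probability of order \<open>d\<close> in the right
  side, so integrating over \<open>g\<close> yields precisely a \<open>d\<close>-th moment, and no
  concentration of \<open>h(g)\<close> about its mean enters. The obstacle is the passage from one
  coordinate to the norm of the head. A union bound over a net in the sphere of dimension
  \<open>k - 1\<close> costs a factor exponential in \<open>k\<close>, which a power
  \<open>d\<close> of a small number cannot absorb when \<open>d\<close> is much smaller than
  \<open>k\<close> (for \<open>k = n\<close> it is 1). Averaging over a Gaussian direction
  \<open>u\<close> costs only \<open>exp (4 d)\<close>, the inverse of a lower bound for the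
  probability that the inner product of \<open>u\<close> and \<open>x\<close> is at least
  \<open>sqrt d * |x|\<close>. It also brings in the moment of order \<open>d\<close> of
  \<open>|u|\<close>, at most \<open>sqrt (k + d) ^ d\<close> with \<open>k + d = n + 1\<close>;
  this is the origin of \<open>sqrt n\<close> in all three bounds.\<close>

abbreviation borel_PiM :: "'i set \<Rightarrow> ('i \<Rightarrow> real) measure"
  where "borel_PiM I \<equiv> PiM I (\<lambda>_. borel)"

section \<open>Standard Gaussian vectors\<close>

definition gauss :: "'i set \<Rightarrow> ('i \<Rightarrow> real) measure"
  where "gauss I = PiM I (\<lambda>_. std_normal_distribution)"

lemma prob_space_std_normal: "prob_space std_normal_distribution"
  using real_dist_normal_dist by (simp add: real_distribution_def)

lemma sets_gauss [measurable_cong]: "sets (gauss I) = sets (borel_PiM I)"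
  unfolding gauss_def by (rule sets_PiM_cong) auto

lemma space_gauss: "space (gauss I) = PiE I (\<lambda>_. UNIV)"
  by (simp add: gauss_def space_PiM)

lemma prob_space_gauss: "prob_space (gauss I)"
  unfolding gauss_def by (intro prob_space_PiM prob_space_std_normal)

interpretation std_normal: prob_space std_normal_distribution
  by (rule prob_space_std_normal)

interpretation gauss: prob_space "gauss I"
  by (rule prob_space_gauss)

interpretation std_normal_PiM: product_sigma_finite "\<lambda>_. std_normal_distribution"
  by (simp add: product_sigma_finite_def std_normal.sigma_finite_measure_axioms)

lemma char_std_normal: "(CLINT x|std_normal_distribution. iexp (t * x)) = complex_of_real (exp (- t\<^sup>2 / 2))"
  using char_std_normal_distribution by (metis char_def)

lemma iexp_sum: "finite I \<Longrightarrow> iexp (\<Sum>i\<in>I. f i) = (\<Prod>i\<in>I. iexp (f i))"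
  by (simp add: sum_distrib_left exp_sum)

lemma char_gauss:
  assumes "finite I"
  shows "(CLINT x|gauss I. iexp (\<Sum>i\<in>I. t i * x i)) = complex_of_real (exp (- (\<Sum>i\<in>I. (t i)\<^sup>2) / 2))"
proof -
  have "(CLINT x|gauss I. iexp (\<Sum>i\<in>I. t i * x i)) = (\<Prod>i\<in>I. CLINT x|std_normal_distribution. iexp (t i * x))"
    unfolding gauss_def iexp_sum[OF assms]
    by (rule std_normal_PiM.product_integral_prod[OF assms])
       (intro std_normal.integrable_const_bound[where B = 1], auto)
  also have "\<dots> = complex_of_real (\<Prod>i\<in>I. exp (- (t i)\<^sup>2 / 2))"
    by (simp only: char_std_normal of_real_prod)
  also have "(\<Prod>i\<in>I. exp (- (t i)\<^sup>2 / 2)) = exp (- (\<Sum>i\<in>I. (t i)\<^sup>2) / 2)"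
    by (simp only: exp_sum[OF assms, symmetric] sum_negf[symmetric] sum_divide_distrib)
  finally show ?thesis .
qed

section \<open>Characteristic functions of random vectors\<close>

text \<open>Uniqueness for characteristic functions: perturbing a random vector \<open>x\<close> by \<open>a\<close> times a standard
  Gaussian vector produces the density \<open>z \<mapsto> E (\<Prod>i. exp (- ((z i - x i) / a)\<^sup>2 / 2))\<close> up to a constant,
  and Fourier inversion of the Gaussian expresses it by the characteristic function of \<open>x\<close>; then \<open>a \<rightarrow> 0\<close>.\<close>

lemma integral_gauss_kernel:
  fixes M :: "('i \<Rightarrow> real) measure" and z :: "'i \<Rightarrow> real"
  assumes [simp]: "finite I" and "prob_space M" and M[measurable_cong]: "sets M = sets (borel_PiM I)"
  shows "complex_of_real (\<integral>x. (\<Prod>i\<in>I. exp (- ((z i - x i) / a)\<^sup>2 / 2)) \<partial>M) =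
    (CLINT \<xi>|gauss I. iexp (\<Sum>i\<in>I. \<xi> i * z i / a) * (CLINT x|M. iexp (\<Sum>i\<in>I. (- \<xi> i / a) * x i)))"
proof -
  interpret M: prob_space M by fact
  interpret P: pair_prob_space M "gauss I" ..
  \<comment> \<open>The Gaussian kernel is, up to scaling, its own Fourier transform: the product is
    the characteristic function of \<open>gauss I\<close> at \<open>(z - x) / a\<close>. After
    Fubini, \<open>x\<close> occurs only inside \<open>iexp\<close>.\<close>
  have K: "complex_of_real (\<Prod>i\<in>I. exp (- ((z i - x i) / a)\<^sup>2 / 2)) = (CLINT \<xi>|gauss I. iexp (\<Sum>i\<in>I. (z i - x i) / a * \<xi> i))" for x
    by (subst char_gauss) (simp_all only: exp_sum[OF \<open>finite I\<close>, symmetric] sum_negf[symmetric] sum_divide_distrib assms)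
  have "complex_of_real (\<integral>x. (\<Prod>i\<in>I. exp (- ((z i - x i) / a)\<^sup>2 / 2)) \<partial>M) =
    (CLINT x|M. CLINT \<xi>|gauss I. iexp (\<Sum>i\<in>I. (z i - x i) / a * \<xi> i))"
    by (subst integral_complex_of_real[symmetric]) (simp only: K)
  also have "\<dots> = (CLINT \<xi>|gauss I. CLINT x|M. iexp (\<Sum>i\<in>I. (z i - x i) / a * \<xi> i))"
    by (rule P.Fubini_integral[symmetric])
       (intro P.integrable_const_bound[where B = 1]; auto simp: case_prod_beta)
  also have "\<dots> = (CLINT \<xi>|gauss I. iexp (\<Sum>i\<in>I. \<xi> i * z i / a) * (CLINT x|M. iexp (\<Sum>i\<in>I. (- \<xi> i / a) * x i)))"
  proof (intro Bochner_Integration.integral_cong refl)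
    fix \<xi> :: "'i \<Rightarrow> real"
    have "iexp (\<Sum>i\<in>I. (z i - x i) / a * \<xi> i) = iexp (\<Sum>i\<in>I. \<xi> i * z i / a) * iexp (\<Sum>i\<in>I. (- \<xi> i / a) * x i)" for x
      by (simp flip: exp_add distrib_left sum.distrib of_real_add add: diff_divide_distrib algebra_simps)
    then show "(CLINT x|M. iexp (\<Sum>i\<in>I. (z i - x i) / a * \<xi> i)) =
        iexp (\<Sum>i\<in>I. \<xi> i * z i / a) * (CLINT x|M. iexp (\<Sum>i\<in>I. (- \<xi> i / a) * x i))"
      by simp
  qed
  finally show ?thesis .
qed

text \<open>The factor on the right is the density of the normal law with mean \<open>x\<close> and
  standard deviation \<open>a\<close>.\<close>

lemma nn_integral_std_normal_affine:
  assumes [measurable]: "f \<in> borel_measurable borel" and "0 < a"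
  shows "(\<integral>\<^sup>+\<xi>. f (x + a * \<xi>) \<partial>std_normal_distribution) =
    (\<integral>\<^sup>+z. f z * ennreal (exp (- ((z - x) / a)\<^sup>2 / 2) / (a * sqrt (2 * pi))) \<partial>lborel)"
proof -
  have "(\<integral>\<^sup>+z. f z * ennreal (exp (- ((z - x) / a)\<^sup>2 / 2) / (a * sqrt (2 * pi))) \<partial>lborel) =
    ennreal a * (\<integral>\<^sup>+\<xi>. f (x + a * \<xi>) * ennreal (exp (- \<xi>\<^sup>2 / 2) / (a * sqrt (2 * pi))) \<partial>lborel)"
    using \<open>0 < a\<close> by (subst nn_integral_real_affine[where c = a and t = x]) auto
  also have "\<dots> = (\<integral>\<^sup>+\<xi>. ennreal a * (f (x + a * \<xi>) * ennreal (exp (- \<xi>\<^sup>2 / 2) / (a * sqrt (2 * pi)))) \<partial>lborel)"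
    by (simp add: nn_integral_cmult)
  also have "\<dots> = (\<integral>\<^sup>+\<xi>. ennreal (std_normal_density \<xi>) * f (x + a * \<xi>) \<partial>lborel)"
  proof (intro nn_integral_cong)
    fix \<xi> :: real
    have "ennreal a * ennreal (exp (- \<xi>\<^sup>2 / 2) / (a * sqrt (2 * pi))) = ennreal (std_normal_density \<xi>)"
      using \<open>0 < a\<close> by (subst ennreal_mult[symmetric]) (auto simp: std_normal_density_def field_simps)
    then show "ennreal a * (f (x + a * \<xi>) * ennreal (exp (- \<xi>\<^sup>2 / 2) / (a * sqrt (2 * pi)))) =
        ennreal (std_normal_density \<xi>) * f (x + a * \<xi>)"
      by (metis mult.commute mult.left_commute)
  qed
  finally show ?thesis
    by (subst nn_integral_density) (auto simp: ac_simps)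
qed

text \<open>After convolution with a centred normal law of standard deviation \<open>a\<close>, the
  measure \<open>M\<close> enters the integral of a product function only through the kernel
  integral, which \<open>integral_gauss_kernel\<close> expresses by the characteristic function of
  \<open>M\<close>.\<close>

lemma prod_integral_gauss_kernel:
  fixes f :: "'i \<Rightarrow> real \<Rightarrow> real"
  assumes I: "finite I" and "prob_space M" and M[measurable_cong]: "sets M = sets (borel_PiM I)"
    and f[measurable]: "\<And>i. f i \<in> borel_measurable borel" and f01: "\<And>i x. 0 \<le> f i x" "\<And>i x. f i x \<le> 1"
    and "0 < a"
  shows "ennreal (\<integral>x. (\<Prod>i\<in>I. \<integral>\<xi>. f i (x i + a * \<xi>) \<partial>std_normal_distribution) \<partial>M) =
    (\<integral>\<^sup>+z. (\<Prod>i\<in>I. ennreal (f i (z i) / (a * sqrt (2 * pi)))) *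
       ennreal (\<integral>x. (\<Prod>i\<in>I. exp (- ((z i - x i) / a)\<^sup>2 / 2)) \<partial>M) \<partial>PiM I (\<lambda>_. lborel))"
proof -
  interpret M: prob_space M by fact
  interpret L: product_sigma_finite "\<lambda>_::'i. lborel :: real measure"
    by (simp add: product_sigma_finite_def sigma_finite_lborel)
  interpret LI: finite_product_sigma_finite "\<lambda>_::'i. lborel :: real measure" I
    by standard fact
  interpret P: pair_sigma_finite M "PiM I (\<lambda>_::'i. lborel :: real measure)" ..
  note [measurable_cong] = sets_PiM_cong[OF refl sets_lborel, of I]
  have bound: "\<bar>\<integral>\<xi>. f i (x + a * \<xi>) \<partial>std_normal_distribution\<bar> \<le> 1" for i x
    using f01 by (intro order_trans[OF integral_abs_bound] std_normal.integral_le_const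
        std_normal.integrable_const_bound[where B = 1]) auto
  have int: "integrable std_normal_distribution (\<lambda>\<xi>. f i (x + a * \<xi>))" for i x
    by (intro std_normal.integrable_const_bound[where B = 1]) (auto simp: f01)
  have nonneg: "0 \<le> (\<integral>\<xi>. f i (x + a * \<xi>) \<partial>std_normal_distribution)" for i x
    by (simp add: f01)
  have "ennreal (\<integral>x. (\<Prod>i\<in>I. \<integral>\<xi>. f i (x i + a * \<xi>) \<partial>std_normal_distribution) \<partial>M) =
      (\<integral>\<^sup>+x. ennreal (\<Prod>i\<in>I. \<integral>\<xi>. f i (x i + a * \<xi>) \<partial>std_normal_distribution) \<partial>M)"
  proof (rule nn_integral_eq_integral[symmetric])
    show "integrable M (\<lambda>x. \<Prod>i\<in>I. \<integral>\<xi>. f i (x i + a * \<xi>) \<partial>std_normal_distribution)"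
      by (intro M.integrable_const_bound[where B = 1])
         (auto simp: abs_prod intro!: prod_le_1 bound)
  qed (auto intro!: prod_nonneg nonneg)
  also have "\<dots> = (\<integral>\<^sup>+x. (\<integral>\<^sup>+z. (\<Prod>i\<in>I. ennreal (f i (z i) / (a * sqrt (2 * pi)))) *
      ennreal (\<Prod>i\<in>I. exp (- ((z i - x i) / a)\<^sup>2 / 2)) \<partial>PiM I (\<lambda>_. lborel)) \<partial>M)"
  proof (intro nn_integral_cong)
    fix x :: "'i \<Rightarrow> real"
    have "ennreal (\<Prod>i\<in>I. \<integral>\<xi>. f i (x i + a * \<xi>) \<partial>std_normal_distribution) =
        (\<Prod>i\<in>I. \<integral>\<^sup>+\<xi>. ennreal (f i (x i + a * \<xi>)) \<partial>std_normal_distribution)"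
      by (subst prod_ennreal[symmetric])
         (auto intro!: prod.cong nonneg nn_integral_eq_integral[symmetric] int simp: f01)
    also have "\<dots> = (\<Prod>i\<in>I. \<integral>\<^sup>+z. ennreal (f i z) *
        ennreal (exp (- ((z - x i) / a)\<^sup>2 / 2) / (a * sqrt (2 * pi))) \<partial>lborel)"
      using \<open>0 < a\<close> by (subst nn_integral_std_normal_affine) auto
    also have "\<dots> = (\<integral>\<^sup>+z. (\<Prod>i\<in>I. ennreal (f i (z i)) *
        ennreal (exp (- ((z i - x i) / a)\<^sup>2 / 2) / (a * sqrt (2 * pi)))) \<partial>PiM I (\<lambda>_. lborel))"
      by (rule L.product_nn_integral_prod[symmetric]) (auto simp: I)
    also have "\<dots> = (\<integral>\<^sup>+z. (\<Prod>i\<in>I. ennreal (f i (z i) / (a * sqrt (2 * pi)))) *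
      ennreal (\<Prod>i\<in>I. exp (- ((z i - x i) / a)\<^sup>2 / 2)) \<partial>PiM I (\<lambda>_. lborel))"
      using \<open>0 < a\<close> by (intro nn_integral_cong)
        (auto simp: f01 prod.distrib[symmetric] prod_ennreal[symmetric] ennreal_mult[symmetric] simp del: prod.distrib prod_ennreal
          intro!: prod.cong)
    finally show "ennreal (\<Prod>i\<in>I. \<integral>\<xi>. f i (x i + a * \<xi>) \<partial>std_normal_distribution) = \<dots>" .
  qed
  also have "\<dots> = (\<integral>\<^sup>+z. (\<integral>\<^sup>+x. (\<Prod>i\<in>I. ennreal (f i (z i) / (a * sqrt (2 * pi)))) *
      ennreal (\<Prod>i\<in>I. exp (- ((z i - x i) / a)\<^sup>2 / 2)) \<partial>M) \<partial>PiM I (\<lambda>_. lborel))"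
    by (intro P.Fubini'[symmetric]) (auto simp: case_prod_beta)
  also have "\<dots> = (\<integral>\<^sup>+z. (\<Prod>i\<in>I. ennreal (f i (z i) / (a * sqrt (2 * pi)))) *
       ennreal (\<integral>x. (\<Prod>i\<in>I. exp (- ((z i - x i) / a)\<^sup>2 / 2)) \<partial>M) \<partial>PiM I (\<lambda>_. lborel))"
  proof (intro nn_integral_cong)
    fix z :: "'i \<Rightarrow> real"
    have "(\<integral>\<^sup>+x. ennreal (\<Prod>i\<in>I. exp (- ((z i - x i) / a)\<^sup>2 / 2)) \<partial>M) =
        ennreal (\<integral>x. (\<Prod>i\<in>I. exp (- ((z i - x i) / a)\<^sup>2 / 2)) \<partial>M)"
      by (intro nn_integral_eq_integral M.integrable_const_bound[where B = 1])
         (auto intro!: prod_nonneg prod_le_1 simp: abs_prod)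
    then show "(\<integral>\<^sup>+x. (\<Prod>i\<in>I. ennreal (f i (z i) / (a * sqrt (2 * pi)))) *
        ennreal (\<Prod>i\<in>I. exp (- ((z i - x i) / a)\<^sup>2 / 2)) \<partial>M) =
        (\<Prod>i\<in>I. ennreal (f i (z i) / (a * sqrt (2 * pi)))) *
        ennreal (\<integral>x. (\<Prod>i\<in>I. exp (- ((z i - x i) / a)\<^sup>2 / 2)) \<partial>M)"
      by (simp add: nn_integral_cmult)
  qed
  finally show ?thesis .
qed

text \<open>For every \<open>a > 0\<close> the smoothed integrals agree by the preceding lemmas, and
  \<open>a = 1 / Suc n\<close> tends to 0 by dominated convergence. Continuity of \<open>f i\<close>
  gives the pointwise limit; the bounds 0 and 1 give the dominating constant and allow the
  comparison in \<open>ennreal\<close>.\<close>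

lemma integral_prod_eq_if_char_eq:
  fixes f :: "'i \<Rightarrow> real \<Rightarrow> real"
  assumes I: "finite I" and "prob_space M" "prob_space N"
    and M[measurable_cong]: "sets M = sets (borel_PiM I)" and N[measurable_cong]: "sets N = sets (borel_PiM I)"
    and char: "\<And>t. (CLINT x|M. iexp (\<Sum>i\<in>I. t i * x i)) = (CLINT x|N. iexp (\<Sum>i\<in>I. t i * x i))"
    and cont: "\<And>i. continuous_on UNIV (f i)" and f01: "\<And>i x. 0 \<le> f i x" "\<And>i x. f i x \<le> 1"
  shows "(\<integral>x. (\<Prod>i\<in>I. f i (x i)) \<partial>M) = (\<integral>x. (\<Prod>i\<in>I. f i (x i)) \<partial>N)"
proof -
  have [measurable]: "f i \<in> borel_measurable borel" for i
    using cont by (rule borel_measurable_continuous_onI)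
  define F where "F a i x = (\<integral>\<xi>. f i (x + a * \<xi>) \<partial>std_normal_distribution)" for a i x
  have F_bound: "\<bar>F a i x\<bar> \<le> 1" for a i x
    unfolding F_def using f01 by (intro order_trans[OF integral_abs_bound] std_normal.integral_le_const
        std_normal.integrable_const_bound[where B = 1]) auto
  have F_nonneg: "0 \<le> F a i x" for a i x
    unfolding F_def by (simp add: f01)
  have [measurable]: "F a i \<in> borel_measurable borel" for a i
    unfolding F_def by measurable
  have eq: "(\<integral>x. (\<Prod>i\<in>I. F a i (x i)) \<partial>M) = (\<integral>x. (\<Prod>i\<in>I. F a i (x i)) \<partial>N)" if "0 < a" for a
  proof -
    have "(\<integral>x. (\<Prod>i\<in>I. exp (- ((z i - x i) / a)\<^sup>2 / 2)) \<partial>M) = (\<integral>x. (\<Prod>i\<in>I. exp (- ((z i - x i) / a)\<^sup>2 / 2)) \<partial>N)" for z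
      using trans[OF integral_gauss_kernel[OF I \<open>prob_space M\<close> M, of z a, unfolded char]
          integral_gauss_kernel[OF I \<open>prob_space N\<close> N, of z a, symmetric]]
      by (simp only: of_real_eq_iff)
    then have "ennreal (\<integral>x. (\<Prod>i\<in>I. F a i (x i)) \<partial>M) = ennreal (\<integral>x. (\<Prod>i\<in>I. F a i (x i)) \<partial>N)"
      unfolding F_def using that I assms(2-5) f01 by (subst (1 2) prod_integral_gauss_kernel) auto
    then show ?thesis
      by (simp add: integral_nonneg prod_nonneg F_nonneg)
  qed
  have F_lim: "(\<lambda>n. F (1 / Suc n) i x) \<longlonglongrightarrow> f i x" for i x
  proof -
    have "(\<lambda>n. F (1 / Suc n) i x) \<longlonglongrightarrow> (\<integral>\<xi>. f i x \<partial>std_normal_distribution)"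
      unfolding F_def
    proof (rule integral_dominated_convergence[where w = "\<lambda>_. 1"])
      show "AE \<xi> in std_normal_distribution. (\<lambda>n. f i (x + 1 / real (Suc n) * \<xi>)) \<longlonglongrightarrow> f i x"
      proof (rule AE_I2)
        fix \<xi> :: real
        have "(\<lambda>n. x + 1 / real (Suc n) * \<xi>) \<longlonglongrightarrow> x + 0 * \<xi>"
          by (intro tendsto_intros LIMSEQ_Suc lim_1_over_n)
        moreover have "isCont (f i) x"
          using cont by (simp add: continuous_on_eq_continuous_at)
        ultimately show "(\<lambda>n. f i (x + 1 / real (Suc n) * \<xi>)) \<longlonglongrightarrow> f i x"
          by (auto intro: isCont_tendsto_compose)
      qed
    qed (auto simp: f01)
    then show ?thesis
      using std_normal.prob_space by simp
  qed
  have lim: "(\<lambda>n. \<integral>x. (\<Prod>i\<in>I. F (1 / Suc n) i (x i)) \<partial>P) \<longlonglongrightarrow> (\<integral>x. (\<Prod>i\<in>I. f i (x i)) \<partial>P)"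
    if "prob_space P" and P[measurable_cong]: "sets P = sets (borel_PiM I)" for P
  proof -
    interpret P: prob_space P by fact
    show ?thesis
      by (rule integral_dominated_convergence[where w = "\<lambda>_. 1"])
         (auto simp: abs_prod intro!: prod_le_1 F_bound tendsto_prod F_lim[simplified])
  qed
  show ?thesis
    using lim[OF assms(2) M] lim[OF assms(3) N] by (simp add: eq LIMSEQ_unique)
qed

text \<open>Products of half-lines \<open>{..a i}\<close> generate the product \<sigma>-algebra and
  are closed under intersection, so the measures need only be compared on them. Their indicators are
  limits of products of continuous ramps, to which \<open>integral_prod_eq_if_char_eq\<close>
  applies.\<close>

theorem char_unique_PiM:
  fixes M N :: "('i \<Rightarrow> real) measure"
  assumes I: "finite I" and "prob_space M" "prob_space N"
    and M[measurable_cong]: "sets M = sets (borel_PiM I)" and N[measurable_cong]: "sets N = sets (borel_PiM I)"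
    and char: "\<And>t. (CLINT x|M. iexp (\<Sum>i\<in>I. t i * x i)) = (CLINT x|N. iexp (\<Sum>i\<in>I. t i * x i))"
  shows "M = N"
proof -
  interpret M: prob_space M by fact
  interpret N: prob_space N by fact
  \<comment> \<open>For \<open>n > 0\<close> this ramp is 1 up to \<open>a\<close>, then falls
    linearly, and is 0 from \<open>a + 1 / n\<close> on.\<close>
  define g where "g n a x = max 0 (min 1 (1 - real n * (x - a)))" for n and a x :: real
  have g_lim: "(\<lambda>n. g n a x) \<longlonglongrightarrow> indicator {..a} x" for a x
  proof (cases "x \<le> a")
    case True
    then have "g n a x = 1" for n
      by (simp add: g_def mult_nonneg_nonpos)
    then show ?thesis
      using True by simp
  next
    case False
    then obtain n0 where "1 < real n0 * (x - a)"
      using reals_Archimedean3[of "x - a"] by auto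
    have "g n a x = 0" if "n0 \<le> n" for n
    proof -
      have "real n0 * (x - a) \<le> real n * (x - a)"
        using that False by (intro mult_right_mono) auto
      with \<open>1 < real n0 * (x - a)\<close> have "1 - real n * (x - a) \<le> 0"
        by linarith
      then show ?thesis
        by (simp add: g_def)
    qed
    then have "eventually (\<lambda>n. g n a x = 0) sequentially"
      by (auto simp: eventually_sequentially)
    then show ?thesis
      using False by (simp add: tendsto_eventually)
  qed
  have g01: "0 \<le> g n a x" "g n a x \<le> 1" for n a x
    by (auto simp: g_def)
  have [measurable]: "g n a \<in> borel_measurable borel" for n a
    unfolding g_def by measurable
  have lim: "(\<lambda>n. \<integral>x. (\<Prod>i\<in>I. g n (a i) (x i)) \<partial>P) \<longlonglongrightarrow> (\<integral>x. (\<Prod>i\<in>I. indicator {..a i} (x i)) \<partial>P)"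
    if "prob_space P" and P[measurable_cong]: "sets P = sets (borel_PiM I)" for P and a :: "'i \<Rightarrow> real"
  proof -
    interpret P: prob_space P by fact
    show ?thesis
      by (rule integral_dominated_convergence[where w = "\<lambda>_. 1"])
         (auto simp: abs_prod g01 intro!: prod_le_1 tendsto_prod g_lim)
  qed
  have "(\<integral>x. (\<Prod>i\<in>I. g n (a i) (x i)) \<partial>M) = (\<integral>x. (\<Prod>i\<in>I. g n (a i) (x i)) \<partial>N)" for n a
    by (rule integral_prod_eq_if_char_eq[OF assms]) (auto simp: g01 g_def intro!: continuous_intros)
  then have eq: "(\<integral>x. (\<Prod>i\<in>I. indicator {..a i} (x i)) \<partial>M) = ((\<integral>x. (\<Prod>i\<in>I. indicator {..a i} (x i)) \<partial>N) :: real)" for a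
    using lim[OF assms(2) M, of a] lim[OF assms(3) N, of a] by (simp add: LIMSEQ_unique)
  have box: "(\<Prod>i\<in>I. indicator {..a i} (x i)) = (indicator (PiE I (\<lambda>i. {..a i})) x :: real)" if "x \<in> PiE I (\<lambda>_. UNIV)" for a x
    using that I by (auto simp: indicator_def PiE_iff prod_zero_iff)
  \<comment> \<open>The generator in the form that \<open>sets_PiM_sigma\<close> produces. With
    \<open>I\<close> as the only index set it consists of the products of half-lines, which is the
    content of \<open>E\<close>.\<close>
  let ?E = "{{f\<in>(\<Pi>\<^sub>E i\<in>I. UNIV). \<forall>i\<in>j. f i \<in> A i} | A j. j \<in> {I} \<and> A \<in> Pi j (\<lambda>_. range (\<lambda>a::real. {..a}))}"
  have E: "X \<in> ?E \<longleftrightarrow> (\<exists>a. X = PiE I (\<lambda>i. {..a i}))" for X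
  proof
    assume "X \<in> ?E"
    then obtain A where X: "X = {f\<in>(\<Pi>\<^sub>E i\<in>I. UNIV). \<forall>i\<in>I. f i \<in> A i}" and "\<forall>i\<in>I. \<exists>a. A i = {..a}"
      by (auto simp: Pi_iff image_iff)
    then obtain a where "\<And>i. i \<in> I \<Longrightarrow> A i = {..a i}"
      by metis
    with X show "\<exists>a. X = PiE I (\<lambda>i. {..a i})"
      by (intro exI[of _ a]) (auto simp: PiE_iff extensional_def)
  next
    assume "\<exists>a. X = PiE I (\<lambda>i. {..a i})"
    then obtain a where "X = PiE I (\<lambda>i. {..a i})" by blast
    then show "X \<in> ?E"
      by (intro CollectI exI[of _ "\<lambda>i. {..a i}"] exI[of _ I]) (auto simp: PiE_iff extensional_def)
  qed
  have "sets (PiM I (\<lambda>_. sigma UNIV (range (\<lambda>a::real. {..a})))) = sets (sigma (\<Pi>\<^sub>E i\<in>I. UNIV) ?E)"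
  proof (rule sets_PiM_sigma)
    have "UNIV = (\<Union>n. {..real n})"
      using real_arch_simple by auto
    then show "\<exists>S\<subseteq>range (\<lambda>a::real. {..a}). countable S \<and> UNIV = \<Union>S"
      by (intro exI[of _ "range (\<lambda>n. {..real n})"]) auto
  qed (auto simp: I)
  then have gen: "sets (borel_PiM I) = sigma_sets (\<Pi>\<^sub>E i\<in>I. UNIV) ?E"
    by (subst (asm) sets_measure_of) (auto simp: borel_eq_atMost)
  show ?thesis
  proof (rule measure_eqI_generator_eq[where A = "\<lambda>n. PiE I (\<lambda>_. {..real n})"])
    show "Int_stable ?E"
    proof (rule Int_stableI)
      fix X Y assume "X \<in> ?E" "Y \<in> ?E"
      then obtain a b where "X = PiE I (\<lambda>i. {..a i})" "Y = PiE I (\<lambda>i. {..b i})"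
        by (auto simp only: E)
      then have "X \<inter> Y = PiE I (\<lambda>i. {..min (a i) (b i)})"
        by (auto simp: PiE_iff)
      then show "X \<inter> Y \<in> ?E"
        unfolding E by (intro exI[of _ "\<lambda>i. min (a i) (b i)"]) simp
    qed
    show "?E \<subseteq> Pow (\<Pi>\<^sub>E i\<in>I. UNIV)" by auto
    show "sets M = sigma_sets (\<Pi>\<^sub>E i\<in>I. UNIV) ?E" "sets N = sigma_sets (\<Pi>\<^sub>E i\<in>I. UNIV) ?E"
      using gen M N by auto
    show "range (\<lambda>n. PiE I (\<lambda>_. {..real n})) \<subseteq> ?E"
      unfolding image_subset_iff E by (intro ballI exI[of _ "\<lambda>_. real _"]) simp
    show "(\<Union>n. PiE I (\<lambda>_. {..real n})) = (\<Pi>\<^sub>E i\<in>I. UNIV)"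
    proof safe
      fix x :: "'i \<Rightarrow> real" assume x: "x \<in> (\<Pi>\<^sub>E i\<in>I. UNIV)"
      obtain n where "(\<Sum>i\<in>I. \<bar>x i\<bar>) \<le> real n"
        using real_arch_simple by blast
      then have "x i \<le> real n" if "i \<in> I" for i
        using member_le_sum[of i I "\<lambda>i. \<bar>x i\<bar>"] that I by auto
      then show "x \<in> (\<Union>n. PiE I (\<lambda>_. {..real n}))"
        using x by (auto simp: PiE_iff)
    qed (auto simp: PiE_iff extensional_def)
    fix X assume "X \<in> ?E"
    then obtain a where X: "X = PiE I (\<lambda>i. {..a i})"
      by (auto simp only: E)
    have X_sets: "X \<in> sets (borel_PiM I)"
      unfolding X using I by (intro sets_PiM_I_finite) auto
    have space: "space M = (\<Pi>\<^sub>E i\<in>I. UNIV)" "space N = (\<Pi>\<^sub>E i\<in>I. UNIV)"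
      using sets_eq_imp_space_eq[OF M] sets_eq_imp_space_eq[OF N] by (auto simp: space_PiM)
    have "measure M X = (\<integral>x. indicator X x \<partial>M)" "measure N X = (\<integral>x. indicator X x \<partial>N)"
      using X_sets M N by auto
    moreover have "(\<integral>x. indicator X x \<partial>M) = (\<integral>x. (\<Prod>i\<in>I. indicator {..a i} (x i)) \<partial>M :: real)"
      "(\<integral>x. indicator X x \<partial>N) = (\<integral>x. (\<Prod>i\<in>I. indicator {..a i} (x i)) \<partial>N :: real)"
      unfolding X by (intro Bochner_Integration.integral_cong refl; simp add: space box)+
    ultimately show "emeasure M X = emeasure N X"
      using eq[of a] by (simp add: M.emeasure_eq_measure N.emeasure_eq_measure)
  qed (simp add: M.emeasure_eq_measure)
qed

section \<open>Reflections and rotation invariance\<close>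

text \<open>The index set is a parameter since the same vectors are paired over the head, the tail,
  \<open>{k..N}\<close> and all of \<open>{1..N}\<close>.\<close>

definition ip :: "'i set \<Rightarrow> ('i \<Rightarrow> real) \<Rightarrow> ('i \<Rightarrow> real) \<Rightarrow> real"
  where "ip I x y = (\<Sum>i\<in>I. x i * y i)"

lemma ip_commute: "ip I x y = ip I y x"
  by (simp add: ip_def mult.commute)

lemma ip_cong: "(\<And>i. i \<in> I \<Longrightarrow> x i = x' i) \<Longrightarrow> (\<And>i. i \<in> I \<Longrightarrow> y i = y' i) \<Longrightarrow> ip I x y = ip I x' y'"
  by (simp add: ip_def)

lemma ip_diff_left: "ip I (\<lambda>i. x i - y i) z = ip I x z - ip I y z"
  by (simp add: ip_def sum_subtractf left_diff_distrib)

lemma ip_add_left: "ip I (\<lambda>i. x i + y i) z = ip I x z + ip I y z"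
  by (simp add: ip_def sum.distrib distrib_right)

lemma ip_mult_left: "ip I (\<lambda>i. c * x i) z = c * ip I x z"
  by (simp add: ip_def sum_distrib_left mult.assoc)

lemma ip_sum_left: "ip I (\<lambda>i. \<Sum>j\<in>J. f j i) z = (\<Sum>j\<in>J. ip I (f j) z)"
  unfolding ip_def by (simp add: sum_distrib_right) (rule sum.swap)

lemma ip_diff_right: "ip I z (\<lambda>i. x i - y i) = ip I z x - ip I z y"
  by (simp add: ip_commute[of I z] ip_diff_left)

lemma ip_add_right: "ip I z (\<lambda>i. x i + y i) = ip I z x + ip I z y"
  by (simp add: ip_commute[of I z] ip_add_left)

lemma ip_mult_right: "ip I z (\<lambda>i. c * x i) = c * ip I z x"
  by (simp add: ip_commute[of I z] ip_mult_left)

lemma ip_sum_right: "ip I z (\<lambda>i. \<Sum>j\<in>J. f j i) = (\<Sum>j\<in>J. ip I z (f j))"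
  by (simp add: ip_commute[of I z] ip_sum_left)

lemmas ip_linear = ip_diff_left ip_add_left ip_mult_left ip_diff_right ip_add_right ip_mult_right

lemma ip_self: "ip I x x = (L2_set x I)\<^sup>2"
  by (simp add: ip_def L2_set_def sum_nonneg power2_eq_square)

lemma ip_self_nonneg [simp]: "0 \<le> ip I x x"
  by (simp add: ip_self)

lemma ip_self_eq_0: "finite I \<Longrightarrow> ip I x x = 0 \<longleftrightarrow> (\<forall>i\<in>I. x i = 0)"
  by (simp add: ip_self L2_set_eq_0_iff)

lemma ip_unit: "finite I \<Longrightarrow> ip I (\<lambda>i. if i = j then 1 else 0) x = (if j \<in> I then x j else 0)"
  by (simp add: ip_def if_distrib[of "\<lambda>u. u * _"] sum.delta cong: if_cong)

lemma L2_set_restrict [simp]: "L2_set (restrict x I) I = L2_set x I"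
  by (intro L2_set_cong) auto

lemma L2_set_cmult: "0 \<le> c \<Longrightarrow> L2_set (\<lambda>i. c * x i) I = c * L2_set x I"
  by (simp add: L2_set_right_distrib)

text \<open>The Householder reflection in the hyperplane orthogonal to \<open>a\<close>. If
  \<open>ip I a a = 0\<close>, division by zero makes it the identity, so degenerate directions need
  no exception.\<close>

definition reflect :: "'i set \<Rightarrow> ('i \<Rightarrow> real) \<Rightarrow> ('i \<Rightarrow> real) \<Rightarrow> 'i \<Rightarrow> real"
  where "reflect I a x = (\<lambda>i. x i - (2 * ip I a x / ip I a a) * a i)"

lemma ip_reflect_left: "ip I (reflect I a x) y = ip I x (reflect I a y)"
  by (simp only: reflect_def ip_linear) (simp add: ip_commute[of I x a])

lemma reflect_reflect: "reflect I a (reflect I a x) = x"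
proof (cases "ip I a a = 0")
  case False
  then have "ip I a (reflect I a x) = - ip I a x"
    by (simp only: reflect_def ip_linear) simp
  then have "reflect I a (reflect I a x) = (\<lambda>i. reflect I a x i - (2 * (- ip I a x) / ip I a a) * a i)"
    by (simp only: reflect_def[of I a "reflect I a x"])
  then show ?thesis
    by (simp add: reflect_def)
qed (simp add: reflect_def)

lemma ip_reflect: "ip I (reflect I a x) (reflect I a y) = ip I x y"
  by (simp add: ip_reflect_left reflect_reflect)

lemma L2_set_reflect: "L2_set (reflect I a x) I = L2_set x I"
proof -
  have "(L2_set (reflect I a x) I)\<^sup>2 = (L2_set x I)\<^sup>2"
    by (simp flip: ip_self add: ip_reflect)
  then show ?thesis
    by (simp add: power2_eq_iff_nonneg)
qed

text \<open>Two vectors of equal length are mirror images in the hyperplane orthogonal to their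
  difference. Reflections thus act transitively on spheres, and they are the only maps for which the
  invariance of the Haar measure is invoked.\<close>

lemma reflect_swap:
  assumes "finite I" "ip I s s = ip I t t" "i \<in> I"
  shows "reflect I (\<lambda>i. s i - t i) s i = t i"
proof (cases "ip I (\<lambda>i. s i - t i) (\<lambda>i. s i - t i) = 0")
  case True
  then show ?thesis
    using assms by (auto simp: ip_self_eq_0 reflect_def)
next
  case False
  have "ip I (\<lambda>i. s i - t i) (\<lambda>i. s i - t i) = 2 * ip I (\<lambda>i. s i - t i) s"
    using assms(2) by (simp add: ip_linear ip_commute[of I t s])
  with False show ?thesis
    by (simp add: reflect_def)
qed

text \<open>At \<open>t\<close>, the characteristic function of the left side is that of
  \<open>gauss I\<close> at the combination of the \<open>c j\<close> with coefficients
  \<open>t j\<close>, and orthonormality gives this combination the length of \<open>t\<close>. The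
  index sets may differ, so that projections to fewer coordinates are covered as well as
  rotations.\<close>

lemma distr_gauss_orthonormal:
  assumes "finite I" "finite J"
    and orth: "\<And>i j. i \<in> J \<Longrightarrow> j \<in> J \<Longrightarrow> ip I (c i) (c j) = (if i = j then 1 else 0)"
  shows "distr (gauss I) (borel_PiM J) (\<lambda>x. \<lambda>j\<in>J. ip I (c j) x) = gauss J"
proof (rule char_unique_PiM[OF \<open>finite J\<close>])
  have [measurable]: "(\<lambda>x. \<lambda>j\<in>J. ip I (c j) x) \<in> measurable (gauss I) (borel_PiM J)"
    unfolding ip_def by measurable
  show "prob_space (distr (gauss I) (borel_PiM J) (\<lambda>x. \<lambda>j\<in>J. ip I (c j) x))"
    by (rule gauss.prob_space_distr) measurable
  fix t :: "'b \<Rightarrow> real"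
  let ?s = "\<lambda>i. \<Sum>j\<in>J. t j * c j i"
  have "(CLINT x|distr (gauss I) (borel_PiM J) (\<lambda>x. \<lambda>j\<in>J. ip I (c j) x). iexp (\<Sum>i\<in>J. t i * x i)) =
      (CLINT x|gauss I. iexp (\<Sum>j\<in>J. t j * ip I (c j) x))"
    by (subst integral_distr) auto
  also have "\<dots> = (CLINT x|gauss I. iexp (\<Sum>i\<in>I. ?s i * x i))"
    by (simp only: ip_def[of I ?s, symmetric] ip_sum_left ip_mult_left)
  also have "\<dots> = complex_of_real (exp (- (\<Sum>i\<in>I. (?s i)\<^sup>2) / 2))"
    by (rule char_gauss[OF \<open>finite I\<close>])
  also have "(\<Sum>i\<in>I. (?s i)\<^sup>2) = ip I ?s ?s"
    by (simp add: ip_def power2_eq_square)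
  also have "ip I ?s ?s = (\<Sum>i\<in>J. t i * (\<Sum>j\<in>J. t j * ip I (c i) (c j)))"
    by (simp only: ip_sum_left ip_sum_right ip_linear sum_distrib_left)
  also have "\<dots> = (\<Sum>i\<in>J. t i * (\<Sum>j\<in>J. t j * (if i = j then 1 else 0)))"
    by (intro sum.cong refl arg_cong2[where f = "(*)"]) (auto simp: orth)
  also have "\<dots> = (\<Sum>i\<in>J. (t i)\<^sup>2)"
    using \<open>finite J\<close> by (simp add: if_distrib[of "\<lambda>u. _ * u"] sum.delta power2_eq_square cong: if_cong)
  also have "complex_of_real (exp (- (\<Sum>i\<in>J. (t i)\<^sup>2) / 2)) = (CLINT x|gauss J. iexp (\<Sum>i\<in>J. t i * x i))"
    by (rule char_gauss[OF \<open>finite J\<close>, symmetric])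
  finally show "(CLINT x|distr (gauss I) (borel_PiM J) (\<lambda>x. \<lambda>j\<in>J. ip I (c j) x). iexp (\<Sum>i\<in>J. t i * x i)) =
      (CLINT x|gauss J. iexp (\<Sum>i\<in>J. t i * x i))" .
qed (auto intro: prob_space_gauss simp: sets_gauss)

lemma borel_measurable_ip [measurable]:
  assumes "\<And>i. i \<in> I \<Longrightarrow> (\<lambda>w. f w i) \<in> borel_measurable M" "\<And>i. i \<in> I \<Longrightarrow> (\<lambda>w. g w i) \<in> borel_measurable M"
  shows "(\<lambda>w. ip I (f w) (g w)) \<in> borel_measurable M"
  unfolding ip_def using assms by measurable

lemma borel_measurable_L2_set [measurable]:
  assumes "\<And>i. i \<in> I \<Longrightarrow> (\<lambda>w. f w i) \<in> borel_measurable M"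
  shows "(\<lambda>w. L2_set (f w) I) \<in> borel_measurable M"
  unfolding L2_set_def using assms by measurable

text \<open>The coordinates of the reflected vector are the inner products of \<open>x\<close> with
  the reflected unit vectors, which are orthonormal.\<close>

lemma distr_gauss_reflect:
  assumes "finite I"
  shows "distr (gauss I) (borel_PiM I) (\<lambda>x. restrict (reflect I a x) I) = gauss I"
proof -
  let ?e = "\<lambda>j i. if i = j then 1 else 0 :: real"
  have "ip I (reflect I a (?e j)) x = reflect I a x j" if "j \<in> I" for j x
    using that assms by (simp add: ip_reflect_left ip_unit)
  then have "(\<lambda>x. \<lambda>j\<in>I. ip I (reflect I a (?e j)) x) = (\<lambda>x. restrict (reflect I a x) I)"
    by (auto simp: fun_eq_iff)
  moreover have "ip I (reflect I a (?e i)) (reflect I a (?e j)) = (if i = j then 1 else 0)" if "i \<in> I" "j \<in> I" for i j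
    using that assms by (simp add: ip_reflect ip_unit)
  ultimately show ?thesis
    using distr_gauss_orthonormal[OF assms assms, of "\<lambda>j. reflect I a (?e j)"] by simp
qed

lemma AE_gauss_nonzero:
  assumes "finite I" "I \<noteq> {}"
  shows "AE x in gauss I. L2_set x I \<noteq> 0"
proof -
  obtain i where i: "i \<in> I" using assms by blast
  have "AE y in std_normal_distribution. y \<noteq> 0"
    by (simp add: AE_density) (use AE_lborel_singleton[of "0::real"] in eventually_elim, auto)
  then have "AE x in gauss I. x i \<noteq> 0"
    unfolding gauss_def using i by (intro AE_PiM_component prob_space_std_normal)
  then show ?thesis
    by eventually_elim (use i assms in \<open>auto simp: L2_set_eq_0_iff\<close>)
qed

text \<open>The reflection that exchanges \<open>s\<close> and \<open>t\<close> preserves both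
  \<open>gauss I\<close> and the length in the denominator.\<close>

lemma direction_gauss_char:
  assumes I: "finite I" and st: "ip I s s = ip I t t"
  shows "(CLINT x|gauss I. iexp (ip I s x / L2_set x I)) = (CLINT x|gauss I. iexp (ip I t x / L2_set x I))"
proof -
  let ?a = "\<lambda>i. s i - t i"
  have [measurable]: "(\<lambda>x. restrict (reflect I ?a x) I) \<in> measurable (borel_PiM I) (borel_PiM I)"
    unfolding reflect_def by measurable
  have swap: "ip I s (restrict (reflect I ?a x) I) = ip I t x" for x
  proof -
    have "ip I s (restrict (reflect I ?a x) I) = ip I s (reflect I ?a x)"
      by (intro ip_cong) auto
    also have "\<dots> = ip I t x"
      unfolding ip_reflect_left[symmetric] by (intro ip_cong reflect_swap I st refl)
    finally show ?thesis .
  qed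
  have "(CLINT x|gauss I. iexp (ip I s x / L2_set x I)) =
      (CLINT x|distr (gauss I) (borel_PiM I) (\<lambda>x. restrict (reflect I ?a x) I). iexp (ip I s x / L2_set x I))"
    by (simp add: distr_gauss_reflect I)
  also have "\<dots> = (CLINT x|gauss I. iexp (ip I s (restrict (reflect I ?a x) I) / L2_set (restrict (reflect I ?a x) I) I))"
    by (subst integral_distr) auto
  finally show ?thesis
    by (simp add: swap L2_set_reflect)
qed

text \<open>If the characteristic function of \<open>Y\<close> depends only on the length of its
  argument, then \<open>Y\<close> is distributed like its length times an independent uniform
  direction, realised here as a normalised Gaussian vector.\<close>

theorem rotation_invariant_law:
  fixes Y :: "'w \<Rightarrow> 'i \<Rightarrow> real"
  assumes I: "finite I" "I \<noteq> {}" and "prob_space P" and Y[measurable]: "Y \<in> measurable P (borel_PiM I)"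
    and inv: "\<And>s t. ip I s s = ip I t t \<Longrightarrow> (CLINT w|P. iexp (ip I s (Y w))) = (CLINT w|P. iexp (ip I t (Y w)))"
  shows "distr P (borel_PiM I) Y =
    distr (P \<Otimes>\<^sub>M gauss I) (borel_PiM I) (\<lambda>(w, x). \<lambda>i\<in>I. L2_set (Y w) I / L2_set x I * x i)"
proof (rule char_unique_PiM[OF I(1)])
  interpret P: prob_space P by fact
  interpret PG: pair_prob_space P "gauss I" ..
  have [measurable]: "(\<lambda>w. Y w i) \<in> borel_measurable P" if "i \<in> I" for i
    using that by measurable
  show "prob_space (distr P (borel_PiM I) Y)"
    by (rule P.prob_space_distr) measurable
  show "prob_space (distr (P \<Otimes>\<^sub>M gauss I) (borel_PiM I) (\<lambda>(w, x). \<lambda>i\<in>I. L2_set (Y w) I / L2_set x I * x i))"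
    by (rule PG.prob_space_distr) measurable
  fix t :: "'i \<Rightarrow> real"
  have "(CLINT y|distr (P \<Otimes>\<^sub>M gauss I) (borel_PiM I) (\<lambda>(w, x). \<lambda>i\<in>I. L2_set (Y w) I / L2_set x I * x i).
      iexp (\<Sum>i\<in>I. t i * y i)) =
      (CLINT z|P \<Otimes>\<^sub>M gauss I. iexp (ip I (\<lambda>i. L2_set (Y (fst z)) I * t i) (snd z) / L2_set (snd z) I))"
    by (subst integral_distr)
       (auto simp: case_prod_beta ip_def sum_divide_distrib intro!: Bochner_Integration.integral_cong
         arg_cong[where f = exp] sum.cong)
  also have "\<dots> = (CLINT w|P. CLINT x|gauss I. iexp (ip I (\<lambda>i. L2_set (Y w) I * t i) x / L2_set x I))"
    by (subst PG.integral_fst'[symmetric])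
       (auto intro!: PG.integrable_const_bound[where B = 1])
  \<comment> \<open>The vectors \<open>|Y w| t\<close> and \<open>|t| (Y w)\<close> have the same
    length, so the direction of \<open>x\<close> cannot tell them apart. Afterwards
    \<open>Y w\<close> occurs linearly, and \<open>inv\<close> applies for fixed \<open>x\<close>
    because \<open>|t| x / |x|\<close> has the length of \<open>t\<close>.\<close>
  also have "\<dots> = (CLINT w|P. CLINT x|gauss I. iexp (ip I (\<lambda>i. L2_set t I * Y w i) x / L2_set x I))"
    by (rule Bochner_Integration.integral_cong[OF refl], rule direction_gauss_char[OF I(1)])
       (simp add: ip_linear ip_self power2_eq_square)
  also have "\<dots> = (CLINT x|gauss I. CLINT w|P. iexp (ip I (\<lambda>i. L2_set t I * Y w i) x / L2_set x I))"
    by (rule PG.Fubini_integral[symmetric])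
       (auto intro!: PG.integrable_const_bound[where B = 1] simp: case_prod_beta)
  also have "\<dots> = (CLINT x|gauss I. CLINT w|P. iexp (ip I t (Y w)))"
  proof (rule integral_cong_AE)
    show "AE x in gauss I. (CLINT w|P. iexp (ip I (\<lambda>i. L2_set t I * Y w i) x / L2_set x I)) = (CLINT w|P. iexp (ip I t (Y w)))"
      using AE_gauss_nonzero[OF I]
    proof eventually_elim
      case (elim x)
      have "ip I (\<lambda>i. L2_set t I * Y w i) x / L2_set x I = ip I (\<lambda>i. L2_set t I / L2_set x I * x i) (Y w)" for w
        by (simp only: ip_linear) (simp add: ip_commute[of I x])
      moreover have "ip I (\<lambda>i. L2_set t I / L2_set x I * x i) (\<lambda>i. L2_set t I / L2_set x I * x i) = ip I t t"
        using elim by (simp only: ip_linear) (simp add: ip_self power2_eq_square)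
      ultimately show ?case
        by (simp only:) (rule inv)
    qed
  qed auto
  also have "\<dots> = (CLINT w|P. iexp (ip I t (Y w)))"
    using gauss.prob_space[of I] by simp
  also have "\<dots> = (CLINT y|distr P (borel_PiM I) Y. iexp (\<Sum>i\<in>I. t i * y i))"
    by (subst integral_distr) (auto simp: ip_def)
  finally show "(CLINT y|distr P (borel_PiM I) Y. iexp (\<Sum>i\<in>I. t i * y i)) =
    (CLINT y|distr (P \<Otimes>\<^sub>M gauss I) (borel_PiM I) (\<lambda>(w, x). \<lambda>i\<in>I. L2_set (Y w) I / L2_set x I * x i). iexp (\<Sum>i\<in>I. t i * y i))"
    by simp
qed auto

section \<open>Small ball and tail estimates\<close>

lemma nn_integral_gauss_component:
  assumes "finite I" "i \<in> I" and [measurable]: "f \<in> borel_measurable borel"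
  shows "(\<integral>\<^sup>+x. f (x i) \<partial>gauss I) = (\<integral>\<^sup>+y. f y \<partial>std_normal_distribution)"
proof -
  have "(\<integral>\<^sup>+x. f (x i) \<partial>gauss I) = (\<integral>\<^sup>+x. (\<Prod>j\<in>I. (if j = i then f else (\<lambda>_. 1)) (x j)) \<partial>gauss I)"
    using assms by (intro nn_integral_cong) (simp add: if_distribR prod.delta cong: if_cong)
  also have "\<dots> = (\<Prod>j\<in>I. \<integral>\<^sup>+y. (if j = i then f else (\<lambda>_. 1)) y \<partial>std_normal_distribution)"
    unfolding gauss_def by (rule std_normal_PiM.product_nn_integral_prod) (auto simp: assms)
  also have "\<dots> = (\<Prod>j\<in>I. if j = i then \<integral>\<^sup>+y. f y \<partial>std_normal_distribution else 1)"
    using std_normal.emeasure_space_1 by (intro prod.cong) auto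
  finally show ?thesis
    using assms by (simp add: prod.delta)
qed

lemma nn_integral_std_normal_exp_square:
  assumes "0 \<le> c"
  shows "(\<integral>\<^sup>+x. ennreal (exp (- c * x\<^sup>2)) \<partial>std_normal_distribution) = ennreal (1 / sqrt (1 + 2 * c))"
proof -
  let ?b = "1 / sqrt (1 + 2 * c)"
  have b: "0 < ?b" "?b\<^sup>2 = 1 / (1 + 2 * c)"
    using assms by (auto simp: power_divide)
  have eq: "std_normal_density x * exp (- c * x\<^sup>2) = ?b * normal_density 0 ?b x" for x
  proof -
    have "exp (- x\<^sup>2 / 2) * exp (- c * x\<^sup>2) = exp (- x\<^sup>2 / (2 * ?b\<^sup>2))"
      unfolding b exp_add[symmetric] by (simp add: field_simps)
    then show ?thesis
      using b(1) by (simp add: normal_density_def std_normal_density_def real_sqrt_mult)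
  qed
  have "(\<integral>\<^sup>+x. ennreal (exp (- c * x\<^sup>2)) \<partial>std_normal_distribution) =
      (\<integral>\<^sup>+x. ennreal ?b * ennreal (normal_density 0 ?b x) \<partial>lborel)"
  proof -
    have "ennreal (std_normal_density x) * ennreal (exp (- c * x\<^sup>2)) = ennreal ?b * ennreal (normal_density 0 ?b x)" for x
      unfolding ennreal_mult[OF normal_density_nonneg exp_ge_zero, symmetric] eq
      using b(1) by (intro ennreal_mult) auto
    then show ?thesis
      by (subst nn_integral_density) auto
  qed
  also have "\<dots> = ennreal ?b * (\<integral>\<^sup>+x. ennreal (normal_density 0 ?b x) \<partial>lborel)"
    by (simp add: nn_integral_cmult)
  also have "(\<integral>\<^sup>+x. ennreal (normal_density 0 ?b x) \<partial>lborel) = 1"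
    using prob_space.emeasure_space_1[OF prob_space_normal_density[OF b(1), of 0]]
    by (simp add: emeasure_density)
  finally show ?thesis
    by simp
qed

lemma gauss_small_ball:
  assumes J: "finite J" "J \<noteq> {}" and "0 < r"
  shows "measure (gauss J) {x \<in> space (gauss J). L2_set x J \<le> r} \<le> (exp (1 / 2) * r / sqrt (card J)) ^ card J"
proof -
  define d where "d = real (card J)"
  have d: "0 < d" using J by (simp add: d_def card_gt_0_iff)
  \<comment> \<open>Exponential Markov inequality with \<open>exp (- c |x|^2)\<close>. This choice
    gives \<open>c r^2 = d / 2\<close>, hence the factor \<open>exp (d / 2)\<close>, and
    \<open>1 + 2 c \<ge> d / r^2\<close>.\<close>
  define c where "c = d / (2 * r\<^sup>2)"
  have c: "0 < c" "c * r\<^sup>2 = d / 2" using d \<open>0 < r\<close> by (auto simp: c_def)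
  let ?A = "{x \<in> space (gauss J). L2_set x J \<le> r}"
  have [measurable]: "?A \<in> sets (gauss J)"
    by measurable
  have sq: "(L2_set x J)\<^sup>2 = (\<Sum>j\<in>J. (x j)\<^sup>2)" for x
    by (simp add: L2_set_def sum_nonneg)
  have "emeasure (gauss J) ?A = (\<integral>\<^sup>+x. indicator ?A x \<partial>gauss J)"
    by simp
  also have "\<dots> \<le> (\<integral>\<^sup>+x. ennreal (exp (d / 2)) * (\<Prod>j\<in>J. ennreal (exp (- c * (x j)\<^sup>2))) \<partial>gauss J)"
  proof (intro nn_integral_mono)
    fix x
    have "1 \<le> exp (d / 2) * (\<Prod>j\<in>J. exp (- c * (x j)\<^sup>2))" if "L2_set x J \<le> r"
    proof -
      have "(L2_set x J)\<^sup>2 \<le> r\<^sup>2"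
        using that by (intro power_mono) auto
      then have "c * (\<Sum>j\<in>J. (x j)\<^sup>2) \<le> d / 2"
        using mult_left_mono[of "(L2_set x J)\<^sup>2" "r\<^sup>2" c] c by (simp add: sq)
      then have "0 \<le> d / 2 + (\<Sum>j\<in>J. - c * (x j)\<^sup>2)"
        by (simp add: sum_distrib_left sum_negf)
      then show ?thesis
        using J(1) by (simp only: exp_sum[symmetric] exp_add[symmetric] one_le_exp_iff)
    qed
    then show "indicator ?A x \<le> ennreal (exp (d / 2)) * (\<Prod>j\<in>J. ennreal (exp (- c * (x j)\<^sup>2)))"
      by (auto simp: indicator_def prod_ennreal ennreal_mult[symmetric] prod_nonneg simp flip: ennreal_1 intro!: ennreal_leI)
  qed
  also have "\<dots> = ennreal (exp (d / 2)) * (\<Prod>j\<in>J. \<integral>\<^sup>+x. ennreal (exp (- c * x\<^sup>2)) \<partial>std_normal_distribution)"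
    unfolding gauss_def using J(1)
    by (subst nn_integral_cmult, measurable) (subst std_normal_PiM.product_nn_integral_prod, auto)
  also have "\<dots> = ennreal (exp (d / 2) * (1 / sqrt (1 + 2 * c)) ^ card J)"
    using c by (subst nn_integral_std_normal_exp_square) (auto simp: ennreal_mult ennreal_power)
  also have "\<dots> \<le> ennreal ((exp (1 / 2) * r / sqrt (card J)) ^ card J)"
  proof (intro ennreal_leI)
    have "1 / sqrt (1 + 2 * c) \<le> r / sqrt d"
    proof -
      have "sqrt d / r = sqrt (d / r\<^sup>2)"
        using \<open>0 < r\<close> by (simp add: real_sqrt_divide)
      also have "\<dots> \<le> sqrt (1 + 2 * c)"
        by (simp add: c_def)
      finally show ?thesis
        using \<open>0 < r\<close> d c by (simp add: field_simps)
    qed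
    moreover have "exp (d / 2) = exp (1 / 2) ^ card J"
      by (simp add: d_def exp_of_nat_mult[symmetric])
    ultimately show "exp (d / 2) * (1 / sqrt (1 + 2 * c)) ^ card J \<le> (exp (1 / 2) * r / sqrt (card J)) ^ card J"
      unfolding d_def[symmetric] times_divide_eq_right[symmetric] power_mult_distrib
      using c by (auto intro!: mult_left_mono power_mono)
  qed
  finally show ?thesis
    using \<open>0 < r\<close> by (simp add: gauss.emeasure_eq_measure)
qed

text \<open>Markov's inequality for the squared length, whose mean is \<open>card I\<close>, at the
  level \<open>4 * card I\<close>.\<close>

lemma gauss_norm_upper:
  assumes I: "finite I" "I \<noteq> {}"
  shows "3 / 4 \<le> measure (gauss I) {x \<in> space (gauss I). L2_set x I \<le> 2 * sqrt (card I)}"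
proof -
  let ?m = "real (card I)"
  have m: "0 < ?m" using I by (simp add: card_gt_0_iff)
  have sq: "(L2_set x I)\<^sup>2 = (\<Sum>j\<in>I. (x j)\<^sup>2)" for x
    by (simp add: L2_set_def sum_nonneg)
  have one: "(\<integral>\<^sup>+x. ennreal (x\<^sup>2) \<partial>std_normal_distribution) = 1"
    using std_normal_distribution_even_moments[of 1]
    by (subst nn_integral_eq_integral) (auto simp: fact_numeral)
  let ?A = "{x \<in> space (gauss I). 1 \<le> ennreal (1 / (4 * ?m)) * ennreal ((L2_set x I)\<^sup>2)}"
  have "emeasure (gauss I) ?A \<le> ennreal (1 / (4 * ?m)) * (\<integral>\<^sup>+x. ennreal ((L2_set x I)\<^sup>2) \<partial>gauss I)"
    using nn_integral_Markov_inequality[of "\<lambda>x. ennreal ((L2_set x I)\<^sup>2)" "space (gauss I)" "gauss I" "ennreal (1 / (4 * ?m))"]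
    by (simp cong: nn_integral_cong)
  also have "(\<integral>\<^sup>+x. ennreal ((L2_set x I)\<^sup>2) \<partial>gauss I) = (\<Sum>j\<in>I. \<integral>\<^sup>+x. ennreal ((x j)\<^sup>2) \<partial>gauss I)"
    by (simp add: sq sum_ennreal[symmetric] nn_integral_sum del: sum_ennreal)
  also have "\<dots> = ennreal ?m"
    using I by (simp add: nn_integral_gauss_component[where f = "\<lambda>y. ennreal (y\<^sup>2)"] one ennreal_of_nat_eq_real_of_nat)
  also have "ennreal (1 / (4 * ?m)) * ennreal ?m = ennreal (1 / 4)"
    using m by (simp add: ennreal_mult[symmetric])
  finally have A: "measure (gauss I) ?A \<le> 1 / 4"
    by (simp add: gauss.emeasure_eq_measure)
  have "space (gauss I) - ?A \<subseteq> {x \<in> space (gauss I). L2_set x I \<le> 2 * sqrt ?m}"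
  proof safe
    fix x assume "\<not> 1 \<le> ennreal (1 / (4 * ?m)) * ennreal ((L2_set x I)\<^sup>2)"
    then have "(L2_set x I)\<^sup>2 / (4 * ?m) < 1"
      by (simp add: ennreal_mult[symmetric] ennreal_1[symmetric] not_le del: ennreal_1)
    then have "(L2_set x I)\<^sup>2 \<le> (2 * sqrt ?m)\<^sup>2"
      using m by (simp add: power_mult_distrib field_simps)
    then show "L2_set x I \<le> 2 * sqrt ?m"
      by (rule power2_le_imp_le) simp
  qed
  then have "measure (gauss I) (space (gauss I) - ?A) \<le> measure (gauss I) {x \<in> space (gauss I). L2_set x I \<le> 2 * sqrt ?m}"
    by (intro gauss.finite_measure_mono) measurable
  moreover have "measure (gauss I) (space (gauss I) - ?A) = 1 - measure (gauss I) ?A"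
    by (rule gauss.prob_compl) measurable
  ultimately show ?thesis
    using A by simp
qed

text \<open>The small ball estimate at radius \<open>sqrt (card I) / 2\<close> gives
  \<open>(exp (1 / 2) / 2) ^ card I\<close>, which is at most 7/8 because
  \<open>exp 1 \<le> 3 \<le> (7 / 4)^2\<close>.\<close>

lemma gauss_norm_lower:
  assumes I: "finite I" "I \<noteq> {}"
  shows "1 / 8 \<le> measure (gauss I) {x \<in> space (gauss I). sqrt (card I) / 2 \<le> L2_set x I}"
proof -
  let ?m = "card I"
  have m: "0 < ?m" using I by (simp add: card_gt_0_iff)
  let ?A = "{x \<in> space (gauss I). L2_set x I \<le> sqrt ?m / 2}"
  have "measure (gauss I) ?A \<le> (exp (1 / 2) / 2) ^ ?m"
    using gauss_small_ball[OF I, of "sqrt ?m / 2"] m by simp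
  moreover have e: "exp (1 / 2) / 2 \<le> (7 / 8 :: real)"
  proof -
    have "(exp (1 / 2) :: real)\<^sup>2 \<le> (7 / 4)\<^sup>2"
      using exp_le by (simp add: power2_eq_square exp_add[symmetric])
    then have "exp (1 / 2) \<le> (7 / 4 :: real)"
      by (rule power2_le_imp_le) simp
    then show ?thesis by simp
  qed
  moreover have "(exp (1 / 2) / 2 :: real) ^ ?m \<le> (exp (1 / 2) / 2) ^ 1"
    using m e by (intro power_decreasing) auto
  ultimately have A: "measure (gauss I) ?A \<le> 7 / 8"
    by simp
  have "measure (gauss I) (space (gauss I) - ?A) \<le> measure (gauss I) {x \<in> space (gauss I). sqrt ?m / 2 \<le> L2_set x I}"
    by (intro gauss.finite_measure_mono) auto
  moreover have "measure (gauss I) (space (gauss I) - ?A) = 1 - measure (gauss I) ?A"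
    by (rule gauss.prob_compl) measurable
  ultimately show ?thesis
    using A by simp
qed

text \<open>Length and direction of a Gaussian vector are independent:
  \<open>rotation_invariant_law\<close> for the identity map on \<open>gauss I\<close>.\<close>

lemma gauss_polar:
  assumes I: "finite I" "I \<noteq> {}" and [measurable]: "f \<in> borel_measurable (borel_PiM I)"
  shows "(\<integral>\<^sup>+x. f x \<partial>gauss I) = (\<integral>\<^sup>+x. \<integral>\<^sup>+y. f (\<lambda>i\<in>I. L2_set x I / L2_set y I * y i) \<partial>gauss I \<partial>gauss I)"
proof -
  have inv: "(CLINT x|gauss I. iexp (ip I s x)) = (CLINT x|gauss I. iexp (ip I t x))" if "ip I s s = ip I t t" for s t
    using that char_gauss[OF I(1), of s] char_gauss[OF I(1), of t]
    by (simp add: ip_def power2_eq_square)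
  have "gauss I = distr (gauss I) (borel_PiM I) (\<lambda>x. x)"
    by (rule distr_id2[symmetric]) (simp add: sets_gauss)
  also have "\<dots> = distr (gauss I \<Otimes>\<^sub>M gauss I) (borel_PiM I) (\<lambda>(x, y). \<lambda>i\<in>I. L2_set x I / L2_set y I * y i)"
    by (rule rotation_invariant_law[OF I prob_space_gauss _ inv]) auto
  finally have "(\<integral>\<^sup>+x. f x \<partial>gauss I) = (\<integral>\<^sup>+x. f x \<partial>distr (gauss I \<Otimes>\<^sub>M gauss I) (borel_PiM I)
      (\<lambda>(x, y). \<lambda>i\<in>I. L2_set x I / L2_set y I * y i))"
    by simp
  also have "\<dots> = (\<integral>\<^sup>+z. f (\<lambda>i\<in>I. L2_set (fst z) I / L2_set (snd z) I * snd z i) \<partial>(gauss I \<Otimes>\<^sub>M gauss I))"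
    by (subst nn_integral_distr) (auto simp: case_prod_beta)
  also have "\<dots> = (\<integral>\<^sup>+x. \<integral>\<^sup>+y. f (\<lambda>i\<in>I. L2_set x I / L2_set y I * y i) \<partial>gauss I \<partial>gauss I)"
    by (subst gauss.nn_integral_fst[symmetric]) auto
  finally show ?thesis .
qed

text \<open>By homogeneity and \<open>gauss_polar\<close>, the moment of \<open>h\<close> is the
  moment of the length times the moment of \<open>h x / |x|\<close>. The first factor is at least
  \<open>(sqrt (card I) / 2) ^ d / 8\<close> by \<open>gauss_norm_lower\<close>.\<close>

lemma normalized_homogeneous_moment:
  assumes I: "finite I" "I \<noteq> {}" and [measurable]: "h \<in> borel_measurable (borel_PiM I)"
    and h: "\<And>x. 0 \<le> h x" "\<And>c x. 0 \<le> c \<Longrightarrow> h (\<lambda>i\<in>I. c * x i) = c * h x"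
  shows "(\<integral>\<^sup>+x. ennreal ((h x / L2_set x I) ^ d) \<partial>gauss I) \<le>
    ennreal (8 * (2 / sqrt (card I)) ^ d) * (\<integral>\<^sup>+x. ennreal (h x ^ d) \<partial>gauss I)"
proof -
  let ?A = "{x \<in> space (gauss I). sqrt (card I) / 2 \<le> L2_set x I}"
  let ?D = "\<integral>\<^sup>+x. ennreal ((h x / L2_set x I) ^ d) \<partial>gauss I"
  have m: "0 < sqrt (card I)" using I by (simp add: card_gt_0_iff)
  have "ennreal (1 / 8) * ennreal ((sqrt (card I) / 2) ^ d) * ?D \<le> emeasure (gauss I) ?A * ennreal ((sqrt (card I) / 2) ^ d) * ?D"
    using gauss_norm_lower[OF I] by (intro mult_right_mono) (auto simp: gauss.emeasure_eq_measure)
  also have "\<dots> = (\<integral>\<^sup>+x. indicator ?A x * (ennreal ((sqrt (card I) / 2) ^ d) * ?D) \<partial>gauss I)"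
    by (subst nn_integral_multc) (auto simp: mult.assoc)
  also have "\<dots> \<le> (\<integral>\<^sup>+x. \<integral>\<^sup>+y. ennreal (h (\<lambda>i\<in>I. L2_set x I / L2_set y I * y i) ^ d) \<partial>gauss I \<partial>gauss I)"
  proof (intro nn_integral_mono)
    fix x assume "x \<in> space (gauss I)"
    have "(\<integral>\<^sup>+y. ennreal (h (\<lambda>i\<in>I. L2_set x I / L2_set y I * y i) ^ d) \<partial>gauss I) =
        (\<integral>\<^sup>+y. ennreal (L2_set x I ^ d) * ennreal ((h y / L2_set y I) ^ d) \<partial>gauss I)"
      by (intro nn_integral_cong, subst h(2))
         (simp_all add: h(1) power_mult_distrib power_divide ennreal_mult[symmetric])
    also have "\<dots> = ennreal (L2_set x I ^ d) * ?D"
      by (simp add: nn_integral_cmult)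
    finally show "indicator ?A x * (ennreal ((sqrt (card I) / 2) ^ d) * ?D) \<le>
        (\<integral>\<^sup>+y. ennreal (h (\<lambda>i\<in>I. L2_set x I / L2_set y I * y i) ^ d) \<partial>gauss I)"
      by (auto simp: indicator_def intro!: mult_right_mono ennreal_leI power_mono)
  qed
  also have "\<dots> = (\<integral>\<^sup>+x. ennreal (h x ^ d) \<partial>gauss I)"
    by (rule gauss_polar[OF I, symmetric]) measurable
  finally have "ennreal (8 * (2 / sqrt (card I)) ^ d) * (ennreal (1 / 8) * ennreal ((sqrt (card I) / 2) ^ d) * ?D) \<le>
      ennreal (8 * (2 / sqrt (card I)) ^ d) * (\<integral>\<^sup>+x. ennreal (h x ^ d) \<partial>gauss I)"
    by (intro mult_left_mono) auto
  moreover have "ennreal (8 * (2 / sqrt (card I)) ^ d) * (ennreal (1 / 8) * ennreal ((sqrt (card I) / 2) ^ d)) = 1"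
    using m by (simp add: ennreal_mult[symmetric] power_mult_distrib[symmetric] del: power_mult_distrib)
  ultimately show ?thesis
    by (simp add: mult.assoc[symmetric])
qed

text \<open>The event concerns only the direction of \<open>x\<close>. Combined with an independent
  length of at most \<open>2 * sqrt (card I)\<close> it becomes an event for a single Gaussian
  vector, whose projection is a Gaussian vector in dimension \<open>d\<close>. The factor 4/3 undoes
  the 3/4 of \<open>gauss_norm_upper\<close>.\<close>

lemma gauss_projection_small_ball:
  assumes I: "finite I" and d: "0 < d" and t: "0 < t"
    and orth: "\<And>i j. i < d \<Longrightarrow> j < d \<Longrightarrow> ip I (c i) (c j) = (if i = j then 1 else 0)"
  shows "measure (gauss I) {x \<in> space (gauss I). L2_set (\<lambda>j. ip I (c j) x) {..<d} \<le> t * L2_set x I} \<le>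
    4 / 3 * (2 * exp (1 / 2) * t * sqrt (card I) / sqrt d) ^ d"
proof -
  have ne: "I \<noteq> {}"
    using orth[of 0 0] d by (auto simp: ip_def)
  then have m: "0 < sqrt (card I)" using I by (simp add: card_gt_0_iff)
  let ?P = "\<lambda>x. L2_set (\<lambda>j. ip I (c j) x) {..<d}"
  let ?r = "t * (2 * sqrt (card I))"
  let ?A = "{x \<in> space (gauss I). ?P x \<le> t * L2_set x I}"
  let ?B = "{x \<in> space (gauss I). L2_set x I \<le> 2 * sqrt (card I)}"
  let ?C = "{x \<in> space (gauss I). ?P x \<le> ?r}"
  have [measurable]: "(\<lambda>x. \<lambda>j\<in>{..<d}. ip I (c j) x) \<in> measurable (gauss I) (borel_PiM {..<d})"
    by measurable
  have P_restrict: "?P x = L2_set (\<lambda>j\<in>{..<d}. ip I (c j) x) {..<d}" for x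
    by simp
  have "measure (gauss I) ?C = measure (distr (gauss I) (borel_PiM {..<d}) (\<lambda>x. \<lambda>j\<in>{..<d}. ip I (c j) x))
      {y \<in> space (gauss {..<d}). L2_set y {..<d} \<le> ?r}"
    by (subst measure_distr) (auto intro!: arg_cong[where f = "measure _"] simp: space_PiM space_gauss)
  also have "\<dots> \<le> (exp (1 / 2) * ?r / sqrt d) ^ d"
    using d t m gauss_small_ball[of "{..<d}" ?r] by (subst distr_gauss_orthonormal[OF I]) (auto simp: orth)
  finally have C: "measure (gauss I) ?C \<le> (2 * exp (1 / 2) * t * sqrt (card I) / sqrt d) ^ d"
    by (simp add: mult_ac)
  have "emeasure (gauss I) ?B * emeasure (gauss I) ?A = (\<integral>\<^sup>+x. \<integral>\<^sup>+y. indicator ?B x * indicator ?A y \<partial>gauss I \<partial>gauss I)"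
    by (simp add: nn_integral_cmult nn_integral_multc)
  also have "\<dots> \<le> (\<integral>\<^sup>+x. \<integral>\<^sup>+y. indicator ?C (\<lambda>i\<in>I. L2_set x I / L2_set y I * y i) \<partial>gauss I \<partial>gauss I)"
  proof (intro nn_integral_mono)
    fix x y
    have "?P (\<lambda>i\<in>I. L2_set x I / L2_set y I * y i) = L2_set x I * (?P y / L2_set y I)"
    proof -
      have "ip I (c j) (\<lambda>i\<in>I. L2_set x I / L2_set y I * y i) = L2_set x I / L2_set y I * ip I (c j) y" for j
        unfolding ip_mult_right[symmetric] by (intro ip_cong) auto
      then show ?thesis
        by (simp only:) (subst L2_set_cmult, simp_all)
    qed
    moreover have "?P y / L2_set y I \<le> t" if "?P y \<le> t * L2_set y I"
      using that t by (cases "L2_set y I = 0") (auto simp: divide_le_eq order.strict_iff_order)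
    ultimately have "?P (\<lambda>i\<in>I. L2_set x I / L2_set y I * y i) \<le> ?r" if "y \<in> ?A" "x \<in> ?B"
      using that m mult_mono[of "L2_set x I" "2 * sqrt (card I)" "?P y / L2_set y I" t] by (simp add: mult_ac)
    then show "indicator ?B x * indicator ?A y \<le> (indicator ?C (\<lambda>i\<in>I. L2_set x I / L2_set y I * y i) :: ennreal)"
      by (auto simp: indicator_def space_gauss)
  qed
  also have "\<dots> = (\<integral>\<^sup>+x. indicator ?C x \<partial>gauss I)"
    by (rule gauss_polar[OF I ne, symmetric]) measurable
  also have "\<dots> = emeasure (gauss I) ?C"
    by simp
  finally have "measure (gauss I) ?B * measure (gauss I) ?A \<le> measure (gauss I) ?C"
    by (simp add: gauss.emeasure_eq_measure ennreal_mult[symmetric])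
  moreover have "3 / 4 * measure (gauss I) ?A \<le> measure (gauss I) ?B * measure (gauss I) ?A"
    using gauss_norm_upper[OF I ne] by (intro mult_right_mono) auto
  ultimately show ?thesis
    using C by simp
qed

text \<open>The density is bounded below on the interval of length 1 that starts at
  \<open>sqrt d\<close>, where \<open>y^2 \<le> 2 d + 2\<close>. Since \<open>d \<ge> 1\<close>, the
  exponent \<open>- 4 d\<close> leaves a factor \<open>exp 2\<close> to spare, which pays for
  \<open>sqrt (2 pi)\<close>.\<close>

lemma std_normal_lower_tail:
  assumes "1 \<le> d"
  shows "exp (- 4 * d) \<le> measure std_normal_distribution {y. sqrt d \<le> y}"
proof -
  have dens: "exp (- 4 * d) \<le> std_normal_density y" if "sqrt d \<le> y" "y \<le> sqrt d + 1" for y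
  proof -
    have "y\<^sup>2 \<le> (sqrt d + 1)\<^sup>2"
      using that assms by (intro power_mono) (auto intro: order_trans[of _ "sqrt d"])
    also have "\<dots> \<le> 2 * d + 2"
    proof -
      have "0 \<le> (sqrt d - 1)\<^sup>2" by simp
      then show ?thesis
        using assms by (simp add: power2_eq_square algebra_simps)
    qed
    finally have "- 4 * d + 2 \<le> - y\<^sup>2 / 2"
      using assms by (simp add: field_simps)
    then have "exp (- 4 * d) * exp 2 \<le> exp (- y\<^sup>2 / 2)"
      by (simp flip: exp_add)
    moreover have "sqrt (2 * pi) \<le> exp 2"
    proof (rule real_le_lsqrt)
      have "3 \<le> exp (2::real)"
        using exp_ge_add_one_self[of 2] by simp
      then have "9 \<le> (exp 2 :: real)\<^sup>2"
        using power_mono[of 3 "exp 2 :: real" 2] by simp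
      then show "2 * pi \<le> (exp 2)\<^sup>2"
        using pi_less_4 by simp
    qed simp
    then have "exp (- 4 * d) * sqrt (2 * pi) \<le> exp (- 4 * d) * exp 2"
      by (intro mult_left_mono) auto
    ultimately have "exp (- 4 * d) * sqrt (2 * pi) \<le> exp (- y\<^sup>2 / 2)"
      by linarith
    then show ?thesis
      by (simp add: std_normal_density_def field_simps)
  qed
  have "ennreal (exp (- 4 * d)) = (\<integral>\<^sup>+y. ennreal (exp (- 4 * d)) * indicator {sqrt d..sqrt d + 1} y \<partial>lborel)"
    by (simp add: nn_integral_cmult)
  also have "\<dots> \<le> (\<integral>\<^sup>+y. ennreal (std_normal_density y) * indicator {y. sqrt d \<le> y} y \<partial>lborel)"
    by (intro nn_integral_mono) (auto simp: indicator_def intro!: ennreal_leI dens[simplified])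
  also have "\<dots> = emeasure std_normal_distribution {y. sqrt d \<le> y}"
    by (subst emeasure_density) auto
  finally show ?thesis
    by (simp add: std_normal.emeasure_eq_measure)
qed

text \<open>The inner product of \<open>u\<close> with the unit vector in the direction of
  \<open>x\<close> is a standard normal variable.\<close>

lemma gauss_halfspace:
  assumes I: "finite I" and d: "1 \<le> d" and x: "L2_set x I \<noteq> 0"
  shows "exp (- 4 * d) \<le> measure (gauss I) {u \<in> space (gauss I). sqrt d * L2_set x I \<le> ip I x u}"
proof -
  let ?J = "{0::nat}" and ?c = "\<lambda>_::nat. \<lambda>i. 1 / L2_set x I * x i"
  have r: "0 < L2_set x I" using x by (simp add: order.strict_iff_order)
  have "ip I (?c 0) (?c 0) = 1"
    using x by (simp only: ip_linear) (simp add: ip_self power2_eq_square)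
  then have D: "distr (gauss I) (borel_PiM ?J) (\<lambda>u. \<lambda>j\<in>?J. ip I (?c j) u) = gauss ?J"
    by (intro distr_gauss_orthonormal I) auto
  have [measurable]: "(\<lambda>u. \<lambda>j\<in>?J. ip I (?c j) u) \<in> measurable (gauss I) (borel_PiM ?J)"
    by measurable
  have "emeasure std_normal_distribution {y. sqrt d \<le> y} = (\<integral>\<^sup>+y. indicator {y. sqrt d \<le> y} y \<partial>std_normal_distribution)"
    by simp
  also have "\<dots> = (\<integral>\<^sup>+u. indicator {y. sqrt d \<le> y} (u 0) \<partial>gauss ?J)"
    by (rule nn_integral_gauss_component[symmetric]) auto
  also have "\<dots> = (\<integral>\<^sup>+u. indicator {y. sqrt d \<le> y} (ip I (?c 0) u) \<partial>gauss I)"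
    by (subst D[symmetric], subst nn_integral_distr) auto
  also have "\<dots> = (\<integral>\<^sup>+u. indicator {u \<in> space (gauss I). sqrt d * L2_set x I \<le> ip I x u} u \<partial>gauss I)"
    using r by (intro nn_integral_cong) (simp only: ip_linear, auto simp: indicator_def field_simps)
  also have "\<dots> = emeasure (gauss I) {u \<in> space (gauss I). sqrt d * L2_set x I \<le> ip I x u}"
    by (subst nn_integral_indicator) auto
  finally show ?thesis
    using std_normal_lower_tail[OF d] by (simp add: std_normal.emeasure_eq_measure gauss.emeasure_eq_measure)
qed

section \<open>Moments of norms of Gaussian vectors\<close>

lemma nn_integral_std_normal_abs:
  assumes [measurable]: "f \<in> borel_measurable borel"
  shows "(\<integral>\<^sup>+x. f \<bar>x\<bar> \<partial>std_normal_distribution) =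
    2 * (\<integral>\<^sup>+x. f x * ennreal (std_normal_density x) * indicator {0<..} x \<partial>lborel)"
proof -
  let ?g = "\<lambda>x. f \<bar>x\<bar> * ennreal (std_normal_density x)"
  have "(\<integral>\<^sup>+x. f \<bar>x\<bar> \<partial>std_normal_distribution) = (\<integral>\<^sup>+x. ?g x \<partial>lborel)"
    by (subst nn_integral_density) (auto simp: mult.commute)
  also have "\<dots> = (\<integral>\<^sup>+x. ?g x * indicator {0<..} x + ?g x * indicator {..<0} x \<partial>lborel)"
  proof (rule nn_integral_cong_AE)
    show "AE x in lborel. ?g x = ?g x * indicator {0<..} x + ?g x * indicator {..<0} x"
      using AE_lborel_singleton[of "0::real"] by eventually_elim (auto simp: indicator_def)
  qed
  also have "\<dots> = (\<integral>\<^sup>+x. ?g x * indicator {0<..} x \<partial>lborel) + (\<integral>\<^sup>+x. ?g x * indicator {..<0} x \<partial>lborel)"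
    by (rule nn_integral_add) measurable
  also have "(\<integral>\<^sup>+x. ?g x * indicator {..<0} x \<partial>lborel) = (\<integral>\<^sup>+x. ?g (- x) * indicator {..<0} (- x) \<partial>lborel)"
    by (subst nn_integral_real_affine[where c = "-1" and t = 0]) auto
  also have "\<dots> = (\<integral>\<^sup>+x. ?g x * indicator {0<..} x \<partial>lborel)"
    by (intro nn_integral_cong) (auto simp: indicator_def std_normal_density_def)
  also have "(\<integral>\<^sup>+x. ?g x * indicator {0<..} x \<partial>lborel) = (\<integral>\<^sup>+x. f x * ennreal (std_normal_density x) * indicator {0<..} x \<partial>lborel)"
    by (intro nn_integral_cong) (auto simp: indicator_def)
  finally show ?thesis
    by (simp add: mult_2)
qed

lemma nn_integral_std_normal_tail_moment:
  assumes "0 \<le> y"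
  shows "(\<integral>\<^sup>+x. ennreal (x * std_normal_density x) * indicator {y..} x \<partial>lborel) = ennreal (std_normal_density y)"
proof -
  have "((\<lambda>x. - (exp (- x\<^sup>2 / 2) / sqrt (2 * pi))) \<longlongrightarrow> - (0 / sqrt (2 * pi))) at_top"
    by (intro tendsto_intros filterlim_compose[OF exp_at_bot])
       (simp_all add: filterlim_uminus_at_bot filterlim_pow_at_top filterlim_ident
         filterlim_tendsto_pos_mult_at_top[OF tendsto_const, of "1/2", simplified])
  then have lim: "((\<lambda>x. - std_normal_density x) \<longlongrightarrow> 0) at_top"
    by (simp add: std_normal_density_def)
  have "((\<lambda>x. - (c * exp (- x\<^sup>2 / 2))) has_real_derivative x * (c * exp (- x\<^sup>2 / 2))) (at x)" for c x :: real
    by (auto intro!: derivative_eq_intros)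
  then have deriv: "((\<lambda>x. - std_normal_density x) has_real_derivative x * std_normal_density x) (at x)" for x
    unfolding std_normal_density_def .
  have "(\<integral>\<^sup>+x. ennreal (x * std_normal_density x) * indicator {y..} x \<partial>lborel) = ennreal (0 - (- std_normal_density y))"
    using assms by (intro nn_integral_FTC_atLeast[OF _ deriv _ lim]) auto
  then show ?thesis by simp
qed

text \<open>Bound \<open>H x\<close> by the integral of \<open>H'\<close> from 0 to
  \<open>x\<close>, exchange the integrals, and use that \<open>x * std_normal_density x\<close>
  integrates to \<open>std_normal_density y\<close> over the half-line from \<open>y\<close>.
  Differentiability is asked for off 0 only, because \<open>H\<close> will be built from real
  powers.\<close>

lemma std_normal_integration_by_parts:
  assumes [measurable]: "H \<in> borel_measurable borel" "H' \<in> borel_measurable borel"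
    and deriv: "\<And>x. 0 < x \<Longrightarrow> (H has_real_derivative H' x) (at x)"
    and nonneg: "\<And>x. 0 < x \<Longrightarrow> 0 \<le> H' x"
    and lim: "(H \<longlongrightarrow> 0) (at_right 0)"
  shows "(\<integral>\<^sup>+x. ennreal (\<bar>x\<bar> * H \<bar>x\<bar>) \<partial>std_normal_distribution) \<le> (\<integral>\<^sup>+x. ennreal (H' \<bar>x\<bar>) \<partial>std_normal_distribution)"
proof -
  have H_le: "ennreal (H x) \<le> (\<integral>\<^sup>+y. ennreal (H' y) * indicator {0<..x} y \<partial>lborel)" if x: "0 < x" for x
  proof (rule tendsto_upperbound)
    show "((\<lambda>e. ennreal (H x - H e)) \<longlongrightarrow> ennreal (H x)) (at_right 0)"
      using tendsto_diff[OF tendsto_const lim, of "H x"] by (intro tendsto_ennrealI) simp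
    show "\<forall>\<^sub>F e in at_right 0. ennreal (H x - H e) \<le> (\<integral>\<^sup>+y. ennreal (H' y) * indicator {0<..x} y \<partial>lborel)"
      using eventually_at_right_real[OF x]
    proof eventually_elim
      case (elim e)
      then have "(\<integral>\<^sup>+y. ennreal (H' y) * indicator {e..x} y \<partial>lborel) = ennreal (H x - H e)"
        by (intro nn_integral_FTC_Icc deriv nonneg) simp_all
      moreover have "(\<integral>\<^sup>+y. ennreal (H' y) * indicator {e..x} y \<partial>lborel) \<le> (\<integral>\<^sup>+y. ennreal (H' y) * indicator {0<..x} y \<partial>lborel)"
        using elim by (intro nn_integral_mono mult_left_mono) (auto simp: indicator_def)
      ultimately show ?case by simp
    qed
  qed simp
  have "(\<integral>\<^sup>+x. ennreal (\<bar>x\<bar> * H \<bar>x\<bar>) \<partial>std_normal_distribution) =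
      2 * (\<integral>\<^sup>+x. ennreal (x * H x) * ennreal (std_normal_density x) * indicator {0<..} x \<partial>lborel)"
    by (rule nn_integral_std_normal_abs) measurable
  also have "(\<integral>\<^sup>+x. ennreal (x * H x) * ennreal (std_normal_density x) * indicator {0<..} x \<partial>lborel) \<le>
      (\<integral>\<^sup>+x. \<integral>\<^sup>+y. (ennreal (H' y) * indicator {0<..} y) * (ennreal (x * std_normal_density x) * indicator {y..} x) \<partial>lborel \<partial>lborel)"
  proof (intro nn_integral_mono)
    fix x :: real
    show "ennreal (x * H x) * ennreal (std_normal_density x) * indicator {0<..} x \<le>
      (\<integral>\<^sup>+y. (ennreal (H' y) * indicator {0<..} y) * (ennreal (x * std_normal_density x) * indicator {y..} x) \<partial>lborel)"
    proof (cases "0 < x")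
      case True
      have "ennreal (x * H x) * ennreal (std_normal_density x) = ennreal (x * std_normal_density x) * ennreal (H x)"
        using True by (simp only: ennreal_mult'[OF less_imp_le[OF True]] mult_ac)
      also have "\<dots> \<le> ennreal (x * std_normal_density x) * (\<integral>\<^sup>+y. ennreal (H' y) * indicator {0<..x} y \<partial>lborel)"
        by (intro mult_left_mono H_le True) simp
      also have "\<dots> = (\<integral>\<^sup>+y. ennreal (x * std_normal_density x) * (ennreal (H' y) * indicator {0<..x} y) \<partial>lborel)"
        by (simp add: nn_integral_cmult)
      also have "\<dots> = (\<integral>\<^sup>+y. (ennreal (H' y) * indicator {0<..} y) * (ennreal (x * std_normal_density x) * indicator {y..} x) \<partial>lborel)"
        by (intro nn_integral_cong) (auto simp: indicator_def mult_ac)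
      finally show ?thesis
        using True by simp
    qed simp
  qed
  also have "\<dots> = (\<integral>\<^sup>+y. \<integral>\<^sup>+x. (ennreal (H' y) * indicator {0<..} y) * (ennreal (x * std_normal_density x) * indicator {y..} x) \<partial>lborel \<partial>lborel)"
    by (rule lborel_pair.Fubini') (simp add: case_prod_beta indicator_def[of "{_..}"])
  also have "\<dots> = (\<integral>\<^sup>+y. (ennreal (H' y) * indicator {0<..} y) * (\<integral>\<^sup>+x. ennreal (x * std_normal_density x) * indicator {y..} x \<partial>lborel) \<partial>lborel)"
    by (intro nn_integral_cong nn_integral_cmult) simp
  also have "\<dots> = (\<integral>\<^sup>+y. ennreal (H' y) * ennreal (std_normal_density y) * indicator {0<..} y \<partial>lborel)"
    by (intro nn_integral_cong) (auto simp: nn_integral_std_normal_tail_moment split: split_indicator)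
  also have "2 * \<dots> = (\<integral>\<^sup>+x. ennreal (H' \<bar>x\<bar>) \<partial>std_normal_distribution)"
    by (rule nn_integral_std_normal_abs[symmetric]) measurable
  finally show ?thesis
    by (simp add: mult_left_mono)
qed

section \<open>Moments of weighted l_q norms for \<open>q \<ge> 2\<close>\<close>

lemma powr_le_affine:
  fixes y t :: real
  assumes "0 \<le> y" "0 \<le> t" "t \<le> 1"
  shows "y powr t \<le> t * y + (1 - t)"
proof (cases "y = 0")
  case False
  then show ?thesis
    using Youngs_inequality_0[of t "1 - t" y 1] assms by simp
qed (use assms in simp)

text \<open>Hoelder's inequality with weights \<open>a\<close> and exponents \<open>q / 2\<close>
  and \<open>q / (q - 2)\<close>; after normalisation by \<open>Z / S\<close> each term is an
  instance of \<open>powr_le_affine\<close>. For \<open>q = 2\<close> and \<open>Z = 0\<close> it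
  rests on the convention \<open>0 powr 0 = 0\<close>.\<close>

lemma sum_mult_powr_le:
  fixes a w :: "'i \<Rightarrow> real"
  assumes "finite I" and q: "2 \<le> q" and a: "\<And>i. i \<in> I \<Longrightarrow> 0 \<le> a i" and w: "\<And>i. i \<in> I \<Longrightarrow> 0 \<le> w i"
  shows "(\<Sum>i\<in>I. a i * w i powr (q - 2)) \<le> (\<Sum>i\<in>I. a i) powr (2 / q) * (\<Sum>i\<in>I. a i * w i powr q) powr ((q - 2) / q)"
proof -
  define S where "S = (\<Sum>i\<in>I. a i)"
  define Z where "Z = (\<Sum>i\<in>I. a i * w i powr q)"
  define t where "t = (q - 2) / q"
  have t: "0 \<le> t" "t \<le> 1" "1 - t = 2 / q" "q * t = q - 2"
    using q by (auto simp: t_def field_simps)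
  have nonneg: "0 \<le> S" "0 \<le> Z"
    unfolding S_def Z_def using a by (auto intro!: sum_nonneg)
  show ?thesis
  proof (cases "Z = 0")
    case True
    then have "a i = 0 \<or> w i = 0" if "i \<in> I" for i
      using that assms unfolding Z_def by (subst (asm) sum_nonneg_eq_0_iff) auto
    then have "(\<Sum>i\<in>I. a i * w i powr (q - 2)) = 0"
      by (intro sum.neutral) auto
    then show ?thesis
      by simp
  next
    case False
    then have Z: "0 < Z" using nonneg by simp
    have "S \<noteq> 0"
    proof
      assume "S = 0"
      then have "\<forall>i\<in>I. a i = 0"
        using a assms(1) unfolding S_def by (subst (asm) sum_nonneg_eq_0_iff) auto
      then show False
        using False by (simp add: Z_def)
    qed
    then have S: "0 < S" using nonneg by simp
    have scale: "w i powr (q - 2) = (Z / S) powr t * (w i powr q * (S / Z)) powr t" for i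
    proof -
      have "(Z / S) powr t * (w i powr q * (S / Z)) powr t = ((Z / S) * (w i powr q * (S / Z))) powr t"
        using S Z by (subst powr_mult) auto
      also have "(Z / S) * (w i powr q * (S / Z)) = w i powr q"
        using S Z by simp
      finally show ?thesis
        by (simp add: powr_powr t)
    qed
    have "(\<Sum>i\<in>I. a i * w i powr (q - 2)) = (Z / S) powr t * (\<Sum>i\<in>I. a i * (w i powr q * (S / Z)) powr t)"
      unfolding sum_distrib_left by (intro sum.cong refl) (subst scale, simp only: mult_ac)
    also have "\<dots> \<le> (Z / S) powr t * (\<Sum>i\<in>I. a i * (t * (w i powr q * (S / Z)) + (1 - t)))"
      using S Z a t by (intro mult_left_mono sum_mono powr_le_affine) auto
    also have "(\<Sum>i\<in>I. a i * (t * (w i powr q * (S / Z)) + (1 - t))) =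
        (\<Sum>i\<in>I. (t * (S / Z)) * (a i * w i powr q) + (1 - t) * a i)"
      by (intro sum.cong refl) (simp only: distrib_left mult_ac)
    also have "\<dots> = t * (S / Z) * Z + (1 - t) * S"
      unfolding sum.distrib S_def Z_def sum_distrib_left ..
    also have "\<dots> = S"
      using Z by (simp add: algebra_simps)
    also have "(Z / S) powr t * S = S powr (2 / q) * Z powr t"
    proof -
      have "(Z / S) powr t * S = Z powr t * (S powr 1 / S powr t)"
        using S Z by (simp add: powr_divide)
      also have "S powr 1 / S powr t = S powr (2 / q)"
        unfolding powr_diff[symmetric] t ..
      finally show ?thesis by simp
    qed
    finally show ?thesis
      by (simp add: S_def Z_def t_def)
  qed
qed

text \<open>Each summand is \<open>z i * z i powr (e - 1)\<close>, and the second factor grows when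
  \<open>z i\<close> is replaced by the total.\<close>

lemma sum_powr_le_powr_sum:
  fixes z :: "'i \<Rightarrow> real"
  assumes "finite I" "1 \<le> e" and z: "\<And>i. i \<in> I \<Longrightarrow> 0 \<le> z i"
  shows "(\<Sum>i\<in>I. z i powr e) \<le> (\<Sum>i\<in>I. z i) powr e"
proof -
  let ?Z = "\<Sum>i\<in>I. z i"
  have "z i powr e \<le> z i * ?Z powr (e - 1)" if "i \<in> I" for i
  proof -
    have "z i powr e = z i * z i powr (e - 1)"
      using z[OF that] by (cases "z i = 0") (auto simp: powr_diff)
    also have "\<dots> \<le> z i * ?Z powr (e - 1)"
      using assms that by (intro mult_left_mono powr_mono2 member_le_sum) auto
    finally show ?thesis .
  qed
  then have "(\<Sum>i\<in>I. z i powr e) \<le> (\<Sum>i\<in>I. z i * ?Z powr (e - 1))"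
    by (rule sum_mono)
  also have "\<dots> = ?Z * ?Z powr (e - 1)"
    by (simp add: sum_distrib_right)
  also have "\<dots> = ?Z powr e"
    using z by (cases "?Z = 0") (auto simp: powr_diff sum_nonneg)
  finally show ?thesis .
qed

lemma std_normal_moment_powr_ibp:
  assumes q: "2 \<le> q" and e: "0 < e" and a: "0 < a" and c: "0 \<le> c"
  shows "(\<integral>\<^sup>+x. ennreal (\<bar>x\<bar> powr q * (c + a * \<bar>x\<bar> powr q) powr e) \<partial>std_normal_distribution) \<le>
    (\<integral>\<^sup>+x. ennreal ((q - 1) * \<bar>x\<bar> powr (q - 2) * (c + a * \<bar>x\<bar> powr q) powr e +
      e * q * a * \<bar>x\<bar> powr (2 * q - 2) * (c + a * \<bar>x\<bar> powr q) powr (e - 1)) \<partial>std_normal_distribution)"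
proof -
  define H where "H x = x powr (q - 1) * (c + a * x powr q) powr e" for x
  define H' where "H' x = (q - 1) * x powr (q - 2) * (c + a * x powr q) powr e +
      e * q * a * x powr (2 * q - 2) * (c + a * x powr q) powr (e - 1)" for x
  have [measurable]: "H \<in> borel_measurable borel" "H' \<in> borel_measurable borel"
    unfolding H_def H'_def by measurable
  have "(\<integral>\<^sup>+x. ennreal (\<bar>x\<bar> * H \<bar>x\<bar>) \<partial>std_normal_distribution) \<le> (\<integral>\<^sup>+x. ennreal (H' \<bar>x\<bar>) \<partial>std_normal_distribution)"
  proof (rule std_normal_integration_by_parts)
    fix x :: real assume x: "0 < x"
    then have pos: "0 < c + a * x powr q"
      using a c by (simp add: add_nonneg_pos)
    have "(H has_real_derivative
        (q - 1) * x powr (q - 1 - 1) * (c + a * x powr q) powr e +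
        e * (c + a * x powr q) powr (e - 1) * (a * (q * x powr (q - 1))) * x powr (q - 1)) (at x)"
      unfolding H_def using x pos
      by (auto intro!: derivative_eq_intros)
    moreover have "x powr (2 * q - 2) = x powr (q - 1) * x powr (q - 1)"
      by (simp flip: powr_add)
    ultimately show "(H has_real_derivative H' x) (at x)"
      by (simp add: H'_def mult_ac)
    show "0 \<le> H' x"
      using q e a c by (simp add: H'_def)
  next
    have "(H \<longlongrightarrow> 0 powr (q - 1) * (c + a * 0 powr q) powr e) (at_right 0)"
      unfolding H_def using q e a c
      by (intro tendsto_mult tendsto_powr2 tendsto_add tendsto_const tendsto_ident_at)
         (auto simp: eventually_at_right_less intro!: eventually_at_right_less[THEN eventually_mono])
    then show "(H \<longlongrightarrow> 0) (at_right 0)"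
      by simp
  qed measurable
  moreover have "\<bar>x\<bar> * H \<bar>x\<bar> = \<bar>x\<bar> powr q * (c + a * \<bar>x\<bar> powr q) powr e" for x
    using q by (cases "x = 0") (auto simp: H_def powr_diff)
  ultimately show ?thesis
    by (simp add: H'_def)
qed

lemma nn_integral_gauss_split:
  assumes "finite I" "i \<in> I" and [measurable]: "f \<in> borel_measurable (borel_PiM I)"
  shows "(\<integral>\<^sup>+x. f x \<partial>gauss I) = (\<integral>\<^sup>+x. \<integral>\<^sup>+y. f (x(i := y)) \<partial>std_normal_distribution \<partial>gauss (I - {i}))"
proof -
  have I: "insert i (I - {i}) = I"
    using \<open>i \<in> I\<close> by auto
  have "sets (PiM (insert i (I - {i})) (\<lambda>_. std_normal_distribution)) = sets (borel_PiM I)"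
    unfolding I using sets_gauss[of I] by (simp add: gauss_def)
  then have "f \<in> borel_measurable (PiM (insert i (I - {i})) (\<lambda>_. std_normal_distribution))"
    using assms(3) measurable_cong_sets by blast
  then show ?thesis
    using std_normal_PiM.product_nn_integral_insert[of "I - {i}" i f] \<open>finite I\<close>
    unfolding I by (simp add: gauss_def)
qed

text \<open>Trades a sum for a product, whose integral over independent coordinates
  factorises.\<close>

lemma sum_le_prod_1_plus:
  fixes z :: "'i \<Rightarrow> real"
  assumes "finite I" "\<And>i. i \<in> I \<Longrightarrow> 0 \<le> z i"
  shows "(\<Sum>i\<in>I. z i) \<le> (\<Prod>i\<in>I. 1 + z i)"
  using assms
proof (induction I)
  case (insert i I)
  have "1 \<le> (\<Prod>i\<in>I. 1 + z i)"
    using insert.prems by (intro prod_ge_1) auto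
  then have "z i * 1 \<le> z i * (\<Prod>i\<in>I. 1 + z i)"
    using insert.prems by (intro mult_left_mono) auto
  then show ?case
    using insert by (simp add: distrib_right)
qed simp

lemma std_normal_moment_powr_finite:
  assumes "0 \<le> a" "0 < q" "0 < m"
  shows "(\<integral>\<^sup>+x. ennreal ((1 + a * \<bar>x\<bar> powr q) powr m) \<partial>std_normal_distribution) < \<infinity>"
proof -
  obtain k :: nat where k: "q * m \<le> real k"
    using real_arch_simple by blast
  let ?c = "(1 + a) powr m"
  have le: "(1 + a * \<bar>x\<bar> powr q) powr m \<le> ?c * (1 + \<bar>x\<bar> ^ k)" for x
  proof -
    define M where "M = max 1 \<bar>x\<bar>"
    have M: "1 \<le> M" "\<bar>x\<bar> \<le> M" by (auto simp: M_def)
    have "1 \<le> M powr q" using M assms by (simp add: ge_one_powr_ge_zero)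
    moreover have "a * \<bar>x\<bar> powr q \<le> a * M powr q"
      using M assms by (intro mult_left_mono powr_mono2) auto
    ultimately have "1 + a * \<bar>x\<bar> powr q \<le> (1 + a) * M powr q"
      by (simp add: distrib_right)
    then have "(1 + a * \<bar>x\<bar> powr q) powr m \<le> ((1 + a) * M powr q) powr m"
      using assms by (intro powr_mono2) auto
    also have "\<dots> = (1 + a) powr m * M powr (q * m)"
      using assms M by (simp add: powr_mult powr_powr)
    also have "\<dots> \<le> (1 + a) powr m * M powr k"
      using k M by (intro mult_left_mono powr_mono) auto
    also have "M powr k = M ^ k"
      using M by (simp add: powr_realpow)
    also have "M ^ k \<le> 1 + \<bar>x\<bar> ^ k"
      by (auto simp: M_def max_def)
    finally show ?thesis by (simp add: mult_left_mono)
  qed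
  have int: "integrable std_normal_distribution (\<lambda>x. ?c * (1 + \<bar>x\<bar> ^ k))"
    using integrable_abs[OF integrable_std_normal_distribution_moment[of k]] by (simp add: power_abs)
  have "(\<integral>\<^sup>+x. ennreal ((1 + a * \<bar>x\<bar> powr q) powr m) \<partial>std_normal_distribution) \<le>
      (\<integral>\<^sup>+x. ennreal (?c * (1 + \<bar>x\<bar> ^ k)) \<partial>std_normal_distribution)"
    by (intro nn_integral_mono ennreal_leI le)
  also have "\<dots> = ennreal (\<integral>x. ?c * (1 + \<bar>x\<bar> ^ k) \<partial>std_normal_distribution)"
    by (rule nn_integral_eq_integral[OF int]) simp
  also have "\<dots> < \<infinity>"
    by simp
  finally show ?thesis .
qed

text \<open>Finiteness permits the moment to be cancelled from both sides of the inequality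
  \<open>ineq\<close> in \<open>gauss_lq_moment\<close>.\<close>

lemma gauss_moment_powr_finite:
  assumes "finite I" and a: "\<And>i. i \<in> I \<Longrightarrow> 0 \<le> a i" and "0 < q" "0 < m"
  shows "(\<integral>\<^sup>+x. ennreal ((\<Sum>i\<in>I. a i * \<bar>x i\<bar> powr q) powr m) \<partial>gauss I) < \<infinity>"
proof -
  have "(\<integral>\<^sup>+x. ennreal ((\<Sum>i\<in>I. a i * \<bar>x i\<bar> powr q) powr m) \<partial>gauss I) \<le>
      (\<integral>\<^sup>+x. (\<Prod>i\<in>I. ennreal ((1 + a i * \<bar>x i\<bar> powr q) powr m)) \<partial>gauss I)"
  proof (intro nn_integral_mono)
    fix x
    have "(\<Sum>i\<in>I. a i * \<bar>x i\<bar> powr q) powr m \<le> (\<Prod>i\<in>I. 1 + a i * \<bar>x i\<bar> powr q) powr m"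
      using assms by (intro powr_mono2 sum_le_prod_1_plus sum_nonneg) auto
    also have "\<dots> = (\<Prod>i\<in>I. (1 + a i * \<bar>x i\<bar> powr q) powr m)"
      by (rule prod_powr_distrib)
    finally show "ennreal ((\<Sum>i\<in>I. a i * \<bar>x i\<bar> powr q) powr m) \<le> (\<Prod>i\<in>I. ennreal ((1 + a i * \<bar>x i\<bar> powr q) powr m))"
      by (subst prod_ennreal) (auto intro: ennreal_leI)
  qed
  also have "\<dots> = (\<Prod>i\<in>I. \<integral>\<^sup>+x. ennreal ((1 + a i * \<bar>x\<bar> powr q) powr m) \<partial>std_normal_distribution)"
    unfolding gauss_def by (rule std_normal_PiM.product_nn_integral_prod) (auto simp: assms)
  also have "\<dots> < \<infinity>"
    using std_normal_moment_powr_finite[OF a assms(3,4)]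
    by (auto simp: less_top[symmetric] ennreal_prod_eq_top)
  finally show ?thesis .
qed

text \<open>With \<open>h = Z powr (1 / q)\<close>, the moment of \<open>h\<close> of order
  \<open>q + d\<close> is bounded by \<open>A\<close> times the one of order
  \<open>q + d - 2\<close>. Split off one factor \<open>Z\<close>, write it as a sum over
  \<open>i\<close>, and integrate each term by parts in \<open>x i\<close>. Differentiating
  \<open>|x i| powr (q - 1)\<close> leads to the first summand of \<open>A\<close> by Hoelder's
  inequality; differentiating \<open>Z powr (d / q)\<close> leads to the second because
  \<open>s i \<le> R\<close>.\<close>

lemma gauss_lq_moment_aux:
  fixes s :: "'i \<Rightarrow> real" and d q R :: real and I :: "'i set"
  defines "Z \<equiv> \<lambda>x. \<Sum>i\<in>I. s i powr q * \<bar>x i\<bar> powr q"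
    and "A \<equiv> (q - 1) * (\<Sum>i\<in>I. s i powr q) powr (2 / q) + d * R\<^sup>2"
  assumes I: "finite I" and q: "2 \<le> q" and d: "0 < d" and s: "\<And>i. i \<in> I \<Longrightarrow> 0 \<le> s i" "\<And>i. i \<in> I \<Longrightarrow> s i \<le> R"
  shows "(\<integral>\<^sup>+x. ennreal (Z x powr (1 + d / q)) \<partial>gauss I) \<le> (\<integral>\<^sup>+x. ennreal (A * Z x powr (1 + d / q - 2 / q)) \<partial>gauss I)"
proof -
  define e where "e = d / q"
  have e: "0 < e" "e * q = d" using d q by (auto simp: e_def)
  have Z_nonneg: "0 \<le> Z x" for x
    unfolding Z_def by (intro sum_nonneg) simp
  have [measurable]: "Z \<in> borel_measurable (borel_PiM I)"
    unfolding Z_def by measurable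
  \<comment> \<open>What \<open>std_normal_moment_powr_ibp\<close> makes of the \<open>i\<close>-th
    term, with \<open>s i powr q\<close> in the role of \<open>a\<close>.\<close>
  define T where "T i x = s i powr q * ((q - 1) * \<bar>x i\<bar> powr (q - 2) * Z x powr e +
      e * q * s i powr q * \<bar>x i\<bar> powr (2 * q - 2) * Z x powr (e - 1))" for i x
  have T_nonneg: "0 \<le> T i x" for i x
    unfolding T_def using q e d by (intro mult_nonneg_nonneg add_nonneg_nonneg) (auto simp: Z_nonneg)
  have [measurable]: "T i \<in> borel_measurable (borel_PiM I)" if "i \<in> I" for i
    using that unfolding T_def by measurable
  have step: "(\<integral>\<^sup>+x. ennreal (s i powr q * \<bar>x i\<bar> powr q * Z x powr e) \<partial>gauss I) \<le> (\<integral>\<^sup>+x. ennreal (T i x) \<partial>gauss I)"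
    if i: "i \<in> I" for i
  proof (cases "s i = 0")
    case False
    then have si: "0 < s i powr q" by simp
    have "(\<integral>\<^sup>+x. ennreal (s i powr q * \<bar>x i\<bar> powr q * Z x powr e) \<partial>gauss I) =
        (\<integral>\<^sup>+x. \<integral>\<^sup>+y. ennreal (s i powr q * \<bar>(x(i := y)) i\<bar> powr q * Z (x(i := y)) powr e) \<partial>std_normal_distribution \<partial>gauss (I - {i}))"
      using i by (intro nn_integral_gauss_split I i) measurable
    also have "\<dots> \<le> (\<integral>\<^sup>+x. \<integral>\<^sup>+y. ennreal (T i (x(i := y))) \<partial>std_normal_distribution \<partial>gauss (I - {i}))"
    proof (rule nn_integral_mono)
      fix x :: "'i \<Rightarrow> real"
      define c where "c = (\<Sum>j\<in>I - {i}. s j powr q * \<bar>x j\<bar> powr q)"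
      have c: "0 \<le> c" unfolding c_def by (intro sum_nonneg) simp
      have Zc: "Z (x(i := y)) = c + s i powr q * \<bar>y\<bar> powr q" for y
        unfolding Z_def c_def using I i by (subst sum.remove[of I i]) (auto intro!: sum.cong)
      have "(\<integral>\<^sup>+y. ennreal (s i powr q * \<bar>(x(i := y)) i\<bar> powr q * Z (x(i := y)) powr e) \<partial>std_normal_distribution) =
          (\<integral>\<^sup>+y. ennreal (s i powr q) * ennreal (\<bar>y\<bar> powr q * (c + s i powr q * \<bar>y\<bar> powr q) powr e) \<partial>std_normal_distribution)"
        by (intro nn_integral_cong) (simp add: Zc ennreal_mult[symmetric] mult.assoc)
      also have "\<dots> = ennreal (s i powr q) * (\<integral>\<^sup>+y. ennreal (\<bar>y\<bar> powr q * (c + s i powr q * \<bar>y\<bar> powr q) powr e) \<partial>std_normal_distribution)"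
        by (rule nn_integral_cmult) measurable
      also have "\<dots> \<le> ennreal (s i powr q) * (\<integral>\<^sup>+y. ennreal ((q - 1) * \<bar>y\<bar> powr (q - 2) * (c + s i powr q * \<bar>y\<bar> powr q) powr e +
          e * q * s i powr q * \<bar>y\<bar> powr (2 * q - 2) * (c + s i powr q * \<bar>y\<bar> powr q) powr (e - 1)) \<partial>std_normal_distribution)"
        by (intro mult_left_mono std_normal_moment_powr_ibp q e si c) simp
      also have "\<dots> = (\<integral>\<^sup>+y. ennreal (s i powr q) * ennreal ((q - 1) * \<bar>y\<bar> powr (q - 2) * (c + s i powr q * \<bar>y\<bar> powr q) powr e +
          e * q * s i powr q * \<bar>y\<bar> powr (2 * q - 2) * (c + s i powr q * \<bar>y\<bar> powr q) powr (e - 1)) \<partial>std_normal_distribution)"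
        by (rule nn_integral_cmult[symmetric]) measurable
      also have "\<dots> = (\<integral>\<^sup>+y. ennreal (T i (x(i := y))) \<partial>std_normal_distribution)"
        unfolding T_def Zc using q d e c si
        by (intro nn_integral_cong, subst ennreal_mult)
           (auto intro!: add_nonneg_nonneg mult_nonneg_nonneg)
      finally show "(\<integral>\<^sup>+y. ennreal (s i powr q * \<bar>(x(i := y)) i\<bar> powr q * Z (x(i := y)) powr e) \<partial>std_normal_distribution) \<le>
          (\<integral>\<^sup>+y. ennreal (T i (x(i := y))) \<partial>std_normal_distribution)" .
    qed
    also have "\<dots> = (\<integral>\<^sup>+x. ennreal (T i x) \<partial>gauss I)"
      using i by (intro nn_integral_gauss_split[symmetric] I i) measurable
    finally show ?thesis .
  qed simp
  have pointwise: "(\<Sum>i\<in>I. T i x) \<le> A * Z x powr (1 + e - 2 / q)" for x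
  proof (cases "Z x = 0")
    case False
    then have Z: "0 < Z x" using Z_nonneg[of x] by simp
    let ?S = "\<Sum>i\<in>I. s i powr q"
    have P1: "(\<Sum>i\<in>I. s i powr q * \<bar>x i\<bar> powr (q - 2)) \<le> ?S powr (2 / q) * Z x powr ((q - 2) / q)"
      unfolding Z_def by (rule sum_mult_powr_le[OF I q]) auto
    \<comment> \<open>Two of the factors \<open>s i\<close> are bounded by \<open>R\<close>. What
      remains is the power \<open>(2 q - 2) / q \<ge> 1\<close> of the terms of \<open>Z\<close>, so
      superadditivity applies.\<close>
    have P2: "(\<Sum>i\<in>I. s i powr q * s i powr q * \<bar>x i\<bar> powr (2 * q - 2)) \<le> R\<^sup>2 * Z x powr ((2 * q - 2) / q)"
    proof -
      have "s i powr q * s i powr q * \<bar>x i\<bar> powr (2 * q - 2) \<le> R\<^sup>2 * (s i powr q * \<bar>x i\<bar> powr q) powr ((2 * q - 2) / q)"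
        if i: "i \<in> I" for i
      proof -
        have "(s i powr q * \<bar>x i\<bar> powr q) powr ((2 * q - 2) / q) = s i powr (2 * q - 2) * \<bar>x i\<bar> powr (2 * q - 2)"
          using q s i by (simp add: powr_mult powr_powr)
        moreover have "s i powr q * s i powr q = (s i)\<^sup>2 * s i powr (2 * q - 2)"
        proof (cases "s i = 0")
          case False
          then have "0 < s i" using s(1)[OF i] by simp
          then have "(s i)\<^sup>2 = s i powr 2"
            by simp
          then show ?thesis
            by (simp only: powr_add[symmetric]) simp
        qed simp
        moreover have "(s i)\<^sup>2 \<le> R\<^sup>2"
          using s i by (intro power_mono) auto
        ultimately show ?thesis
          by (simp add: mult.assoc mult_right_mono)
      qed
      then have "(\<Sum>i\<in>I. s i powr q * s i powr q * \<bar>x i\<bar> powr (2 * q - 2)) \<le>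
          (\<Sum>i\<in>I. R\<^sup>2 * (s i powr q * \<bar>x i\<bar> powr q) powr ((2 * q - 2) / q))"
        by (rule sum_mono)
      also have "\<dots> = R\<^sup>2 * (\<Sum>i\<in>I. (s i powr q * \<bar>x i\<bar> powr q) powr ((2 * q - 2) / q))"
        by (simp add: sum_distrib_left)
      also have "\<dots> \<le> R\<^sup>2 * Z x powr ((2 * q - 2) / q)"
        unfolding Z_def using q by (intro mult_left_mono sum_powr_le_powr_sum I) (auto simp: field_simps)
      finally show ?thesis .
    qed
    have "(\<Sum>i\<in>I. T i x) = (q - 1) * Z x powr e * (\<Sum>i\<in>I. s i powr q * \<bar>x i\<bar> powr (q - 2)) +
        d * Z x powr (e - 1) * (\<Sum>i\<in>I. s i powr q * s i powr q * \<bar>x i\<bar> powr (2 * q - 2))"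
      unfolding T_def sum_distrib_left sum.distrib[symmetric] e(2)[symmetric]
      by (intro sum.cong refl) (simp add: algebra_simps)
    also have "\<dots> \<le> (q - 1) * Z x powr e * (?S powr (2 / q) * Z x powr ((q - 2) / q)) +
        d * Z x powr (e - 1) * (R\<^sup>2 * Z x powr ((2 * q - 2) / q))"
      using q d by (intro add_mono mult_left_mono P1 P2) auto
    also have "\<dots> = (q - 1) * ?S powr (2 / q) * (Z x powr e * Z x powr ((q - 2) / q)) +
        d * R\<^sup>2 * (Z x powr (e - 1) * Z x powr ((2 * q - 2) / q))"
      by (simp add: mult_ac)
    also have "Z x powr e * Z x powr ((q - 2) / q) = Z x powr (1 + e - 2 / q)"
      unfolding powr_add[symmetric] using q by (intro arg_cong2[where f = "(powr)"] refl) (simp add: field_simps)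
    also have "Z x powr (e - 1) * Z x powr ((2 * q - 2) / q) = Z x powr (1 + e - 2 / q)"
      unfolding powr_add[symmetric] using q by (intro arg_cong2[where f = "(powr)"] refl) (simp add: field_simps)
    finally show ?thesis
      by (simp add: A_def distrib_right)
  next
    case True
    then show ?thesis
      by (simp add: T_def)
  qed
  have "(\<integral>\<^sup>+x. ennreal (Z x powr (1 + d / q)) \<partial>gauss I) =
      (\<integral>\<^sup>+x. (\<Sum>i\<in>I. ennreal (s i powr q * \<bar>x i\<bar> powr q * Z x powr e)) \<partial>gauss I)"
  proof (intro nn_integral_cong)
    fix x
    have "Z x powr (1 + d / q) = Z x * Z x powr e"
      using Z_nonneg[of x] by (cases "Z x = 0") (auto simp: powr_add e_def)
    also have "\<dots> = (\<Sum>i\<in>I. s i powr q * \<bar>x i\<bar> powr q * Z x powr e)"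
      by (simp add: Z_def sum_distrib_right)
    finally show "ennreal (Z x powr (1 + d / q)) = (\<Sum>i\<in>I. ennreal (s i powr q * \<bar>x i\<bar> powr q * Z x powr e))"
      by simp
  qed
  also have "\<dots> = (\<Sum>i\<in>I. \<integral>\<^sup>+x. ennreal (s i powr q * \<bar>x i\<bar> powr q * Z x powr e) \<partial>gauss I)"
    by (rule nn_integral_sum) measurable
  also have "\<dots> \<le> (\<Sum>i\<in>I. \<integral>\<^sup>+x. ennreal (T i x) \<partial>gauss I)"
    by (intro sum_mono step)
  also have "\<dots> = (\<integral>\<^sup>+x. (\<Sum>i\<in>I. ennreal (T i x)) \<partial>gauss I)"
    by (rule nn_integral_sum[symmetric]) measurable
  also have "\<dots> \<le> (\<integral>\<^sup>+x. ennreal (A * Z x powr (1 + d / q - 2 / q)) \<partial>gauss I)"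
    using pointwise by (intro nn_integral_mono) (simp add: T_nonneg e_def ennreal_leI)
  finally show ?thesis .
qed

text \<open>By \<open>gauss_lq_moment_aux\<close>, the moment of order \<open>D = q + d\<close> is
  controlled by the one of order \<open>D - 2\<close>. Young's inequality turns this into a bound of
  the former by itself with a factor below 1, hence by \<open>A powr (D / 2)\<close>. Concavity then
  descends from order \<open>D\<close> to order \<open>d\<close>.\<close>

theorem gauss_lq_moment:
  fixes s :: "'i \<Rightarrow> real" and d q R :: real and I :: "'i set"
  assumes I: "finite I" and q: "2 \<le> q" and d: "0 < d" and s: "\<And>i. i \<in> I \<Longrightarrow> 0 \<le> s i" "\<And>i. i \<in> I \<Longrightarrow> s i \<le> R"
  shows "(\<integral>\<^sup>+x. ennreal ((\<Sum>i\<in>I. s i powr q * \<bar>x i\<bar> powr q) powr (d / q)) \<partial>gauss I) \<le>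
    ennreal (((q - 1) * (\<Sum>i\<in>I. s i powr q) powr (2 / q) + d * R\<^sup>2) powr (d / 2))"
proof (cases "\<forall>i\<in>I. s i = 0")
  case True
  then show ?thesis by simp
next
  case False
  define Z where "Z x = (\<Sum>i\<in>I. s i powr q * \<bar>x i\<bar> powr q)" for x :: "'i \<Rightarrow> real"
  define S where "S = (\<Sum>i\<in>I. s i powr q)"
  define A where "A = (q - 1) * S powr (2 / q) + d * R\<^sup>2"
  have [measurable]: "Z \<in> borel_measurable (borel_PiM I)"
    unfolding Z_def by measurable
  have Z_nonneg: "0 \<le> Z x" for x
    unfolding Z_def by (intro sum_nonneg) simp
  from False obtain i where i: "i \<in> I" "0 < s i"
    using s by (auto simp: order.strict_iff_order)
  have "0 < R" using i s(2)[OF i(1)] by simp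
  then have A: "0 < A"
    unfolding A_def using q d by (intro add_nonneg_pos) auto
  define D where "D = q + d"
  have D: "0 < D" "0 \<le> 2 / D" "2 / D \<le> 1" using q d by (auto simp: D_def)
  define m where "m = 1 + d / q"
  have m: "0 < m" "m = D / q" using q d by (auto simp: m_def D_def field_simps)
  let ?E = "\<integral>\<^sup>+x. ennreal (Z x powr m) \<partial>gauss I"
  have E_fin: "?E < \<infinity>"
    unfolding Z_def using gauss_moment_powr_finite[OF I, of "\<lambda>i. s i powr q" q m] q m by auto
  have young: "A * Z x powr (m - 2 / q) \<le> 2 / D * A powr (D / 2) + (1 - 2 / D) * Z x powr m" for x
  proof (cases "Z x = 0")
    case False
    then have Z: "0 < Z x" using Z_nonneg[of x] by simp
    have "A = (A powr (D / 2)) powr (2 / D)"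
      using A D by (simp add: powr_powr)
    moreover have "Z x powr (m - 2 / q) = (Z x powr m) powr (1 - 2 / D)"
    proof -
      have "m - 2 / q = m * (1 - 2 / D)"
        using D q by (simp add: m(2) right_diff_distrib)
      then show ?thesis
        by (simp add: powr_powr)
    qed
    ultimately show ?thesis
      using Youngs_inequality_0[of "2 / D" "1 - 2 / D" "A powr (D / 2)" "Z x powr m"] D A Z by simp
  qed (use A D in simp)
  have "?E \<le> (\<integral>\<^sup>+x. ennreal (A * Z x powr (m - 2 / q)) \<partial>gauss I)"
    using gauss_lq_moment_aux[OF I q d s] by (simp add: Z_def A_def S_def m_def)
  also have "\<dots> \<le> (\<integral>\<^sup>+x. ennreal (2 / D * A powr (D / 2)) + ennreal (1 - 2 / D) * ennreal (Z x powr m) \<partial>gauss I)"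
    using D young by (intro nn_integral_mono) (simp add: ennreal_mult[symmetric] ennreal_plus[symmetric] del: ennreal_plus)
  also have "\<dots> = ennreal (2 / D * A powr (D / 2)) + ennreal (1 - 2 / D) * ?E"
    using gauss.emeasure_space_1[of I] by (simp add: nn_integral_add nn_integral_cmult)
  finally have ineq: "?E \<le> ennreal (2 / D * A powr (D / 2)) + ennreal (1 - 2 / D) * ?E" .
  have E: "?E \<le> ennreal (A powr (D / 2))"
  proof -
    obtain r where r: "?E = ennreal r" "0 \<le> r"
      using E_fin by (cases ?E) auto
    then have "r \<le> 2 / D * A powr (D / 2) + (1 - 2 / D) * r"
      using ineq D by (simp add: ennreal_mult[symmetric] ennreal_plus[symmetric] del: ennreal_plus)
    then have "2 / D * r \<le> 2 / D * A powr (D / 2)"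
      by (simp add: algebra_simps)
    then have "r \<le> A powr (D / 2)"
      using D(1) by (subst (asm) mult_le_cancel_left_pos) auto
    then show ?thesis
      by (simp add: r ennreal_leI)
  qed
  \<comment> \<open>The power \<open>d / D \<le> 1\<close> of
    \<open>A powr (- D / 2) * Z x powr m\<close> lies below its tangent at 1: Jensen's inequality in
    pointwise form.\<close>
  have young': "Z x powr (d / q) \<le> d / D * A powr (- q / 2) * Z x powr m + (1 - d / D) * A powr (d / 2)" for x
  proof -
    have *: "0 \<le> d / D" "d / D \<le> 1" using q d D by (auto simp: D_def)
    have "(A powr (- D / 2) * Z x powr m) powr (d / D) \<le> d / D * (A powr (- D / 2) * Z x powr m) + (1 - d / D)"
      by (intro powr_le_affine *) simp
    moreover have "(A powr (- D / 2) * Z x powr m) powr (d / D) = A powr (- d / 2) * Z x powr (d / q)"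
      using D q by (simp add: powr_mult powr_powr m)
    ultimately have "A powr (d / 2) * (A powr (- d / 2) * Z x powr (d / q)) \<le>
        A powr (d / 2) * (d / D * (A powr (- D / 2) * Z x powr m) + (1 - d / D))"
      by (intro mult_left_mono) auto
    moreover have "A powr (d / 2) * A powr (- d / 2) = 1" "A powr (d / 2) * A powr (- D / 2) = A powr (- q / 2)"
      unfolding powr_add[symmetric] using A by (simp_all add: D_def field_simps)
    ultimately show ?thesis
      by (simp add: distrib_left mult.assoc[symmetric]) (simp add: mult_ac)
  qed
  have "(\<integral>\<^sup>+x. ennreal (Z x powr (d / q)) \<partial>gauss I) \<le>
      (\<integral>\<^sup>+x. ennreal (d / D * A powr (- q / 2)) * ennreal (Z x powr m) + ennreal ((1 - d / D) * A powr (d / 2)) \<partial>gauss I)"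
    using d D q young' by (intro nn_integral_mono)
      (simp add: ennreal_mult[symmetric] ennreal_plus[symmetric] D_def del: ennreal_plus)
  also have "\<dots> = ennreal (d / D * A powr (- q / 2)) * ?E + ennreal ((1 - d / D) * A powr (d / 2))"
    using gauss.emeasure_space_1[of I] by (simp add: nn_integral_add nn_integral_cmult)
  also have "\<dots> \<le> ennreal (d / D * A powr (- q / 2)) * ennreal (A powr (D / 2)) + ennreal ((1 - d / D) * A powr (d / 2))"
    by (intro add_right_mono mult_left_mono E) simp
  also have "\<dots> = ennreal (A powr (d / 2))"
  proof -
    have "A powr (- q / 2) * A powr (D / 2) = A powr (d / 2)"
      unfolding powr_add[symmetric] by (simp add: D_def field_simps)
    then have "d / D * A powr (- q / 2) * A powr (D / 2) + (1 - d / D) * A powr (d / 2) = A powr (d / 2)"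
      by (simp add: mult.assoc algebra_simps)
    then show ?thesis
      using d q by (simp add: ennreal_mult[symmetric] ennreal_plus[symmetric] D_def del: ennreal_plus)
  qed
  finally show ?thesis
    by (simp add: Z_def A_def S_def)
qed

lemma std_normal_abs_moment:
  assumes "0 < d"
  shows "(\<integral>\<^sup>+x. ennreal (\<bar>x\<bar> ^ d) \<partial>std_normal_distribution) \<le> ennreal (sqrt (1 + d) ^ d)"
proof -
  have "(\<integral>\<^sup>+x. ennreal (\<bar>x\<bar> ^ d) \<partial>std_normal_distribution) = (\<integral>\<^sup>+x. ennreal (\<bar>x 0\<bar> ^ d) \<partial>gauss {0::nat})"
    by (rule nn_integral_gauss_component[symmetric]) auto
  also have "\<dots> = (\<integral>\<^sup>+x. ennreal ((\<Sum>i\<in>{0::nat}. 1 powr 2 * \<bar>x i\<bar> powr 2) powr (real d / 2)) \<partial>gauss {0::nat})"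
    using assms by (intro nn_integral_cong) (simp add: powr_powr powr_realpow' del: powr_numeral)
  also have "\<dots> \<le> ennreal (((2 - 1) * (\<Sum>i\<in>{0::nat}. 1 powr 2) powr (2 / 2) + real d * 1\<^sup>2) powr (real d / 2))"
    using assms by (intro gauss_lq_moment) auto
  also have "((2 - 1) * (\<Sum>i\<in>{0::nat}. 1 powr 2) powr (2 / 2) + real d * 1\<^sup>2) powr (real d / 2) = sqrt (1 + d) ^ d"
    by (simp add: powr_half_sqrt[symmetric] powr_realpow[symmetric] powr_powr)
  finally show ?thesis .
qed

lemma gauss_L2_moment:
  assumes I: "finite I" and d: "0 < d"
  shows "(\<integral>\<^sup>+x. ennreal (L2_set x I ^ d) \<partial>gauss I) \<le> ennreal (sqrt (card I + d) ^ d)"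
proof -
  have pow: "sqrt y ^ d = y powr (real d / 2)" if "0 \<le> y" for y
    using that d by (cases "y = 0") (simp_all add: powr_half_sqrt[symmetric] powr_realpow[symmetric] powr_powr)
  have "(\<integral>\<^sup>+x. ennreal (L2_set x I ^ d) \<partial>gauss I) =
      (\<integral>\<^sup>+x. ennreal ((\<Sum>i\<in>I. 1 powr 2 * \<bar>x i\<bar> powr 2) powr (real d / 2)) \<partial>gauss I)"
    by (intro nn_integral_cong) (simp add: L2_set_def pow sum_nonneg)
  also have "\<dots> \<le> ennreal (((2 - 1) * (\<Sum>i\<in>I. 1 powr 2) powr (2 / 2) + real d * 1\<^sup>2) powr (real d / 2))"
    using assms by (intro gauss_lq_moment) auto
  finally show ?thesis
    by (simp add: pow)
qed

section \<open>Moments of a weighted maximum\<close>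

lemma std_normal_excess_moment:
  assumes a: "0 \<le> a" and d: "0 < d"
  shows "(\<integral>\<^sup>+x. ennreal (max 0 (\<bar>x\<bar> - a) ^ d) \<partial>std_normal_distribution) \<le>
    ennreal (exp (- a\<^sup>2 / 2)) * (\<integral>\<^sup>+x. ennreal (\<bar>x\<bar> ^ d) \<partial>std_normal_distribution)"
proof -
  define X where "X = (\<integral>\<^sup>+x. ennreal (max 0 (x - a) ^ d) * ennreal (std_normal_density x) * indicator {0<..} x \<partial>lborel)"
  define Y where "Y = (\<integral>\<^sup>+x. ennreal (x ^ d) * ennreal (std_normal_density x) * indicator {0<..} x \<partial>lborel)"
  \<comment> \<open>Shifting by \<open>a\<close> moves the threshold to 0; for \<open>y > 0\<close>
    the inequality \<open>(a + y)^2 \<ge> a^2 + y^2\<close> then splits off the factor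
    \<open>exp (- a^2 / 2)\<close>.\<close>
  have "X = (\<integral>\<^sup>+y. ennreal (max 0 y ^ d) * ennreal (std_normal_density (a + y)) * indicator {0<..} (a + y) \<partial>lborel)"
    unfolding X_def by (subst nn_integral_real_affine[where c = 1 and t = a]) auto
  also have "\<dots> \<le> (\<integral>\<^sup>+y. ennreal (exp (- a\<^sup>2 / 2)) * (ennreal (y ^ d) * ennreal (std_normal_density y) * indicator {0<..} y) \<partial>lborel)"
  proof (intro nn_integral_mono)
    fix y :: real
    show "ennreal (max 0 y ^ d) * ennreal (std_normal_density (a + y)) * indicator {0<..} (a + y) \<le>
        ennreal (exp (- a\<^sup>2 / 2)) * (ennreal (y ^ d) * ennreal (std_normal_density y) * indicator {0<..} y)"
    proof (cases "0 < y")
      case True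
      have "exp (- (a + y)\<^sup>2 / 2) \<le> exp (- a\<^sup>2 / 2) * exp (- y\<^sup>2 / 2)"
        using True a by (simp add: mult_exp_exp power2_sum field_simps)
      then have "std_normal_density (a + y) \<le> exp (- a\<^sup>2 / 2) * std_normal_density y"
        unfolding std_normal_density_def by (simp add: field_simps divide_right_mono)
      then have "ennreal (std_normal_density (a + y)) \<le> ennreal (exp (- a\<^sup>2 / 2)) * ennreal (std_normal_density y)"
        by (simp add: ennreal_mult[symmetric] ennreal_leI)
      then have "ennreal (y ^ d) * ennreal (std_normal_density (a + y)) \<le>
          ennreal (y ^ d) * (ennreal (exp (- a\<^sup>2 / 2)) * ennreal (std_normal_density y))"
        by (rule mult_left_mono) simp
      with True a show ?thesis
        by (simp add: mult_ac)
    next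
      case False
      then have "max 0 y = 0" by simp
      then show ?thesis using d by simp
    qed
  qed
  also have "\<dots> = ennreal (exp (- a\<^sup>2 / 2)) * Y"
    unfolding Y_def by (rule nn_integral_cmult) measurable
  finally have "2 * X \<le> 2 * (ennreal (exp (- a\<^sup>2 / 2)) * Y)"
    by (rule mult_left_mono) simp
  moreover have "(\<integral>\<^sup>+x. ennreal (max 0 (\<bar>x\<bar> - a) ^ d) \<partial>std_normal_distribution) = 2 * X"
    unfolding X_def by (rule nn_integral_std_normal_abs) measurable
  moreover have "(\<integral>\<^sup>+x. ennreal (\<bar>x\<bar> ^ d) \<partial>std_normal_distribution) = 2 * Y"
    unfolding Y_def by (rule nn_integral_std_normal_abs) measurable
  ultimately show ?thesis
    by (simp only: mult.left_commute[of 2])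
qed

text \<open>The term \<open>1 / (n + 1)\<close> is kept for the induction: with
  \<open>r = n + 1\<close>, the new summand \<open>1 / (2 r)^2\<close> is at most
  \<open>1 / r - 1 / (r + 1)\<close>.\<close>

lemma sum_inverse_even_squares_le: "(\<Sum>i = k + 1..k + n. 1 / (2 * real (i - k))\<^sup>2) \<le> 1 - 1 / (real n + 1)"
proof (induction n)
  case (Suc n)
  let ?r = "real n + 1"
  have "1 / (2 * ?r)\<^sup>2 \<le> 1 / (?r * (?r + 1))"
    by (rule frac_le) (auto simp: power2_eq_square algebra_simps add_pos_nonneg)
  also have "\<dots> = 1 / ?r - 1 / (?r + 1)"
    by (simp add: field_simps)
  finally have "1 / (2 * ?r)\<^sup>2 \<le> 1 / ?r - 1 / (?r + 1)" .
  moreover have "(\<Sum>i = k + 1..k + Suc n. 1 / (2 * real (i - k))\<^sup>2) =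
      (\<Sum>i = k + 1..k + n. 1 / (2 * real (i - k))\<^sup>2) + 1 / (2 * ?r)\<^sup>2"
    by (simp add: add.commute)
  moreover have "real (Suc n) + 1 = ?r + 1"
    by simp
  moreover have "b + t \<le> 1 - v" if "b \<le> 1 - u" "t \<le> u - v" for b t u v :: real
    using that by simp
  ultimately show ?case
    using Suc by (simp only:)
qed simp

text \<open>At the index \<open>i\<close> of the maximum, \<open>|x i|\<close> is at most a
  threshold \<open>a i\<close> plus the excess over it. The thresholds contribute at most
  \<open>2 * B\<close>. The \<open>d\<close>-th moments of the excesses may be summed over all
  \<open>i\<close>, because their factors \<open>exp (- (a i)^2 / 2)\<close> have total at most
  1.\<close>

theorem gauss_weighted_max_moment:
  fixes s :: "nat \<Rightarrow> real"
  assumes kN: "k < N" and d: "0 < d" and s: "\<And>i. i \<in> {k+1..N} \<Longrightarrow> 0 \<le> s i" "\<And>i. i \<in> {k+1..N} \<Longrightarrow> s i \<le> R"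
    and B: "\<And>i. i \<in> {k+1..N} \<Longrightarrow> s i * sqrt (ln (2 * real (i - k))) \<le> B"
  shows "(\<integral>\<^sup>+x. ennreal (Max ((\<lambda>i. s i * \<bar>x i\<bar>) ` {k+1..N}) ^ d) \<partial>gauss {k+1..N}) \<le>
    ennreal ((2 * (2 * B + R * sqrt (1 + d))) ^ d)"
proof -
  let ?J = "{k+1..N}"
  have J: "finite ?J" "k + 1 \<in> ?J" using kN by auto
  have R: "0 \<le> R" using s[OF J(2)] by simp
  have ln_nonneg: "0 \<le> ln (2 * real (i - k))" if "i \<in> ?J" for i
    using that by simp
  have B_nonneg: "0 \<le> B"
    using B[OF J(2)] s(1)[OF J(2)] by (intro order_trans[OF _ B[OF J(2)]] mult_nonneg_nonneg) auto
  \<comment> \<open>The factor 2 makes \<open>exp (- (a i)^2 / 2)\<close> equal to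
    \<open>1 / (2 (i - k))^2\<close>, which is summable over \<open>i > k\<close>.\<close>
  define a where "a i = 2 * sqrt (ln (2 * real (i - k)))" for i
  have a: "0 \<le> a i" if "i \<in> ?J" for i using ln_nonneg[OF that] by (simp add: a_def)
  have le: "Max ((\<lambda>i. s i * \<bar>x i\<bar>) ` ?J) ^ d \<le> 2 ^ d * (2 * B) ^ d + (\<Sum>i\<in>?J. 2 ^ d * R ^ d * max 0 (\<bar>x i\<bar> - a i) ^ d)" for x :: "nat \<Rightarrow> real"
  proof -
    have "Max ((\<lambda>i. s i * \<bar>x i\<bar>) ` ?J) \<in> (\<lambda>i. s i * \<bar>x i\<bar>) ` ?J"
      using J by (intro Max_in) auto
    then obtain i where i: "i \<in> ?J" "Max ((\<lambda>i. s i * \<bar>x i\<bar>) ` ?J) = s i * \<bar>x i\<bar>" by auto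
    let ?e = "max 0 (\<bar>x i\<bar> - a i)"
    have "s i * \<bar>x i\<bar> \<le> s i * (a i + ?e)"
      using s(1)[OF i(1)] by (intro mult_left_mono) auto
    also have "\<dots> \<le> 2 * B + R * ?e"
      using B[OF i(1)] mult_right_mono[OF s(2)[OF i(1)], of ?e] by (simp add: a_def distrib_left)
    also have "\<dots> \<le> 2 * max (2 * B) (R * ?e)"
      by simp
    finally have "(s i * \<bar>x i\<bar>) ^ d \<le> (2 * max (2 * B) (R * ?e)) ^ d"
      by (rule power_mono) (simp add: s(1)[OF i(1)])
    also have "\<dots> = 2 ^ d * max (2 * B) (R * ?e) ^ d"
      by (rule power_mult_distrib)
    also have "max (2 * B) (R * ?e) ^ d \<le> (2 * B) ^ d + (R * ?e) ^ d"
    proof -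
      have *: "max u v ^ d \<le> u ^ d + v ^ d" if "0 \<le> u" "0 \<le> v" for u v :: real
        using that by (simp add: max_def)
      show ?thesis
        by (rule *) (use B_nonneg R in simp_all)
    qed
    also have "2 ^ d * ((2 * B) ^ d + (R * ?e) ^ d) = 2 ^ d * (2 * B) ^ d + 2 ^ d * R ^ d * ?e ^ d"
      by (simp only: power_mult_distrib[of R] distrib_left mult.assoc)
    also have "2 ^ d * R ^ d * ?e ^ d \<le> (\<Sum>i\<in>?J. 2 ^ d * R ^ d * max 0 (\<bar>x i\<bar> - a i) ^ d)"
      using i(1) R by (intro member_le_sum[where f = "\<lambda>i. 2 ^ d * R ^ d * max 0 (\<bar>x i\<bar> - a i) ^ d"]) auto
    finally show ?thesis
      using i(2) by simp
  qed
  have excess: "(\<integral>\<^sup>+x. ennreal (max 0 (\<bar>x i\<bar> - a i) ^ d) \<partial>gauss ?J) \<le> ennreal (1 / (2 * real (i - k))\<^sup>2 * sqrt (1 + d) ^ d)"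
    if i: "i \<in> ?J" for i
  proof -
    have "exp (- (a i)\<^sup>2 / 2) = exp (- 2 * ln (2 * real (i - k)))"
      using ln_nonneg[OF i] by (simp add: a_def power_mult_distrib)
    also have "\<dots> = (2 * real (i - k)) powr (- 2)"
      using i by (simp add: powr_def)
    also have "\<dots> = 1 / (2 * real (i - k))\<^sup>2"
      using i by (simp add: powr_minus field_simps)
    finally have e: "exp (- (a i)\<^sup>2 / 2) = 1 / (2 * real (i - k))\<^sup>2" .
    have "(\<integral>\<^sup>+x. ennreal (max 0 (\<bar>x i\<bar> - a i) ^ d) \<partial>gauss ?J) = (\<integral>\<^sup>+y. ennreal (max 0 (\<bar>y\<bar> - a i) ^ d) \<partial>std_normal_distribution)"
      using i by (intro nn_integral_gauss_component) auto
    also have "\<dots> \<le> ennreal (exp (- (a i)\<^sup>2 / 2)) * (\<integral>\<^sup>+y. ennreal (\<bar>y\<bar> ^ d) \<partial>std_normal_distribution)"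
      by (rule std_normal_excess_moment[OF a[OF i] d])
    also have "\<dots> \<le> ennreal (exp (- (a i)\<^sup>2 / 2)) * ennreal (sqrt (1 + d) ^ d)"
      by (intro mult_left_mono std_normal_abs_moment d) simp
    finally show ?thesis
      unfolding e by (subst ennreal_mult) auto
  qed
  have "(\<integral>\<^sup>+x. ennreal (Max ((\<lambda>i. s i * \<bar>x i\<bar>) ` ?J) ^ d) \<partial>gauss ?J) \<le>
      (\<integral>\<^sup>+x. ennreal (2 ^ d * (2 * B) ^ d) + (\<Sum>i\<in>?J. ennreal (2 ^ d * R ^ d) * ennreal (max 0 (\<bar>x i\<bar> - a i) ^ d)) \<partial>gauss ?J)"
    using B_nonneg R le by (intro nn_integral_mono)
      (simp add: ennreal_mult[symmetric] ennreal_plus[symmetric] sum_nonneg ennreal_leI del: ennreal_plus)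
  also have "\<dots> = ennreal (2 ^ d * (2 * B) ^ d) + (\<Sum>i\<in>?J. ennreal (2 ^ d * R ^ d) * (\<integral>\<^sup>+x. ennreal (max 0 (\<bar>x i\<bar> - a i) ^ d) \<partial>gauss ?J))"
    using gauss.emeasure_space_1[of ?J] by (simp add: nn_integral_add nn_integral_sum nn_integral_cmult)
  also have "\<dots> \<le> ennreal (2 ^ d * (2 * B) ^ d) + (\<Sum>i\<in>?J. ennreal (2 ^ d * R ^ d) * ennreal (1 / (2 * real (i - k))\<^sup>2 * sqrt (1 + d) ^ d))"
    by (intro add_left_mono sum_mono mult_left_mono excess) auto
  also have "\<dots> = ennreal (2 ^ d * (2 * B) ^ d + (2 ^ d * R ^ d * sqrt (1 + d) ^ d) * (\<Sum>i\<in>?J. 1 / (2 * real (i - k))\<^sup>2))"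
    using B_nonneg R by (simp add: ennreal_mult[symmetric] ennreal_plus[symmetric] sum_nonneg sum_distrib_left mult_ac del: ennreal_plus)
  also have "\<dots> \<le> ennreal ((2 * (2 * B + R * sqrt (1 + d))) ^ d)"
  proof (intro ennreal_leI)
    have "k + (N - k) = N"
      using kN by simp
    then have "(\<Sum>i\<in>?J. 1 / (2 * real (i - k))\<^sup>2) \<le> 1 - 1 / (real (N - k) + 1)"
      using sum_inverse_even_squares_le[of k "N - k"] by (simp only: of_nat_1)
    also have "\<dots> \<le> 1"
      by simp
    finally have "(\<Sum>i\<in>?J. 1 / (2 * real (i - k))\<^sup>2) \<le> 1" .
    then have "2 ^ d * (2 * B) ^ d + (2 ^ d * R ^ d * sqrt (1 + d) ^ d) * (\<Sum>i\<in>?J. 1 / (2 * real (i - k))\<^sup>2) \<le>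
        2 ^ d * (2 * B) ^ d + (2 ^ d * R ^ d * sqrt (1 + d) ^ d) * 1"
      using R by (intro add_left_mono mult_left_mono) auto
    also have "\<dots> = 2 ^ d * ((2 * B) ^ d + (R * sqrt (1 + d)) ^ d)"
      by (simp add: power_mult_distrib algebra_simps)
    also have "\<dots> \<le> 2 ^ d * (2 * B + R * sqrt (1 + d)) ^ d"
    proof (intro mult_left_mono)
      have sup: "x ^ d + y ^ d \<le> (x + y) ^ d" if "0 \<le> x" "0 \<le> y" for x y :: real
      proof -
        have "x ^ d + y ^ d = x * x ^ (d - 1) + y * y ^ (d - 1)"
          using d by (simp add: power_eq_if)
        also have "\<dots> \<le> x * (x + y) ^ (d - 1) + y * (x + y) ^ (d - 1)"
          using that by (intro add_mono mult_left_mono power_mono) auto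
        also have "\<dots> = (x + y) ^ d"
          using d by (simp add: power_eq_if distrib_right)
        finally show ?thesis .
      qed
      show "(2 * B) ^ d + (R * sqrt (1 + d)) ^ d \<le> (2 * B + R * sqrt (1 + d)) ^ d"
        using B_nonneg R by (intro sup) auto
    qed simp
    finally show "2 ^ d * (2 * B) ^ d + (2 ^ d * R ^ d * sqrt (1 + d) ^ d) * (\<Sum>i\<in>?J. 1 / (2 * real (i - k))\<^sup>2) \<le>
        (2 * (2 * B + R * sqrt (1 + d))) ^ d"
      by (simp only: power_mult_distrib[of 2 "2 * B + R * sqrt (1 + d)"])
  qed
  finally show ?thesis .
qed

section \<open>The Haar measure of the Grassmannian\<close>

text \<open>A homogeneous linear system with fewer equations than unknowns, solved by elimination: a
  coordinate \<open>j\<close> with \<open>b j \<noteq> 0\<close> is the pivot that removes one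
  equation and one unknown.\<close>

lemma exists_nonzero_orthogonal_vector:
  fixes B :: "('i \<Rightarrow> real) set"
  assumes "finite I" "finite B" "card B < card I"
  shows "\<exists>y. (\<forall>i. i \<notin> I \<longrightarrow> y i = 0) \<and> (\<exists>i\<in>I. y i \<noteq> 0) \<and> (\<forall>b\<in>B. ip I y b = 0)"
  using assms
proof (induction "card B" arbitrary: B I rule: less_induct)
  case less
  show ?case
  proof (cases "B = {}")
    case True
    have "I \<noteq> {}" using less.prems by auto
    then obtain j where "j \<in> I" by blast
    with True show ?thesis
      by (intro exI[of _ "\<lambda>i. if i = j then 1 else 0"]) auto
  next
    case False
    then obtain b where b: "b \<in> B" by blast
    let ?B = "B - {b}"
    have card_B: "card ?B < card B"
      using b less.prems by (intro psubset_card_mono) auto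
    show ?thesis
    proof (cases "\<forall>i\<in>I. b i = 0")
      case True
      obtain y where y: "\<forall>i. i \<notin> I \<longrightarrow> y i = 0" "\<exists>i\<in>I. y i \<noteq> 0" "\<forall>c\<in>?B. ip I y c = 0"
        using less.hyps[OF card_B, of I] less.prems card_B by auto
      moreover have "ip I y b = 0"
        using True by (simp add: ip_def)
      ultimately show ?thesis
        by (intro exI[of _ y]) auto
    next
      case False
      then obtain j where j: "j \<in> I" "b j \<noteq> 0" by blast
      let ?I = "I - {j}"
      define elim where "elim c = (\<lambda>i. c i - c j / b j * b i)" for c :: "'i \<Rightarrow> real"
      have card_elim: "card (elim ` ?B) \<le> card ?B"
        using less.prems by (intro card_image_le) auto
      have "card ?B = card B - 1" "card ?I = card I - 1"
        using b j less.prems by auto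
      then have "card (elim ` ?B) < card ?I"
        using card_elim card_B less.prems by linarith
      then obtain y where y: "\<And>i. i \<notin> ?I \<Longrightarrow> y i = 0" "\<exists>i\<in>?I. y i \<noteq> 0" "\<And>c. c \<in> ?B \<Longrightarrow> ip ?I y (elim c) = 0"
        using less.hyps[of "elim ` ?B" ?I] card_elim card_B less.prems by auto
      \<comment> \<open>The eliminated coordinate is recovered from the equation of
        \<open>b\<close>.\<close>
      define z where "z = y(j := - ip ?I y b / b j)"
      have ip_z: "ip I z c = - ip ?I y b / b j * c j + ip ?I y c" for c
      proof -
        have "ip I z c = z j * c j + ip ?I z c"
          unfolding ip_def using less.prems(1) j(1) by (rule sum.remove)
        moreover have "ip ?I z c = ip ?I y c"
          by (intro ip_cong) (auto simp: z_def)
        ultimately show ?thesis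
          by (simp add: z_def)
      qed
      have "ip I z c = 0" if "c \<in> B" for c
      proof (cases "c = b")
        case True
        then show ?thesis
          using j(2) by (simp add: ip_z)
      next
        case False
        then have "ip ?I y c - c j / b j * ip ?I y b = 0"
          using y(3)[of c] that by (simp only: elim_def ip_diff_right ip_mult_right) simp
        then show ?thesis
          by (simp add: ip_z field_simps)
      qed
      moreover have "\<exists>i\<in>I. z i \<noteq> 0" "\<forall>i. i \<notin> I \<longrightarrow> z i = 0"
        using y(1,2) j by (auto simp: z_def)
      ultimately show ?thesis
        by (intro exI[of _ z]) blast
    qed
  qed
qed

text \<open>Each new vector is taken orthogonal to \<open>B\<close> and to the vectors already
  found, which adds at most \<open>r\<close> equations.\<close>

lemma exists_orthonormal_family:
  fixes B :: "('i \<Rightarrow> real) set"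
  assumes I: "finite I" and B: "finite B" and r: "r + card B \<le> card I"
  shows "\<exists>c :: nat \<Rightarrow> 'i \<Rightarrow> real. (\<forall>j<r. \<forall>i. i \<notin> I \<longrightarrow> c j i = 0) \<and>
    (\<forall>i<r. \<forall>j<r. ip I (c i) (c j) = (if i = j then 1 else 0)) \<and> (\<forall>j<r. \<forall>b\<in>B. ip I (c j) b = 0)"
  using r
proof (induction r)
  case (Suc r)
  then have "\<exists>c :: nat \<Rightarrow> 'i \<Rightarrow> real. (\<forall>j<r. \<forall>i. i \<notin> I \<longrightarrow> c j i = 0) \<and>
    (\<forall>i<r. \<forall>j<r. ip I (c i) (c j) = (if i = j then 1 else 0)) \<and> (\<forall>j<r. \<forall>b\<in>B. ip I (c j) b = 0)"
    by simp
  then obtain c :: "nat \<Rightarrow> 'i \<Rightarrow> real" where "(\<forall>j<r. \<forall>i. i \<notin> I \<longrightarrow> c j i = 0) \<and>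
    (\<forall>i<r. \<forall>j<r. ip I (c i) (c j) = (if i = j then 1 else 0)) \<and> (\<forall>j<r. \<forall>b\<in>B. ip I (c j) b = 0)"
    by (rule exE)
  then have c: "\<And>j i. j < r \<Longrightarrow> i \<notin> I \<Longrightarrow> c j i = 0"
    "\<And>i j. i < r \<Longrightarrow> j < r \<Longrightarrow> ip I (c i) (c j) = (if i = j then 1 else 0)"
    "\<And>j b. j < r \<Longrightarrow> b \<in> B \<Longrightarrow> ip I (c j) b = 0"
    by blast+
  have "card (B \<union> c ` {..<r}) \<le> card B + card (c ` {..<r})"
    by (rule card_Un_le)
  also have "\<dots> \<le> card B + r"
    using card_image_le[of "{..<r}" c] by simp
  finally have "card (B \<union> c ` {..<r}) < card I"
    using Suc.prems by simp
  then obtain y where y: "\<And>i. i \<notin> I \<Longrightarrow> y i = 0" "\<exists>i\<in>I. y i \<noteq> 0" "\<And>b. b \<in> B \<union> c ` {..<r} \<Longrightarrow> ip I y b = 0"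
    using exists_nonzero_orthogonal_vector[OF I, of "B \<union> c ` {..<r}"] B by auto
  have nz: "L2_set y I \<noteq> 0"
    using y(2) I by (auto simp: L2_set_eq_0_iff)
  define z where "z = (\<lambda>i. 1 / L2_set y I * y i)"
  have z: "ip I z x = 1 / L2_set y I * ip I y x" "ip I x z = 1 / L2_set y I * ip I x y" for x
    unfolding z_def by (rule ip_mult_left ip_mult_right)+
  have "ip I z z = 1"
    using nz by (simp only: z) (simp add: ip_self power2_eq_square)
  moreover have "ip I z (c j) = 0" "ip I (c j) z = 0" if "j < r" for j
    using y(3)[of "c j"] that by (auto simp: z ip_commute[of I "c j"])
  moreover have "ip I z b = 0" if "b \<in> B" for b
    using y(3)[of b] that by (simp add: z)
  moreover have "z i = 0" if "i \<notin> I" for i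
    using y(1)[OF that] by (simp add: z_def)
  ultimately show ?case
    using c by (intro exI[of _ "c(r := z)"]) (auto simp: less_Suc_eq)
qed simp

section \<open>Orthogonal projections onto members of the Grassmannian\<close>

lemma inner_rn_eq_ip: "inner_rn N x y = ip {1..N} x y"
  by (simp add: inner_rn_def ip_def)

lemma ip_minus_left: "ip I (x - y) z = ip I x z - ip I y z"
  using ip_diff_left[of I x y z] by (simp add: fun_diff_def)

lemma ip_plus_left: "ip I (x + y) z = ip I x z + ip I y z"
  using ip_add_left[of I x y z] by (simp add: plus_fun_def)

lemma ip_scaleR_left: "ip I (c *\<^sub>R x) z = c * ip I x z"
  using ip_mult_left[of I c x z] by (simp add: scaleR_fun_def)

lemma ip_orthogonal_span:
  assumes "\<And>b. b \<in> B \<Longrightarrow> ip I x b = 0" "y \<in> span B"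
  shows "ip I x y = 0"
  using assms(2)
proof (induction rule: span_induct_alt)
  case (step c b y)
  then show ?case
    using assms(1)[of b] by (simp add: ip_def scaleR_fun_def distrib_left sum.distrib sum_distrib_left[symmetric] mult.left_commute)
qed (simp add: ip_def)

text \<open>Gram-Schmidt: the new projection is the one onto \<open>span B\<close> plus the
  component along \<open>b - p\<close>, where \<open>p\<close> is the projection of \<open>b\<close>
  onto \<open>span B\<close>. If \<open>b - p\<close> vanishes on \<open>{1..N}\<close>, division by
  zero drops the component.\<close>

lemma projection_span_exists:
  fixes B :: "(nat \<Rightarrow> real) set"
  assumes "finite B" "B \<subseteq> rn N"
  shows "\<exists>y\<in>span B. \<forall>z\<in>span B. ip {1..N} (x - y) z = 0"
  using assms
proof (induction B arbitrary: x)
  case empty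
  show ?case by (simp add: ip_def)
next
  case (insert b B)
  let ?ip = "ip {1..N}"
  have span_mono: "span B \<subseteq> span (insert b B)"
    by (intro span_mono) auto
  obtain p where p: "p \<in> span B" "\<And>z. z \<in> span B \<Longrightarrow> ?ip (b - p) z = 0"
    using insert by fastforce
  obtain y where y: "y \<in> span B" "\<And>z. z \<in> span B \<Longrightarrow> ?ip (x - y) z = 0"
    using insert by fastforce
  let ?w = "b - p"
  have w: "?w \<in> span (insert b B)"
    using p(1) span_mono by (intro span_diff span_base[of b]) auto
  define q where "q = y + (?ip x ?w / ?ip ?w ?w) *\<^sub>R ?w"
  have q: "q \<in> span (insert b B)"
    unfolding q_def using y(1) span_mono w by (intro span_add span_scale) auto
  have ip_q: "?ip (x - q) z = ?ip (x - y) z - ?ip x ?w / ?ip ?w ?w * ?ip ?w z" for z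
    unfolding q_def by (simp add: ip_minus_left ip_plus_left ip_scaleR_left)
  have base: "?ip (x - q) z = 0" if "z \<in> span B" for z
    using that by (simp only: ip_q y(2) p(2))
  have "?ip (x - q) ?w = 0"
  proof (cases "?ip ?w ?w = 0")
    case True
    then have "?w i = 0" if "i \<in> {1..N}" for i
      using that by (simp add: ip_self_eq_0)
    then show ?thesis
      unfolding ip_def by (intro sum.neutral) simp
  next
    case False
    have "?ip y ?w = 0"
      using p(2)[OF y(1)] by (simp add: ip_commute)
    then show ?thesis
      unfolding ip_q ip_minus_left[of "{1..N}" x y ?w] using False by simp
  qed
  moreover have "?ip (x - q) b = ?ip (x - q) ?w + ?ip (x - q) p"
    unfolding ip_def by (simp add: sum.distrib[symmetric] algebra_simps)
  ultimately have "?ip (x - q) b = 0"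
    using base[OF p(1)] by simp
  then have "?ip (x - q) c = 0" if "c \<in> insert b B" for c
    using that base[OF span_base[of c B]] by blast
  then have "?ip (x - q) z = 0" if "z \<in> span (insert b B)" for z
    using that by (rule ip_orthogonal_span)
  with q show ?case by blast
qed

lemma grassmannian_span:
  assumes "E \<in> grassmannian N n" "n < N"
  obtains B where "finite B" "B \<subseteq> rn N" "card B = N - n" "span B = E"
proof -
  have E: "subspace E" "E \<subseteq> rn N" "dim E = N - n"
    using assms by (auto simp: grassmannian_def)
  obtain B where B: "B \<subseteq> E" "independent B" "E \<subseteq> span B" "card B = dim E"
    using basis_exists by blast
  \<comment> \<open>\<open>n < N\<close> makes the cardinality positive, whereas infinite sets have
    cardinality 0.\<close>
  have "finite B"
    using B(4) E(3) assms(2) by (intro card_ge_0_finite) simp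
  moreover have "span B = E"
    using B E(1) span_minimal by blast
  ultimately show thesis
    using B E by (intro that[of B]) auto
qed

lemma orth_proj:
  assumes "E \<in> grassmannian N n" "n < N"
  shows orth_proj_mem: "orth_proj N E x \<in> E"
    and orth_proj_orthogonal: "z \<in> E \<Longrightarrow> ip {1..N} (x - orth_proj N E x) z = 0"
    and orth_proj_unique: "y \<in> E \<Longrightarrow> (\<And>z. z \<in> E \<Longrightarrow> ip {1..N} (x - y) z = 0) \<Longrightarrow> orth_proj N E x = y"
proof -
  let ?P = "\<lambda>y. y \<in> E \<and> (\<forall>z\<in>E. inner_rn N (x - y) z = 0)"
  have E: "subspace E" "E \<subseteq> rn N"
    using assms by (auto simp: grassmannian_def)
  have unique: "y = y'" if "?P y" "?P y'" for y y'
  proof -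
    have "y - y' \<in> E"
      using that E by (simp add: subspace_diff)
    then have "ip {1..N} (x - y') (y - y') = 0" "ip {1..N} (x - y) (y - y') = 0"
      using that by (auto simp: inner_rn_eq_ip)
    then have "ip {1..N} (y - y') (y - y') = 0"
      by (simp add: ip_minus_left)
    then have "y i = y' i" if "i \<in> {1..N}" for i
      using that by (simp add: ip_self_eq_0)
    moreover have "y \<in> rn N" "y' \<in> rn N"
      using that E by auto
    ultimately show ?thesis
      unfolding rn_def fun_eq_iff by (metis (mono_tags, lifting) mem_Collect_eq)
  qed
  obtain B where B: "finite B" "B \<subseteq> rn N" "span B = E"
    using grassmannian_span[OF assms] by metis
  have ex: "\<exists>y. ?P y"
    using projection_span_exists[OF B(1,2), of x] B(3) by (auto simp: inner_rn_eq_ip)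
  have "?P (orth_proj N E x)"
    unfolding orth_proj_def using theI'[of ?P] ex unique by blast
  then show "orth_proj N E x \<in> E" "z \<in> E \<Longrightarrow> ip {1..N} (x - orth_proj N E x) z = 0"
    by (auto simp: inner_rn_eq_ip)
  show "y \<in> E \<Longrightarrow> (\<And>z. z \<in> E \<Longrightarrow> ip {1..N} (x - y) z = 0) \<Longrightarrow> orth_proj N E x = y"
    using unique \<open>?P (orth_proj N E x)\<close> by (auto simp: inner_rn_eq_ip)
qed

lemma ip_minus_right: "ip I z (x - y) = ip I z x - ip I z y"
  by (simp only: ip_commute[of I z] ip_minus_left)

lemma ip_orth_proj:
  assumes E: "E \<in> grassmannian N n" "n < N"
  shows "ip {1..N} (orth_proj N E x) y = ip {1..N} (orth_proj N E x) (orth_proj N E y)"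
proof -
  have "ip {1..N} (y - orth_proj N E y) (orth_proj N E x) = 0"
    by (rule orth_proj_orthogonal[OF E orth_proj_mem[OF E]])
  then show ?thesis
    by (simp only: ip_minus_left) (simp only: ip_commute[of _ _ "orth_proj N E x"] right_minus_eq)
qed

text \<open>Expresses the projection through the matrix entries, the functions of \<open>E\<close>
  that \<open>borel_grassmannian\<close> makes measurable by construction.\<close>

lemma orth_proj_eq_proj_matrix:
  assumes E: "E \<in> grassmannian N n" "n < N"
  shows "orth_proj N E x i = (\<Sum>j = 1..N. x j * proj_matrix N E i j)"
proof -
  let ?e = "\<lambda>j l. if l = j then 1 else 0 :: real"
  define y where "y = (\<lambda>l. \<Sum>j = 1..N. x j * proj_matrix N E l j)"
  have sub: "subspace E"
    using E by (simp add: grassmannian_def)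
  have y_eq: "y = (\<Sum>j = 1..N. x j *\<^sub>R orth_proj N E (?e j))"
  proof
    fix l
    have "(\<Sum>j\<in>J. x j *\<^sub>R orth_proj N E (?e j)) l = (\<Sum>j\<in>J. x j * proj_matrix N E l j)" for J
      by (induction J rule: infinite_finite_induct) (simp_all add: proj_matrix_def scaleR_fun_def)
    then show "y l = (\<Sum>j = 1..N. x j *\<^sub>R orth_proj N E (?e j)) l"
      by (simp only: y_def)
  qed
  have "orth_proj N E x = y"
  proof (rule orth_proj_unique[OF E])
    show "y \<in> E"
      unfolding y_eq by (rule subspace_sum[OF sub], rule subspace_scale[OF sub], rule orth_proj_mem[OF E])
    fix z assume z: "z \<in> E"
    have "ip {1..N} (\<lambda>l. proj_matrix N E l j) z = z j" if "j \<in> {1..N}" for j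
    proof -
      have "ip {1..N} (?e j) z - ip {1..N} (orth_proj N E (?e j)) z = 0"
        using orth_proj_orthogonal[OF E z, of "?e j"] by (simp only: ip_minus_left)
      moreover have "ip {1..N} (?e j) z = z j"
        using that by (subst ip_unit) auto
      ultimately show ?thesis
        by (simp only: proj_matrix_def)
    qed
    then have "(\<Sum>j = 1..N. x j * ip {1..N} (\<lambda>l. proj_matrix N E l j) z) = (\<Sum>j = 1..N. x j * z j)"
      by (intro sum.cong refl arg_cong2[where f = "(*)"])
    then have "ip {1..N} y z = ip {1..N} x z"
      unfolding y_def ip_sum_left ip_mult_left by (simp only: ip_def)
    then show "ip {1..N} (x - y) z = 0"
      by (simp only: ip_minus_left diff_self)
  qed
  then show ?thesis
    by (simp only: y_def)
qed

section \<open>Measurability and reflections on the Grassmannian\<close>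

lemma space_borel_grassmannian [simp]: "space (borel_grassmannian N n) = grassmannian N n"
  by (simp add: borel_grassmannian_def)

lemma borel_measurable_proj_matrix [measurable]:
  "(\<lambda>E. proj_matrix N E i j) \<in> borel_measurable (borel_grassmannian N n)"
proof -
  have "proj_matrix N \<in> measurable (borel_grassmannian N n) borel"
    unfolding borel_grassmannian_def by (rule measurable_vimage_algebra1) auto
  then have "(\<lambda>E. proj_matrix N E i) \<in> measurable (borel_grassmannian N n) borel"
    by (rule measurable_product_then_coordinatewise)
  then show ?thesis
    by (rule measurable_product_then_coordinatewise)
qed

lemma measurable_into_borel_grassmannian:
  assumes "f \<in> space M \<rightarrow> grassmannian N n" and "\<And>i j. (\<lambda>w. proj_matrix N (f w) i j) \<in> borel_measurable M"
  shows "f \<in> measurable M (borel_grassmannian N n)"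
  unfolding borel_grassmannian_def
proof (rule measurable_vimage_algebra2)
  show "(\<lambda>w. proj_matrix N (f w)) \<in> measurable M borel"
    using assms(2) by (intro measurable_coordinatewise_then_product)
qed fact

lemma reflect_rn: "a \<in> rn N \<Longrightarrow> x \<in> rn N \<Longrightarrow> reflect I a x \<in> rn N"
  by (auto simp: rn_def reflect_def)

lemma linear_reflect: "linear (reflect I a)"
proof (rule linearI)
  fix x y :: "'a \<Rightarrow> real" and c :: real
  have "ip I a (x + y) = ip I a x + ip I a y"
    unfolding ip_commute[of I a] by (rule ip_plus_left)
  then show "reflect I a (x + y) = reflect I a x + reflect I a y"
    by (simp add: reflect_def fun_eq_iff add_divide_distrib distrib_left distrib_right)
  have "ip I a (c *\<^sub>R x) = c * ip I a x"
    unfolding ip_commute[of I a] by (rule ip_scaleR_left)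
  then show "reflect I a (c *\<^sub>R x) = c *\<^sub>R reflect I a x"
    by (simp add: reflect_def fun_eq_iff scaleR_fun_def right_diff_distrib)
qed

lemma orthogonal_rn_reflect: "a \<in> rn N \<Longrightarrow> orthogonal_rn N (reflect {1..N} a)"
  by (auto simp: orthogonal_rn_def linear_reflect inner_rn_eq_ip ip_reflect reflect_rn)

lemma reflect_image_grassmannian:
  assumes "E \<in> grassmannian N n" "n < N" "a \<in> rn N"
  shows "reflect {1..N} a ` E \<in> grassmannian N n"
proof -
  let ?U = "reflect {1..N} a"
  have E: "subspace E" "E \<subseteq> rn N" "dim E + n = N"
    using assms by (auto simp: grassmannian_def)
  have inj: "inj ?U"
    by (rule inj_on_inverseI[of _ ?U]) (rule reflect_reflect)
  obtain B where B: "B \<subseteq> E" "independent B" "E \<subseteq> span B" "card B = dim E"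
    using basis_exists by blast
  have span_B: "span B = E"
    using B E(1) by (intro span_subspace)
  have "independent (?U ` B)"
    by (intro linear_independent_injective_image linear_reflect B inj_on_subset[OF inj]) auto
  moreover have "span (?U ` B) = span (?U ` E)"
    unfolding linear_span_image[OF linear_reflect] span_B
    using linear_subspace_image[OF linear_reflect E(1)] by (simp add: span_eq_iff[THEN iffD2] E(1))
  moreover have "card (?U ` B) = card B"
    by (intro card_image inj_on_subset[OF inj]) auto
  ultimately have "dim (?U ` E) = dim E"
    using dim_eq_card[of "?U ` B" "?U ` E"] B(4) by simp
  then show ?thesis
    using E assms(3) linear_subspace_image[OF linear_reflect E(1)]
    by (auto simp: grassmannian_def intro: reflect_rn)
qed

lemma orth_proj_reflect_image:
  assumes E: "E \<in> grassmannian N n" "n < N" "a \<in> rn N"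
  shows "orth_proj N (reflect {1..N} a ` E) x = reflect {1..N} a (orth_proj N E (reflect {1..N} a x))"
proof (rule orth_proj_unique[OF reflect_image_grassmannian[OF E] E(2)])
  let ?U = "reflect {1..N} a" and ?ip = "ip {1..N}"
  show "?U (orth_proj N E (?U x)) \<in> ?U ` E"
    using orth_proj_mem[OF E(1,2)] by blast
  fix z assume "z \<in> ?U ` E"
  then obtain y where y: "y \<in> E" "z = ?U y" by blast
  have "?ip (x - ?U (orth_proj N E (?U x))) (?U y) = ?ip x (?U y) - ?ip (?U (orth_proj N E (?U x))) (?U y)"
    by (rule ip_minus_left)
  also have "\<dots> = ?ip (?U x - orth_proj N E (?U x)) y"
    unfolding ip_reflect by (simp only: ip_minus_left ip_reflect_left)
  also have "\<dots> = 0"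
    by (rule orth_proj_orthogonal[OF E(1,2) y(1)])
  finally show "?ip (x - ?U (orth_proj N E (?U x))) z = 0"
    by (simp only: y)
qed

lemma measurable_reflect_image:
  assumes "n < N" "a \<in> rn N"
  shows "(\<lambda>E. reflect {1..N} a ` E) \<in> measurable (borel_grassmannian N n) (borel_grassmannian N n)"
proof (rule measurable_into_borel_grassmannian)
  show "(\<lambda>E. reflect {1..N} a ` E) \<in> space (borel_grassmannian N n) \<rightarrow> grassmannian N n"
    using reflect_image_grassmannian assms by auto
  fix i j
  let ?U = "reflect {1..N} a" and ?e = "\<lambda>l::nat. if l = j then 1 else 0 :: real"
  have meas: "(\<lambda>E. ?U (\<lambda>i. \<Sum>l = 1..N. ?U ?e l * proj_matrix N E i l) i) \<in> borel_measurable (borel_grassmannian N n)"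
    unfolding reflect_def ip_def by measurable
  have eq: "proj_matrix N (?U ` E) i j = ?U (\<lambda>i. \<Sum>l = 1..N. ?U ?e l * proj_matrix N E i l) i"
    if "E \<in> space (borel_grassmannian N n)" for E
    using that assms
    by (simp only: space_borel_grassmannian proj_matrix_def[of N "?U ` E"] orth_proj_reflect_image orth_proj_eq_proj_matrix)
       (intro arg_cong[where f = "\<lambda>f. ?U f i"] ext, simp add: orth_proj_eq_proj_matrix)
  show "(\<lambda>E. proj_matrix N (?U ` E) i j) \<in> borel_measurable (borel_grassmannian N n)"
    by (rule measurable_cong[THEN iffD2, OF eq meas])
qed

lemma haar_grassmannian_reflect:
  assumes "haar_grassmannian N n \<mu>" "n < N" "a \<in> rn N"
  shows "distr \<mu> \<mu> (\<lambda>E. reflect {1..N} a ` E) = \<mu>"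
    and "(\<lambda>E. reflect {1..N} a ` E) \<in> measurable \<mu> \<mu>"
proof -
  have s: "sets \<mu> = sets (borel_grassmannian N n)"
    using assms(1) by (simp add: haar_grassmannian_def)
  have "distr \<mu> (borel_grassmannian N n) (\<lambda>E. reflect {1..N} a ` E) = \<mu>"
    using assms orthogonal_rn_reflect by (auto simp: haar_grassmannian_def)
  moreover have "distr \<mu> (borel_grassmannian N n) (\<lambda>E. reflect {1..N} a ` E) = distr \<mu> \<mu> (\<lambda>E. reflect {1..N} a ` E)"
    by (rule distr_cong) (auto simp: s)
  ultimately show "distr \<mu> \<mu> (\<lambda>E. reflect {1..N} a ` E) = \<mu>" by simp
  show "(\<lambda>E. reflect {1..N} a ` E) \<in> measurable \<mu> \<mu>"
    using measurable_reflect_image[OF assms(2,3)] measurable_cong_sets[OF s s] by blast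
qed

section \<open>Projection onto the orthogonal complement within a coordinate subspace\<close>

text \<open>Unlike \<open>restrict\<close>, this cuts off by 0, so that for
  \<open>A \<subseteq> {1..N}\<close> the result lies in \<open>rn N\<close>.\<close>

definition supp_restrict :: "nat set \<Rightarrow> (nat \<Rightarrow> real) \<Rightarrow> nat \<Rightarrow> real"
  where "supp_restrict A x = (\<lambda>i. if i \<in> A then x i else 0)"

lemma ip_supp_restrict_left: "A \<subseteq> {1..N} \<Longrightarrow> ip {1..N} (supp_restrict A x) y = ip A x y"
  unfolding ip_def supp_restrict_def by (rule sum.mono_neutral_cong_right) auto

lemma ip_supp_restrict_right: "A \<subseteq> {1..N} \<Longrightarrow> ip {1..N} y (supp_restrict A x) = ip A y x"
  by (metis ip_commute ip_supp_restrict_left)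

text \<open>One step subtracts the projection onto \<open>E\<close> and then deletes the coordinates
  outside \<open>A\<close>. The projection is spelled out in matrix entries so that the
  measurability of the iterates in \<open>E\<close> can be read off.\<close>

primrec alt_proj :: "nat \<Rightarrow> nat set \<Rightarrow> (nat \<Rightarrow> real) set \<Rightarrow> (nat \<Rightarrow> real) \<Rightarrow> nat \<Rightarrow> nat \<Rightarrow> real"
  where
    "alt_proj N A E x 0 = supp_restrict A x"
  | "alt_proj N A E x (Suc j) =
      supp_restrict A (\<lambda>i. alt_proj N A E x j i - (\<Sum>l = 1..N. alt_proj N A E x j l * proj_matrix N E i l))"

text \<open>The orthogonal projection onto the vectors supported in \<open>A\<close> that are orthogonal to \<open>E\<close>, as a limit of
  alternating projections; this makes it a measurable function of \<open>E\<close>.\<close>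

definition coproj :: "nat \<Rightarrow> nat set \<Rightarrow> (nat \<Rightarrow> real) set \<Rightarrow> (nat \<Rightarrow> real) \<Rightarrow> nat \<Rightarrow> real"
  where "coproj N A E x = (\<lambda>i. lim (\<lambda>j. alt_proj N A E x j i))"

context
  fixes N n :: nat and E :: "(nat \<Rightarrow> real) set" and A :: "nat set"
  assumes E: "E \<in> grassmannian N n" "n < N" and A: "A \<subseteq> {1..N}"
begin

private abbreviation "P \<equiv> orth_proj N E"
private abbreviation "inn \<equiv> ip {1..N}"

private lemma alt_Suc: "alt_proj N A E x (Suc j) = supp_restrict A (alt_proj N A E x j - P (alt_proj N A E x j))"
  by (simp add: orth_proj_eq_proj_matrix[OF E] fun_diff_def)

private lemma cut_alt: "supp_restrict A (alt_proj N A E x j) = alt_proj N A E x j"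
  by (cases j) (auto simp: supp_restrict_def)

private lemma inn_alt_Suc:
  "inn (alt_proj N A E x (Suc j)) (alt_proj N A E x l) = inn (alt_proj N A E x j) (alt_proj N A E x l) -
    inn (P (alt_proj N A E x j)) (P (alt_proj N A E x l))"
proof -
  let ?z = "alt_proj N A E x"
  have "inn (?z (Suc j)) (?z l) = inn (?z j - P (?z j)) (supp_restrict A (?z l))"
    unfolding alt_Suc ip_supp_restrict_left[OF A] ip_supp_restrict_right[OF A] ..
  then show ?thesis
    by (simp only: cut_alt ip_minus_left ip_orth_proj[OF E, of "?z j" "?z l"])
qed

text \<open>A step is self-adjoint on vectors supported in \<open>A\<close>, so steps can be moved
  from one argument to the other.\<close>

private lemma inn_alt_shift: "inn (alt_proj N A E x j) (alt_proj N A E x l) = inn (alt_proj N A E x 0) (alt_proj N A E x (j + l))"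
proof (induction j arbitrary: l)
  case (Suc j)
  have "inn (alt_proj N A E x (Suc j)) (alt_proj N A E x l) = inn (alt_proj N A E x (Suc l)) (alt_proj N A E x j)"
    unfolding inn_alt_Suc by (simp only: ip_commute)
  also have "\<dots> = inn (alt_proj N A E x j) (alt_proj N A E x (Suc l))"
    by (rule ip_commute)
  finally show ?case
    using Suc[of "Suc l"] by simp
qed simp

text \<open>Neither half of a step increases the length. For the inner products
  \<open>a (j + l)\<close> of two iterates this says
  \<open>a (2 j + 2) \<le> a (2 j + 1) \<le> a (2 j)\<close>.\<close>

private lemma alt_Suc_le: "inn (alt_proj N A E x (Suc j)) (alt_proj N A E x (Suc j)) \<le> inn (alt_proj N A E x (Suc j)) (alt_proj N A E x j)"
  "inn (alt_proj N A E x (Suc j)) (alt_proj N A E x j) \<le> inn (alt_proj N A E x j) (alt_proj N A E x j)"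
proof -
  let ?z = "alt_proj N A E x j" and ?z' = "alt_proj N A E x (Suc j)"
  let ?w = "?z - P ?z"
  show "inn ?z' ?z \<le> inn ?z ?z"
    unfolding inn_alt_Suc by simp
  have "inn ?w (P ?z) = 0"
    by (rule orth_proj_orthogonal[OF E orth_proj_mem[OF E]])
  then have "inn ?w ?w = inn ?w ?z"
    unfolding ip_minus_right by simp
  also have "\<dots> = inn ?z' ?z"
    by (simp only: inn_alt_Suc ip_minus_left ip_orth_proj[OF E, of ?z ?z])
  finally have w: "inn ?w ?w = inn ?z' ?z" .
  have "inn ?z' ?z' = ip A ?w ?w"
    unfolding alt_Suc ip_supp_restrict_left[OF A] by (intro ip_cong) (auto simp: supp_restrict_def)
  also have "\<dots> \<le> inn ?w ?w"
    unfolding ip_def using A by (intro sum_mono2) auto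
  finally show "inn ?z' ?z' \<le> inn ?z' ?z"
    unfolding w .
qed

private lemma alt_convergent: "convergent (\<lambda>j. alt_proj N A E x j i)"
proof -
  let ?z = "alt_proj N A E x"
  define a where "a m = inn (?z 0) (?z m)" for m
  have a: "inn (?z j) (?z l) = a (j + l)" for j l
    unfolding a_def by (rule inn_alt_shift)
  have dec: "decseq a"
  proof (rule decseq_SucI)
    fix m
    show "a (Suc m) \<le> a m"
    proof (cases "even m")
      case True
      then obtain j where "m = j + j" by (metis evenE mult_2)
      then show ?thesis
        using alt_Suc_le(2)[of x j] unfolding a by simp
    next
      case False
      then obtain j where "m = Suc (j + j)" by (metis oddE mult_2 Suc_eq_plus1)
      then show ?thesis
        using alt_Suc_le(1)[of x j] unfolding a by simp
    qed
  qed
  have nonneg: "0 \<le> a m" for m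
    using a[of m m] ip_self_nonneg[of "{1..N}" "?z m"] decseqD[OF dec, of m "m + m"] by simp
  obtain L where L: "a \<longlonglongrightarrow> L" "\<And>m. L \<le> a m"
    using decseq_convergent[OF dec, of 0] nonneg by blast
  \<comment> \<open>The squared distance of two iterates is
    \<open>a (2 j) - 2 a (j + l) + a (2 l)\<close>, and monotonicity leaves at most
    \<open>a (2 l) - L\<close> for \<open>l \<le> j\<close>. Hence each coordinate is a Cauchy
    sequence.\<close>
  have coord: "(?z j i - ?z l i)\<^sup>2 \<le> a (2 * l) - L" if "l \<le> j" for j l
  proof (cases "i \<in> A")
    case True
    let ?d = "?z j - ?z l"
    have "(?d i)\<^sup>2 \<le> inn ?d ?d"
      unfolding ip_def power2_eq_square using True A by (intro member_le_sum[where f = "\<lambda>i. ?d i * ?d i"]) auto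
    also have "\<dots> = a (j + j) - a (j + l) - (a (j + l) - a (l + l))"
      by (simp only: ip_minus_left ip_minus_right a add.commute[of l j])
    also have "\<dots> \<le> a (2 * l) - L"
    proof -
      have "a (j + j) \<le> a (j + l)"
        using that by (intro decseqD[OF dec]) simp
      then show ?thesis
        unfolding mult_2 using L(2)[of "j + l"] by simp
    qed
    finally show ?thesis by simp
  next
    case False
    then have "?z j i = 0" for j
      by (cases j) (auto simp: supp_restrict_def)
    then show ?thesis
      using L(2) by simp
  qed
  have "Cauchy (\<lambda>j. ?z j i)"
  proof (rule metric_CauchyI)
    fix e :: real assume e: "0 < e"
    then have "\<forall>\<^sub>F m in sequentially. a m < L + e\<^sup>2"
      using L(1) by (intro order_tendstoD(2)) auto
    then obtain M where M: "\<And>m. M \<le> m \<Longrightarrow> a m < L + e\<^sup>2"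
      by (auto simp: eventually_sequentially)
    have close: "\<bar>?z j i - ?z l i\<bar> < e" if "M \<le> l" "l \<le> j" for j l
    proof -
      have "(?z j i - ?z l i)\<^sup>2 < e\<^sup>2"
        using coord[OF that(2)] M[of "2 * l"] that(1) by simp
      then show ?thesis
        using e by (intro power2_less_imp_less[of "\<bar>alt_proj N A E x j i - alt_proj N A E x l i\<bar>" e]) simp_all
    qed
    show "\<exists>M. \<forall>m\<ge>M. \<forall>n\<ge>M. dist (?z m i) (?z n i) < e"
    proof (intro exI allI impI)
      fix m n assume "M \<le> m" "M \<le> n"
      then show "dist (?z m i) (?z n i) < e"
        using close[of m n] close[of n m] by (cases "m \<le> n") (auto simp: dist_real_def abs_minus_commute)
    qed
  qed
  then show ?thesis
    by (rule Cauchy_convergent)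
qed

private lemma alt_LIMSEQ: "(\<lambda>j. alt_proj N A E x j i) \<longlonglongrightarrow> coproj N A E x i"
  unfolding coproj_def using alt_convergent by (simp add: convergent_LIMSEQ_iff)

lemma coproj_supp: "i \<notin> A \<Longrightarrow> coproj N A E x i = 0"
proof -
  assume "i \<notin> A"
  then have "alt_proj N A E x j i = 0" for j
    by (cases j) (auto simp: supp_restrict_def)
  then show ?thesis
    by (simp add: coproj_def lim_const)
qed

text \<open>The limit \<open>v\<close> is fixed by a step. Pairing that equation with
  \<open>v\<close> gives \<open>|v|^2 = |v|^2 - |P v|^2\<close>, so \<open>P v\<close> vanishes on
  \<open>{1..N}\<close>.\<close>

lemma coproj_orthogonal:
  assumes "z \<in> E"
  shows "ip {1..N} (coproj N A E x) z = 0"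
proof -
  let ?v = "coproj N A E x"
  have cut_v: "supp_restrict A ?v = ?v"
    by (auto simp: supp_restrict_def coproj_supp)
  have "(\<lambda>j. alt_proj N A E x (Suc j) i) \<longlonglongrightarrow> supp_restrict A (\<lambda>i. ?v i - (\<Sum>l = 1..N. ?v l * proj_matrix N E i l)) i" for i
    by (auto simp: supp_restrict_def intro!: tendsto_intros alt_LIMSEQ)
  then have "?v i = supp_restrict A (\<lambda>i. ?v i - (\<Sum>l = 1..N. ?v l * proj_matrix N E i l)) i" for i
    using LIMSEQ_unique LIMSEQ_Suc[OF alt_LIMSEQ] by blast
  then have "?v = supp_restrict A (\<lambda>i. ?v i - (\<Sum>l = 1..N. ?v l * proj_matrix N E i l))"
    by (rule ext)
  also have "(\<lambda>i. ?v i - (\<Sum>l = 1..N. ?v l * proj_matrix N E i l)) = ?v - P ?v"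
    unfolding fun_diff_def orth_proj_eq_proj_matrix[OF E] ..
  finally have v_eq: "?v = supp_restrict A (?v - P ?v)" .
  have "inn ?v ?v = inn (supp_restrict A (?v - P ?v)) ?v"
    by (rule arg_cong[OF v_eq, of "\<lambda>u. inn u ?v"])
  also have "\<dots> = inn (?v - P ?v) (supp_restrict A ?v)"
    unfolding ip_supp_restrict_left[OF A] ip_supp_restrict_right[OF A] ..
  also have "\<dots> = inn ?v ?v - inn (P ?v) (P ?v)"
    by (simp only: cut_v ip_minus_left ip_orth_proj[OF E, of ?v ?v])
  finally have "inn (P ?v) (P ?v) = 0"
    by simp
  then have "\<forall>i\<in>{1..N}. P ?v i = 0"
    by (simp only: ip_self_eq_0 finite_atLeastAtMost)
  then have "inn (P ?v) z = 0"
    unfolding ip_def by (intro sum.neutral) simp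
  moreover have "inn (?v - P ?v) z = 0"
    by (rule orth_proj_orthogonal[OF E assms])
  ultimately show ?thesis
    by (simp only: ip_minus_left)
qed

text \<open>A step does not change the inner product with a vector that is supported in
  \<open>A\<close> and orthogonal to \<open>E\<close>; this passes to the limit.\<close>

lemma ip_coproj:
  assumes y: "\<And>i. i \<notin> A \<Longrightarrow> y i = 0" "\<And>z. z \<in> E \<Longrightarrow> ip {1..N} y z = 0"
  shows "ip {1..N} (coproj N A E x) y = ip {1..N} x y"
proof -
  have cut_y: "supp_restrict A y = y"
    by (auto simp: supp_restrict_def y)
  have "inn (alt_proj N A E x j) y = inn x y" for j
  proof (induction j)
    case 0
    have "inn (supp_restrict A x) y = inn x (supp_restrict A y)"
      unfolding ip_supp_restrict_left[OF A] ip_supp_restrict_right[OF A] ..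
    then show ?case by (simp only: alt_proj.simps cut_y)
  next
    case (Suc j)
    let ?z = "alt_proj N A E x j"
    have "inn (alt_proj N A E x (Suc j)) y = inn (?z - P ?z) (supp_restrict A y)"
      unfolding alt_Suc ip_supp_restrict_left[OF A] ip_supp_restrict_right[OF A] ..
    also have "\<dots> = inn ?z y - inn y (P ?z)"
      by (simp only: cut_y ip_minus_left ip_commute[of _ y])
    also have "\<dots> = inn ?z y"
      using y(2)[OF orth_proj_mem[OF E]] by simp
    finally show ?case using Suc by simp
  qed
  moreover have "(\<lambda>j. inn (alt_proj N A E x j) y) \<longlonglongrightarrow> inn (coproj N A E x) y"
    unfolding ip_def by (intro tendsto_intros alt_LIMSEQ)
  ultimately show ?thesis
    by (simp add: LIMSEQ_const_iff)
qed

text \<open>Homogeneity and equivariance under reflections are derived from this characterisation of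
  the projection instead of from the limit.\<close>

lemma coproj_unique:
  assumes v: "\<And>i. i \<notin> A \<Longrightarrow> v i = 0" "\<And>z. z \<in> E \<Longrightarrow> ip {1..N} v z = 0"
    and "\<And>y. (\<And>i. i \<notin> A \<Longrightarrow> y i = 0) \<Longrightarrow> (\<And>z. z \<in> E \<Longrightarrow> ip {1..N} y z = 0) \<Longrightarrow> ip {1..N} v y = ip {1..N} x y"
  shows "coproj N A E x = v"
proof -
  let ?d = "coproj N A E x - v"
  have d: "\<And>i. i \<notin> A \<Longrightarrow> ?d i = 0" "\<And>z. z \<in> E \<Longrightarrow> inn ?d z = 0"
    using v coproj_supp coproj_orthogonal by (auto simp: ip_minus_left)
  have "inn (coproj N A E x) ?d = inn v ?d"
    using ip_coproj[of ?d x] assms(3)[of ?d] d by simp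
  then have "inn ?d ?d = 0"
    by (simp only: ip_minus_left[of _ _ _ ?d])
  then have "?d i = 0" if "i \<in> {1..N}" for i
    using that by (simp only: ip_self_eq_0 finite_atLeastAtMost)
  with d(1) A have "?d i = 0" for i
    by blast
  then show ?thesis
    by (auto simp: fun_eq_iff)
qed

lemma coproj_mult: "coproj N A E (\<lambda>i. c * x i) = (\<lambda>i. c * coproj N A E x i)"
proof (rule coproj_unique)
  show "c * coproj N A E x i = 0" if "i \<notin> A" for i
    using coproj_supp[OF that] by simp
  show "inn (\<lambda>i. c * coproj N A E x i) z = 0" if "z \<in> E" for z
    unfolding ip_mult_left coproj_orthogonal[OF that] by simp
  show "inn (\<lambda>i. c * coproj N A E x i) y = inn (\<lambda>i. c * x i) y"
    if "\<And>i. i \<notin> A \<Longrightarrow> y i = 0" "\<And>z. z \<in> E \<Longrightarrow> inn y z = 0" for y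
  proof -
    have "inn (coproj N A E x) y = inn x y"
      by (rule ip_coproj) (use that in auto)
    then show ?thesis
      by (simp only: ip_mult_left)
  qed
qed

lemma ip_coproj_self: "ip {1..N} x (coproj N A E x) = ip {1..N} (coproj N A E x) (coproj N A E x)"
  using ip_coproj[of "coproj N A E x" x] coproj_supp coproj_orthogonal by simp

end

text \<open>As \<open>a\<close> is supported in \<open>A\<close>, the reflection preserves the space
  of vectors supported in \<open>A\<close>, and so it carries the projection for \<open>E\<close> to
  the one for its image.\<close>

lemma coproj_reflect:
  assumes E: "E \<in> grassmannian N n" "n < N" and A: "A \<subseteq> {1..N}" and a: "\<And>i. i \<notin> A \<Longrightarrow> a i = 0"
  shows "coproj N A (reflect {1..N} a ` E) (reflect {1..N} a x) = reflect {1..N} a (coproj N A E x)"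
proof (rule coproj_unique[OF _ E(2) A])
  let ?U = "reflect {1..N} a" and ?v = "coproj N A E x"
  have "a i = 0" if "i \<notin> {1..N}" for i
    using that A by (intro a) blast
  then have a_rn: "a \<in> rn N"
    unfolding rn_def by blast
  show "?U ` E \<in> grassmannian N n"
    by (rule reflect_image_grassmannian[OF E a_rn])
  show "?U ?v i = 0" if "i \<notin> A" for i
    using that by (simp add: reflect_def a coproj_supp[OF E A])
  show "ip {1..N} (?U ?v) z = 0" if "z \<in> ?U ` E" for z
    using that coproj_orthogonal[OF E A] by (auto simp: ip_reflect)
  fix y assume y: "\<And>i. i \<notin> A \<Longrightarrow> y i = 0" "\<And>z. z \<in> ?U ` E \<Longrightarrow> ip {1..N} y z = 0"
  have "ip {1..N} (?U ?v) y = ip {1..N} ?v (?U y)"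
    by (rule ip_reflect_left)
  also have "\<dots> = ip {1..N} x (?U y)"
  proof (rule ip_coproj[OF E A])
    show "?U y i = 0" if "i \<notin> A" for i
      using that by (simp add: reflect_def a y(1))
    show "ip {1..N} (?U y) z = 0" if "z \<in> E" for z
      using y(2)[of "?U z"] that by (simp add: ip_reflect_left)
  qed
  also have "\<dots> = ip {1..N} (?U x) y"
    by (rule ip_reflect_left[symmetric])
  finally show "ip {1..N} (?U ?v) y = ip {1..N} (?U x) y" .
qed

lemma coproj_cong: "(\<And>i. i \<in> A \<Longrightarrow> x i = y i) \<Longrightarrow> coproj N A E x = coproj N A E y"
proof -
  assume *: "\<And>i. i \<in> A \<Longrightarrow> x i = y i"
  have "alt_proj N A E x j = alt_proj N A E y j" for j
    by (induction j) (auto simp: supp_restrict_def fun_eq_iff *)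
  then show ?thesis
    by (simp add: coproj_def)
qed

lemma borel_measurable_coproj [measurable]:
  assumes [measurable]: "f \<in> measurable M (borel_grassmannian N n)"
    and [measurable]: "\<And>i. i \<in> A \<Longrightarrow> (\<lambda>w. g w i) \<in> borel_measurable M"
  shows "(\<lambda>w. coproj N A (f w) (g w) i) \<in> borel_measurable M"
proof -
  have [measurable]: "(\<lambda>w. proj_matrix N (f w) i l) \<in> borel_measurable M" for i l
    using measurable_compose[OF assms(1) borel_measurable_proj_matrix] .
  have "(\<lambda>w. alt_proj N A (f w) (g w) j i) \<in> borel_measurable M" for j i
  proof (induction j arbitrary: i)
    case 0
    show ?case by (cases "i \<in> A") (simp_all add: supp_restrict_def)
  next
    case (Suc j)
    note [measurable] = Suc
    show ?case by (cases "i \<in> A") (simp_all add: supp_restrict_def)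
  qed
  then show ?thesis
    unfolding coproj_def by (intro borel_measurable_lim_metric)
qed

section \<open>Measurability of events that quantify over a compact set\<close>

lemma sets_ex_compact_zero:
  fixes C :: "(nat \<Rightarrow> real) set" and f :: "'w \<Rightarrow> (nat \<Rightarrow> real) \<Rightarrow> real"
  assumes C: "compact C" and [measurable]: "\<And>x. x \<in> C \<Longrightarrow> (\<lambda>w. f w x) \<in> borel_measurable M"
    and cont: "\<And>w. w \<in> space M \<Longrightarrow> continuous_on C (f w)" and nonneg: "\<And>w x. 0 \<le> f w x"
  shows "{w \<in> space M. \<exists>x\<in>C. f w x = 0} \<in> sets M"
proof -
  obtain D where D: "countable D" "D \<subseteq> C" "C \<subseteq> closure D"
    using separable[of C] by metis
  \<comment> \<open>On the compact set \<open>C\<close> a zero exists iff the infimum of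
    \<open>f w\<close> is 0, and by continuity the infimum may be taken over the countable dense
    subset \<open>D\<close>.\<close>
  have "{w \<in> space M. \<exists>x\<in>C. f w x = 0} = (\<Inter>n::nat. \<Union>x\<in>D. {w \<in> space M. f w x < 1 / real (Suc n)})" (is "?L = ?R")
  proof (intro equalityI subsetI)
    fix w assume "w \<in> ?L"
    then obtain x where w: "w \<in> space M" and x: "x \<in> C" "f w x = 0" by blast
    have "\<exists>y\<in>D. f w y < 1 / real (Suc n)" for n
    proof -
      have "open {..<1 / real (Suc n)}" by simp
      then obtain U where U: "open U" "U \<inter> C = f w -` {..<1 / real (Suc n)} \<inter> C"
        using cont[OF w] by (metis continuous_on_open_invariant)
      have "x \<in> U \<inter> closure D"
        using x U D(3) by auto
      then have "U \<inter> D \<noteq> {}"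
        using open_Int_closure_eq_empty[OF U(1)] by blast
      then show ?thesis
        using U(2) D(2) by auto
    qed
    then show "w \<in> ?R"
      using w by auto
  next
    fix w assume w_R: "w \<in> ?R"
    then have w: "w \<in> space M" and small: "\<And>n. \<exists>x\<in>D. f w x < 1 / real (Suc n)" by auto
    have "C \<noteq> {}"
      using small[of 0] D(2) by auto
    then obtain x where x: "x \<in> C" "\<And>y. y \<in> C \<Longrightarrow> f w x \<le> f w y"
      using continuous_attains_inf[OF C _ cont[OF w]] by blast
    have "f w x \<le> 1 / real (Suc n)" for n
      using small[of n] x(2) D(2) by (meson less_imp_le order_trans subsetD)
    then have "f w x \<le> 0"
      by (intro tendsto_lowerbound[OF LIMSEQ_Suc[OF lim_1_over_n]]) auto
    then show "w \<in> ?L"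
      using w x(1) nonneg[of w x] by force
  qed
  also have "\<dots> \<in> sets M"
  proof -
    have "{w \<in> space M. f w x < c} \<in> sets M" if "x \<in> D" for x c
    proof -
      have [measurable]: "(\<lambda>w. f w x) \<in> borel_measurable M"
        using that D(2) by (intro assms(2)) auto
      show ?thesis by measurable
    qed
    then have "(\<Union>x\<in>D. {w \<in> space M. f w x < 1 / real (Suc n)}) \<in> sets M" for n
      by (intro sets.countable_UN'[OF D(1)]) blast
    then show ?thesis
      by (intro sets.countable_INT) auto
  qed
  finally show ?thesis .
qed

lemma continuous_on_coordinate: "continuous_on S (\<lambda>x :: nat \<Rightarrow> real. x i)"
  using continuous_on_product_coordinates[of i] by (rule continuous_on_subset) auto

lemma orth_proj_eq_iff_mem:
  assumes "E \<in> grassmannian N n" "n < N" "x \<in> rn N"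
  shows "x \<in> E \<longleftrightarrow> L2_set (\<lambda>i. x i - (\<Sum>j = 1..N. x j * proj_matrix N E i j)) {1..N} = 0"
proof -
  have "L2_set (\<lambda>i. x i - (\<Sum>j = 1..N. x j * proj_matrix N E i j)) {1..N} = 0 \<longleftrightarrow> (\<forall>i\<in>{1..N}. x i = orth_proj N E x i)"
    by (simp add: L2_set_eq_0_iff orth_proj_eq_proj_matrix[OF assms(1,2)])
  also have "\<dots> \<longleftrightarrow> x = orth_proj N E x"
  proof -
    have "orth_proj N E x \<in> rn N"
      using orth_proj_mem[OF assms(1,2), of x] assms(1) by (auto simp: grassmannian_def)
    then have "x i = orth_proj N E x i" if "i \<notin> {1..N}" for i
      using that assms(3) unfolding rn_def by auto
    then show ?thesis
      by (metis ext)
  qed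
  also have "\<dots> \<longleftrightarrow> x \<in> E"
    using orth_proj_mem[OF assms(1,2), of x] orth_proj_unique[OF assms(1,2), of x x]
    by (auto simp: ip_def)
  finally show ?thesis ..
qed

text \<open>Membership in \<open>f w\<close> and the sign condition together are the vanishing of
  one nonnegative function: the distance from \<open>x\<close> to \<open>f w\<close> plus the
  negative part of \<open>g w x\<close>. The later events on sections of \<open>C\<close> are
  brought into this form.\<close>

lemma sets_ex_compact_mem:
  fixes C :: "(nat \<Rightarrow> real) set" and g :: "'w \<Rightarrow> (nat \<Rightarrow> real) \<Rightarrow> real"
  assumes "compact C" "C \<subseteq> rn N" "n < N" and f[measurable]: "f \<in> measurable M (borel_grassmannian N n)"
    and [measurable]: "\<And>x. x \<in> C \<Longrightarrow> (\<lambda>w. g w x) \<in> borel_measurable M"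
    and cont: "\<And>w. w \<in> space M \<Longrightarrow> continuous_on C (g w)"
  shows "{w \<in> space M. \<exists>x\<in>C. x \<in> f w \<and> 0 \<le> g w x} \<in> sets M"
proof -
  define F where "F w x = L2_set (\<lambda>i. x i - (\<Sum>j = 1..N. x j * proj_matrix N (f w) i j)) {1..N} + max 0 (- g w x)" for w x
  have [measurable]: "(\<lambda>w. proj_matrix N (f w) i l) \<in> borel_measurable M" for i l
    using measurable_compose[OF f borel_measurable_proj_matrix] .
  have "{w \<in> space M. \<exists>x\<in>C. F w x = 0} \<in> sets M"
  proof (rule sets_ex_compact_zero[OF assms(1)])
    show "(\<lambda>w. F w x) \<in> borel_measurable M" if "x \<in> C" for x
      using that unfolding F_def by measurable
    show "continuous_on C (F w)" if "w \<in> space M" for w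
      unfolding F_def L2_set_def using cont[OF that]
      by (intro continuous_intros continuous_on_coordinate)
    show "0 \<le> F w x" for w x
      by (simp add: F_def)
  qed
  moreover have "(x \<in> f w \<and> 0 \<le> g w x) \<longleftrightarrow> F w x = 0" if "w \<in> space M" "x \<in> C" for w x
  proof -
    have "f w \<in> grassmannian N n"
      using measurable_space[OF f that(1)] by simp
    then have "x \<in> f w \<longleftrightarrow> L2_set (\<lambda>i. x i - (\<Sum>j = 1..N. x j * proj_matrix N (f w) i j)) {1..N} = 0"
      using that(2) assms by (intro orth_proj_eq_iff_mem) auto
    then show ?thesis
      unfolding F_def by (subst add_nonneg_eq_0_iff) (auto simp: max_def)
  qed
  ultimately show ?thesis
    by (simp cong: conj_cong bex_cong Collect_cong)
qed

section \<open>Small balls for projected Gaussian vectors\<close>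

lemma Bessel_ip:
  assumes orth: "\<And>i j. i < d \<Longrightarrow> j < d \<Longrightarrow> ip I (c i) (c j) = (if i = j then 1 else 0)"
  shows "L2_set (\<lambda>j. ip I (c j) v) {..<d::nat} \<le> L2_set v I"
proof -
  define p where "p = (\<lambda>i. \<Sum>j<d. ip I (c j) v * c j i)"
  have p: "ip I p y = (\<Sum>j<d. ip I (c j) v * ip I (c j) y)" for y
    unfolding p_def ip_sum_left ip_mult_left ..
  have pp: "ip I p p = (\<Sum>j<d. ip I (c j) v * ip I (c j) v)"
  proof -
    have "ip I (c j) p = ip I (c j) v" if "j < d" for j
    proof -
      have "ip I (c j) p = (\<Sum>i<d. ip I (c i) v * ip I (c i) (c j))"
        unfolding ip_commute[of I "c j" p] by (rule p)
      also have "\<dots> = (\<Sum>i<d. ip I (c i) v * (if i = j then 1 else 0))"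
        using that orth by (intro sum.cong refl) simp
      also have "\<dots> = ip I (c j) v"
        using that by (simp add: if_distrib[of "\<lambda>u. _ * u"] sum.delta cong: if_cong)
      finally show ?thesis .
    qed
    then show ?thesis
      unfolding p by (intro sum.cong) auto
  qed
  have "0 \<le> ip I (v - p) (v - p)"
    by simp
  also have "\<dots> = ip I v v - ip I p v - (ip I p v - ip I p p)"
    by (simp only: ip_minus_left ip_minus_right ip_commute[of I v p])
  finally have "(\<Sum>j<d. ip I (c j) v * ip I (c j) v) \<le> ip I v v"
    unfolding pp p[of v] by simp
  then have "(L2_set (\<lambda>j. ip I (c j) v) {..<d})\<^sup>2 \<le> (L2_set v I)\<^sup>2"
    unfolding ip_self[symmetric] by (simp add: ip_def[of "{..<d}"])
  then show ?thesis
    by (rule power2_le_imp_le) simp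
qed

text \<open>The \<open>N - n\<close> vectors that span \<open>E\<close> leave room for
  \<open>(N - k + 1) - (N - n) = n - k + 1\<close> orthonormal vectors supported in
  \<open>{k..N}\<close> and orthogonal to \<open>E\<close>. By Bessel's inequality
  \<open>coproj\<close> is at least as long as the vector of their inner products with
  \<open>x\<close>, to which \<open>gauss_projection_small_ball\<close> applies.\<close>

lemma coproj_gauss_small_ball:
  assumes E: "E \<in> grassmannian N n" and k: "1 \<le> k" "k \<le> n" "n < N" and t: "0 < t"
  shows "measure (gauss {k..N}) {x \<in> space (gauss {k..N}). L2_set (coproj N {k..N} E x) {1..N} \<le> t * L2_set x {k..N}} \<le>
    4 / 3 * (2 * exp (1 / 2) * t * sqrt (N - k + 1) / sqrt (n - k + 1)) ^ (n - k + 1)"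
proof -
  let ?W = "{k..N}" and ?d = "n - k + 1"
  have W: "?W \<subseteq> {1..N}" using k by auto
  obtain B where B: "finite B" "B \<subseteq> rn N" "card B = N - n" "span B = E"
    using grassmannian_span[OF E k(3)] .
  have "\<exists>c :: nat \<Rightarrow> nat \<Rightarrow> real. (\<forall>j<?d. \<forall>i. i \<notin> ?W \<longrightarrow> c j i = 0) \<and>
    (\<forall>i<?d. \<forall>j<?d. ip ?W (c i) (c j) = (if i = j then 1 else 0)) \<and> (\<forall>j<?d. \<forall>b\<in>B. ip ?W (c j) b = 0)"
    using k B by (intro exists_orthonormal_family) auto
  then obtain c :: "nat \<Rightarrow> nat \<Rightarrow> real" where c: "(\<forall>j<?d. \<forall>i. i \<notin> ?W \<longrightarrow> c j i = 0) \<and>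
    (\<forall>i<?d. \<forall>j<?d. ip ?W (c i) (c j) = (if i = j then 1 else 0)) \<and> (\<forall>j<?d. \<forall>b\<in>B. ip ?W (c j) b = 0)"
    by (rule exE)
  have supp: "c j i = 0" if "j < ?d" "i \<notin> ?W" for i j
    using c that by blast
  have orth: "ip ?W (c i) (c j) = (if i = j then 1 else 0)" if "i < ?d" "j < ?d" for i j
    using c that by blast
  have extend: "ip {1..N} (c j) y = ip ?W (c j) y" if "j < ?d" for j y
  proof -
    have "c j = supp_restrict ?W (c j)"
      using supp[OF that] by (auto simp: supp_restrict_def)
    then show ?thesis
      using ip_supp_restrict_left[OF W, of "c j" y] by simp
  qed
  have ortho_E: "ip {1..N} (c j) z = 0" if "j < ?d" "z \<in> E" for j z
  proof (rule ip_orthogonal_span)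
    show "z \<in> span B" using that(2) B(4) by simp
    show "ip {1..N} (c j) b = 0" if "b \<in> B" for b
      unfolding extend[OF \<open>j < ?d\<close>] using c that \<open>j < ?d\<close> by blast
  qed
  have le: "L2_set (\<lambda>j. ip ?W (c j) x) {..<?d} \<le> L2_set (coproj N ?W E x) {1..N}" for x
  proof -
    have "ip ?W (c j) x = ip {1..N} (c j) (coproj N ?W E x)" if "j < ?d" for j
    proof -
      have "ip {1..N} (coproj N ?W E x) (c j) = ip {1..N} x (c j)"
        by (rule ip_coproj[OF E k(3) W]) (use supp ortho_E that in blast)+
      then show ?thesis
        unfolding ip_commute[of _ _ "c j"] extend[OF that] by simp
    qed
    then have "L2_set (\<lambda>j. ip ?W (c j) x) {..<?d} = L2_set (\<lambda>j. ip {1..N} (c j) (coproj N ?W E x)) {..<?d}"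
      by (intro L2_set_cong) auto
    also have "\<dots> \<le> L2_set (coproj N ?W E x) {1..N}"
      by (rule Bessel_ip) (simp only: extend orth)
    finally show ?thesis .
  qed
  have "measure (gauss ?W) {x \<in> space (gauss ?W). L2_set (coproj N ?W E x) {1..N} \<le> t * L2_set x ?W} \<le>
      measure (gauss ?W) {x \<in> space (gauss ?W). L2_set (\<lambda>j. ip ?W (c j) x) {..<?d} \<le> t * L2_set x ?W}"
    using le order_trans by (intro gauss.finite_measure_mono) (blast, measurable)
  also have "\<dots> \<le> 4 / 3 * (2 * exp (1 / 2) * t * sqrt (card ?W) / sqrt ?d) ^ ?d"
    by (rule gauss_projection_small_ball) (use t orth in auto)
  also have "card ?W = N - k + 1"
    using k by simp
  finally show ?thesis .
qed

section \<open>Ellipsoids\<close>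

lemma powr_inverse_power:
  fixes x q :: real
  assumes "0 < d"
  shows "(x powr (1 / q)) ^ d = x powr (real d / q)"
proof -
  have "(x powr (1 / q)) ^ d = (x powr (1 / q)) powr real d"
    using assms by (simp add: powr_realpow')
  then show ?thesis
    by (simp add: powr_powr)
qed

lemma power2_powr_half:
  fixes x :: real
  assumes "0 \<le> x" "0 < d"
  shows "x\<^sup>2 powr (real d / 2) = x ^ d"
proof (cases "x = 0")
  case False
  then have x: "0 < x" using assms by simp
  then have "x\<^sup>2 = x powr 2" by simp
  then have "x\<^sup>2 powr (real d / 2) = x powr real d"
    by (simp only: powr_powr) simp
  then show ?thesis
    using x by (simp add: powr_realpow)
qed (use assms in simp)

text \<open>The identity includes the case \<open>\<sigma> i = 0\<close>: then
  \<open>x i = 0\<close> on the ellipsoid, and the quotient is 0 by convention.\<close>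

lemma p_ellipsoid_coord_le:
  assumes "x \<in> p_ellipsoid N p \<sigma>" "0 < p" "i \<in> {1..N}" "\<And>i. i \<in> {1..N} \<Longrightarrow> 0 \<le> \<sigma> i"
  shows "\<bar>x i\<bar> / \<sigma> i \<le> 1" "\<bar>x i\<bar> = \<sigma> i * (\<bar>x i\<bar> / \<sigma> i)"
proof -
  have x: "\<sigma> i = 0 \<Longrightarrow> x i = 0" "(\<Sum>i = 1..N. (\<bar>x i\<bar> / \<sigma> i) powr p) \<le> 1"
    using assms by (auto simp: p_ellipsoid_def)
  have "(\<bar>x i\<bar> / \<sigma> i) powr p \<le> 1"
    using member_le_sum[of i "{1..N}" "\<lambda>i. (\<bar>x i\<bar> / \<sigma> i) powr p"] x(2) assms(3) by simp
  then show "\<bar>x i\<bar> / \<sigma> i \<le> 1"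
    using assms(2) powr_less_mono2[of p 1 "\<bar>x i\<bar> / \<sigma> i"] by (simp add: not_le[symmetric]) force
  show "\<bar>x i\<bar> = \<sigma> i * (\<bar>x i\<bar> / \<sigma> i)"
    using x(1) by (cases "\<sigma> i = 0") auto
qed

lemma p_ellipsoid_sum_le:
  assumes "x \<in> p_ellipsoid N p \<sigma>" "J \<subseteq> {1..N}"
  shows "(\<Sum>i\<in>J. (\<bar>x i\<bar> / \<sigma> i) powr p) \<le> 1"
proof -
  have "(\<Sum>i\<in>J. (\<bar>x i\<bar> / \<sigma> i) powr p) \<le> (\<Sum>i = 1..N. (\<bar>x i\<bar> / \<sigma> i) powr p)"
    using assms(2) by (intro sum_mono2) auto
  also have "\<dots> \<le> 1"
    using assms(1) by (simp add: p_ellipsoid_def)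
  finally show ?thesis .
qed

lemma p_ellipsoid_subset_rn: "p_ellipsoid N p \<sigma> \<subseteq> rn N"
  by (auto simp: p_ellipsoid_def)

lemma zero_mem_p_ellipsoid: "(\<lambda>_. 0) \<in> p_ellipsoid N p \<sigma>"
  by (simp add: p_ellipsoid_def rn_def)

lemma compact_p_ellipsoid:
  assumes p: "0 < p" and \<sigma>: "\<And>i. i \<in> {1..N} \<Longrightarrow> 0 \<le> \<sigma> i"
  shows "compact (p_ellipsoid N p \<sigma>)"
proof -
  \<comment> \<open>In the coordinates outside \<open>{1..N}\<close> the box is \<open>{0}\<close>,
    so compactness in \<open>nat \<Rightarrow> real\<close> follows from Tychonoff's
    theorem.\<close>
  define b where "b i = (if i \<in> {1..N} then \<sigma> i else 0)" for i
  let ?box = "PiE UNIV (\<lambda>i. {- b i..b i})"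
  let ?Z = "(\<Inter>i\<in>{i \<in> {1..N}. \<sigma> i = 0}. {x :: nat \<Rightarrow> real. x i = 0})"
  let ?S = "{x :: nat \<Rightarrow> real. (\<Sum>i = 1..N. (\<bar>x i\<bar> / \<sigma> i) powr p) \<le> 1}"
  have "compact ?box"
    using compactin_PiE[of "\<lambda>_. euclidean" UNIV "\<lambda>i. {- b i..b i}"]
    by (simp add: euclidean_product_topology)
  moreover have "closed ?Z"
    by (intro closed_INT ballI closed_Collect_eq continuous_on_coordinate continuous_on_const)
  \<comment> \<open>Division by the constant \<open>\<sigma> i\<close> is multiplication by
    \<open>inverse (\<sigma> i)\<close>, continuous also when \<open>\<sigma> i = 0\<close>.\<close>
  moreover have "closed ?S"
    using p \<sigma> unfolding divide_inverse
    by (intro closed_Collect_le continuous_on_sum continuous_on_powr' continuous_intros continuous_on_coordinate) auto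
  ultimately have "compact (?box \<inter> ?Z \<inter> ?S)"
    by (intro compact_Int_closed)
  moreover have "p_ellipsoid N p \<sigma> = ?box \<inter> ?Z \<inter> ?S"
  proof (intro equalityI subsetI)
    fix x assume x: "x \<in> p_ellipsoid N p \<sigma>"
    have "\<bar>x i\<bar> \<le> b i" for i
    proof (cases "i \<in> {1..N}")
      case True
      have "\<sigma> i * (\<bar>x i\<bar> / \<sigma> i) \<le> \<sigma> i * 1"
        by (intro mult_left_mono p_ellipsoid_coord_le(1)[OF x p True] \<sigma> True)
      then show ?thesis
        using p_ellipsoid_coord_le(2)[OF x p True] \<sigma> True by (simp add: b_def)
    next
      case False
      then show ?thesis
        using x by (auto simp: p_ellipsoid_def rn_def b_def)
    qed
    then have "x \<in> ?box"
      by (auto simp: abs_le_iff minus_le_iff)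
    then show "x \<in> ?box \<inter> ?Z \<inter> ?S"
      using x by (auto simp: p_ellipsoid_def)
  next
    fix x assume x: "x \<in> ?box \<inter> ?Z \<inter> ?S"
    have "x i = 0" if "i \<notin> {1..N}" for i
    proof -
      have "x i \<in> {- b i..b i}"
        using x by (auto simp: PiE_def Pi_def)
      moreover have "b i = 0"
        unfolding b_def using that by (rule if_not_P)
      ultimately show ?thesis
        by simp
    qed
    then show "x \<in> p_ellipsoid N p \<sigma>"
      using x unfolding p_ellipsoid_def rn_def by blast
  qed
  ultimately show ?thesis by simp
qed

lemma Hoelder_unit_ball:
  fixes t z :: "'i \<Rightarrow> real"
  assumes J: "finite J" and pq: "1 < p" "1 < q" "1 / p + 1 / q = 1"
    and t: "\<And>i. i \<in> J \<Longrightarrow> 0 \<le> t i" "(\<Sum>i\<in>J. t i powr p) \<le> 1" and z: "\<And>i. i \<in> J \<Longrightarrow> 0 \<le> z i"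
  shows "(\<Sum>i\<in>J. t i * z i) \<le> (\<Sum>i\<in>J. z i powr q) powr (1 / q)"
proof -
  define H where "H = (\<Sum>i\<in>J. z i powr q) powr (1 / q)"
  have sum_nonneg: "0 \<le> (\<Sum>i\<in>J. z i powr q)"
    by (intro sum_nonneg) simp
  show ?thesis
  proof (cases "(\<Sum>i\<in>J. z i powr q) = 0")
    case True
    then have "z i = 0" if "i \<in> J" for i
      using that J by (subst (asm) sum_nonneg_eq_0_iff) auto
    then have "(\<Sum>i\<in>J. t i * z i) = 0"
      by (intro sum.neutral) simp
    then show ?thesis by simp
  next
    case False
    then have H: "0 < H" "H powr q = (\<Sum>i\<in>J. z i powr q)"
      using sum_nonneg pq by (simp_all add: H_def powr_powr)
    have "(\<Sum>i\<in>J. t i * (z i / H)) \<le> (\<Sum>i\<in>J. t i powr p / p + (z i / H) powr q / q)"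
      using t z H pq by (intro sum_mono Youngs_inequality) auto
    also have "\<dots> = (\<Sum>i\<in>J. t i powr p) / p + (\<Sum>i\<in>J. z i powr q / H powr q) / q"
      using z H by (simp add: sum.distrib sum_divide_distrib powr_divide)
    also have "(\<Sum>i\<in>J. z i powr q / H powr q) = 1"
      using H False by (simp add: sum_divide_distrib[symmetric])
    also have "(\<Sum>i\<in>J. t i powr p) / p + 1 / q \<le> 1"
      using t(2) pq divide_right_mono[OF t(2), of p] by simp
    finally have "(\<Sum>i\<in>J. t i * z i) / H \<le> 1"
      by (simp add: sum_divide_distrib)
    then show ?thesis
      using H(1) by (simp add: H_def[symmetric] divide_le_eq)
  qed
qed

text \<open>By Young's inequality, \<open>\<E>\<^sub>p\<close> with \<open>p > 2\<close> is contained in every ellipsoid with semi-axes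
  \<open>\<sigma>\<^sub>i a\<^sub>i\<^bsup>-1/r\<^esup>\<close>, \<open>a \<ge> 0\<close>, \<open>\<Sum> a\<^sub>i \<le> 1\<close>. The choice of \<open>a\<close> is the mean of the weights that are optimal for the two sums
  of the bound.\<close>

lemma p_ellipsoid_weights:
  fixes p q r :: real and N n k :: nat and \<sigma> :: "nat \<Rightarrow> real"
  assumes p: "2 < p" and k: "1 \<le> k" "k \<le> n" and nonneg: "\<forall>i\<in>{1..N}. 0 \<le> \<sigma> i"
  defines "r \<equiv> 2 * p / (p - 2)" and "q \<equiv> conj_exponent p"
  defines "R \<equiv> (\<Sum>i\<in>{k+1..N}. \<sigma> i powr r) powr (1 / r)" and "Q \<equiv> (\<Sum>i\<in>{n+1..N}. \<sigma> i powr q) powr (1 / q)"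
  shows "\<exists>b. (\<forall>i\<in>{k+1..N}. 0 \<le> b i \<and> b i \<le> sqrt 2 * R) \<and>
    (\<Sum>i\<in>{k+1..N}. (b i)\<^sup>2) \<le> 2 * real (n - k) * R\<^sup>2 + 2 * Q\<^sup>2 \<and>
    (\<forall>x\<in>p_ellipsoid N p \<sigma>. \<exists>c. (\<forall>i\<in>{k+1..N}. 0 \<le> c i \<and> \<bar>x i\<bar> = b i * c i) \<and> (\<Sum>i\<in>{k+1..N}. (c i)\<^sup>2) \<le> 1)"
proof -
  let ?T = "{k+1..N}"
  define S where "S = (\<Sum>i\<in>?T. \<sigma> i powr r)"
  define S' where "S' = (\<Sum>i\<in>{n+1..N}. \<sigma> i powr q)"
  define a where "a i = (\<sigma> i powr r / S + (if i \<in> {n+1..N} then \<sigma> i powr q / S' else 0)) / 2" for i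
  define b where "b i = \<sigma> i * a i powr (- (1 / r))" for i
  note \<sigma> = bspec[OF nonneg]
  have r: "2 < r" "1 / r = 1 / 2 - 1 / p"
    using p by (auto simp: r_def field_simps)
  have q: "1 < q" "q < 2" "1 / q = 1 - 1 / p"
    using p by (auto simp: q_def conj_exponent_def field_simps)
  have qr: "1 / r = 1 / q - 1 / 2"
    using r(2) q(3) by simp
  have S: "0 \<le> S" "0 \<le> S'"
    by (auto simp: S_def S'_def intro!: sum_nonneg)
  have R: "0 \<le> R" and R2: "R\<^sup>2 = S powr (2 / r)" and Q2: "Q\<^sup>2 = S' powr (2 / q)"
    by (simp_all add: R_def Q_def S_def S'_def power2_eq_square flip: powr_add)
  have a: "0 \<le> a i" "\<sigma> i powr r / S / 2 \<le> a i" "i \<in> {n+1..N} \<Longrightarrow> \<sigma> i powr q / S' / 2 \<le> a i" for i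
    using S by (auto simp: a_def)
  have T: "0 \<le> \<sigma> i" if "i \<in> ?T" for i
    using that by (intro \<sigma>) auto
  have pos: "0 < \<sigma> i powr r / S / 2" if "i \<in> ?T" "\<sigma> i \<noteq> 0" for i
  proof -
    have "\<sigma> i powr r \<le> S"
      unfolding S_def using that(1) by (intro member_le_sum) auto
    moreover have "0 < \<sigma> i powr r" using that by simp
    ultimately have "0 < S" by linarith
    then show ?thesis
      using \<open>0 < \<sigma> i powr r\<close> by simp
  qed
  \<comment> \<open>Here \<open>w\<close> is one of the two weights of which \<open>a i\<close> is
    the mean; halving it costs the factor \<open>2 powr (2 / r) \<le> 2\<close>.\<close>
  have b_le: "(b i)\<^sup>2 \<le> 2 * ((\<sigma> i)\<^sup>2 * w powr (- (2 / r)))" if "i \<in> ?T" "0 < w" "w / 2 \<le> a i" for i w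
  proof -
    have "(b i)\<^sup>2 = (\<sigma> i)\<^sup>2 * a i powr (- (2 / r))"
      unfolding b_def power_mult_distrib by (simp add: power2_eq_square flip: powr_add)
    also have "\<dots> \<le> (\<sigma> i)\<^sup>2 * (w / 2) powr (- (2 / r))"
      using that r by (intro mult_left_mono powr_mono2') auto
    also have "(w / 2) powr (- (2 / r)) = 2 powr (2 / r) * w powr (- (2 / r))"
      using that(2) by (simp add: powr_divide powr_minus divide_simps)
    also have "(\<sigma> i)\<^sup>2 * (2 powr (2 / r) * w powr (- (2 / r))) \<le> (\<sigma> i)\<^sup>2 * (2 powr 1 * w powr (- (2 / r)))"
      using r by (intro mult_left_mono mult_right_mono powr_mono) auto
    finally show ?thesis by simp
  qed
  have b1: "(b i)\<^sup>2 \<le> 2 * R\<^sup>2" if i: "i \<in> ?T" for i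
  proof (cases "\<sigma> i = 0")
    case False
    have s: "0 < \<sigma> i" using False T[OF i] by simp
    have S_pos: "0 < S" using pos[OF i False] S by (auto simp: zero_less_divide_iff)
    have "(b i)\<^sup>2 \<le> 2 * ((\<sigma> i)\<^sup>2 * (\<sigma> i powr r / S) powr (- (2 / r)))"
      using pos[OF i False] a(2)[of i] by (intro b_le i) auto
    also have "(\<sigma> i powr r / S) powr (- (2 / r)) = inverse ((\<sigma> i)\<^sup>2) * R\<^sup>2"
      using s S_pos r by (simp add: R2 powr_divide powr_powr powr_minus divide_simps)
    also have "(\<sigma> i)\<^sup>2 * (inverse ((\<sigma> i)\<^sup>2) * R\<^sup>2) = R\<^sup>2"
      using False by simp
    finally show ?thesis .
  qed (simp add: b_def)
  have b2: "(b i)\<^sup>2 \<le> 2 * (\<sigma> i powr q * S' powr (2 / r))" if i: "i \<in> {n+1..N}" for i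
  proof (cases "\<sigma> i = 0")
    case False
    have i': "i \<in> ?T" using i k by auto
    have s: "0 < \<sigma> i" using False T[OF i'] by simp
    have "\<sigma> i powr q \<le> S'"
      unfolding S'_def using i by (intro member_le_sum) auto
    then have S_pos: "0 < S'" using s powr_gt_zero[of "\<sigma> i" q] by linarith
    have "(b i)\<^sup>2 \<le> 2 * ((\<sigma> i)\<^sup>2 * (\<sigma> i powr q / S') powr (- (2 / r)))"
      using s S_pos a(3)[OF i] by (intro b_le i') auto
    also have "(\<sigma> i powr q / S') powr (- (2 / r)) = \<sigma> i powr (- (2 * q / r)) * S' powr (2 / r)"
      using s S_pos by (simp add: powr_divide powr_powr powr_minus divide_simps mult_ac)
    also have "(\<sigma> i)\<^sup>2 * (\<sigma> i powr (- (2 * q / r)) * S' powr (2 / r)) = \<sigma> i powr (2 - 2 * q / r) * S' powr (2 / r)"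
    proof -
      have "(\<sigma> i)\<^sup>2 = \<sigma> i powr 2" using s by simp
      then show ?thesis
        by (simp only: mult.assoc[symmetric] powr_add[symmetric] diff_conv_add_uminus)
    qed
    also have "2 - 2 * q / r = q"
    proof -
      have "2 * q / r = 2 * q * (1 / r)" by simp
      also have "\<dots> = 2 - q"
        unfolding qr using q(1) by (simp add: right_diff_distrib)
      finally show ?thesis by simp
    qed
    finally show ?thesis .
  qed (simp add: b_def)
  \<comment> \<open>Up to \<open>n\<close> the uniform bound \<open>b1\<close> is used, beyond
    \<open>n\<close> the bound \<open>b2\<close>, whose sum is
    \<open>2 * S' powr (1 + 2 / r) = 2 * S' powr (2 / q)\<close>.\<close>
  have sum_b: "(\<Sum>i\<in>?T. (b i)\<^sup>2) \<le> 2 * real (n - k) * R\<^sup>2 + 2 * Q\<^sup>2"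
  proof -
    have "(\<Sum>i\<in>?T. (b i)\<^sup>2) \<le> (\<Sum>i\<in>{k+1..n}. 2 * R\<^sup>2) + (\<Sum>i\<in>{n+1..N}. 2 * (\<sigma> i powr q * S' powr (2 / r)))"
    proof -
      have "?T = (?T \<inter> {k+1..n}) \<union> {n+1..N}" using k by auto
      then have "(\<Sum>i\<in>?T. (b i)\<^sup>2) = (\<Sum>i\<in>(?T \<inter> {k+1..n}) \<union> {n+1..N}. (b i)\<^sup>2)"
        by (rule arg_cong)
      also have "\<dots> = (\<Sum>i\<in>?T \<inter> {k+1..n}. (b i)\<^sup>2) + (\<Sum>i\<in>{n+1..N}. (b i)\<^sup>2)"
        by (rule sum.union_disjoint) auto
      also have "(\<Sum>i\<in>?T \<inter> {k+1..n}. (b i)\<^sup>2) \<le> (\<Sum>i\<in>?T \<inter> {k+1..n}. 2 * R\<^sup>2)"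
        by (intro sum_mono b1) auto
      also have "\<dots> \<le> (\<Sum>i\<in>{k+1..n}. 2 * R\<^sup>2)"
        by (intro sum_mono2) auto
      finally show ?thesis
        using sum_mono[of "{n+1..N}" "\<lambda>i. (b i)\<^sup>2" "\<lambda>i. 2 * (\<sigma> i powr q * S' powr (2 / r))", OF b2] by linarith
    qed
    also have "(\<Sum>i\<in>{n+1..N}. 2 * (\<sigma> i powr q * S' powr (2 / r))) = 2 * (S' powr 1 * S' powr (2 / r))"
      by (simp add: S'_def sum_nonneg sum_distrib_left[symmetric] sum_distrib_right[symmetric])
    also have "S' powr 1 * S' powr (2 / r) = Q\<^sup>2"
      using qr by (simp only: Q2 powr_add[symmetric]) (simp add: field_simps)
    also have "(\<Sum>i\<in>{k+1..n}. 2 * R\<^sup>2) = 2 * real (n - k) * R\<^sup>2"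
      by simp
    finally show ?thesis .
  qed
  have c: "\<exists>c. (\<forall>i\<in>?T. 0 \<le> c i \<and> \<bar>x i\<bar> = b i * c i) \<and> (\<Sum>i\<in>?T. (c i)\<^sup>2) \<le> 1"
    if x: "x \<in> p_ellipsoid N p \<sigma>" for x
  proof -
    define t where "t i = \<bar>x i\<bar> / \<sigma> i" for i
    define c where "c i = a i powr (1 / r) * t i" for i
    have sum_a: "(\<Sum>i\<in>?T. a i) \<le> 1"
    proof -
      have "(\<Sum>i\<in>?T. \<sigma> i powr r / S) \<le> 1"
        unfolding S_def sum_divide_distrib[symmetric] by (simp add: divide_le_eq_1)
      moreover have "(\<Sum>i\<in>?T. if i \<in> {n+1..N} then \<sigma> i powr q / S' else 0) \<le> 1"
      proof -
        have "(\<Sum>i\<in>?T. if i \<in> {n+1..N} then \<sigma> i powr q / S' else 0) = (\<Sum>i\<in>{n+1..N}. \<sigma> i powr q / S')"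
          using k by (intro sum.mono_neutral_cong_right) auto
        also have "\<dots> \<le> 1"
          unfolding S'_def sum_divide_distrib[symmetric] by (simp add: divide_le_eq_1)
        finally show ?thesis .
      qed
      ultimately have "(\<Sum>i\<in>?T. \<sigma> i powr r / S) + (\<Sum>i\<in>?T. if i \<in> {n+1..N} then \<sigma> i powr q / S' else 0) \<le> 1 + 1"
        by (rule add_mono)
      then show ?thesis
        by (simp only: a_def sum_divide_distrib[symmetric] sum.distrib) simp
    qed
    have t: "0 \<le> t i" "\<bar>x i\<bar> = \<sigma> i * t i" if "i \<in> ?T" for i
      using T[OF that] p_ellipsoid_coord_le(2)[OF x, of i] p that \<sigma> by (auto simp: t_def)
    have c_eq: "0 \<le> c i \<and> \<bar>x i\<bar> = b i * c i" if i: "i \<in> ?T" for i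
    proof (cases "\<sigma> i = 0")
      case True
      then show ?thesis
        using t(2)[OF i] by (simp add: b_def c_def t_def)
    next
      case False
      then have "0 < a i"
        using pos[OF i] a(2)[of i] by simp
      then have "a i powr (- (1 / r)) * a i powr (1 / r) = 1"
        by (simp flip: powr_add)
      then have "b i * c i = \<sigma> i * t i"
        unfolding b_def c_def by (metis mult.assoc mult.left_commute mult_1)
      then have "\<bar>x i\<bar> = b i * c i"
        using t(2)[OF i] by (simp only:)
      moreover have "0 \<le> c i"
        using t(1)[OF i] by (simp add: c_def)
      ultimately show ?thesis by (rule conjI[rotated])
    qed
    \<comment> \<open>Young's inequality with the conjugate exponents \<open>p / 2\<close> and
      \<open>r / 2\<close>.\<close>
    have "(c i)\<^sup>2 \<le> 2 / p * t i powr p + 2 / r * a i" if i: "i \<in> ?T" for i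
    proof (cases "t i = 0 \<or> a i = 0")
      case True
      then show ?thesis
        using p r a(1)[of i] by (auto simp: c_def)
    next
      case False
      then have pos: "0 < t i" "0 < a i"
        using t(1)[OF i] a(1)[of i] by auto
      have "(c i)\<^sup>2 = (t i powr p) powr (2 / p) * a i powr (2 / r)"
      proof -
        have "(a i powr (1 / r))\<^sup>2 = a i powr (2 / r)"
          by (simp add: power2_eq_square flip: powr_add)
        moreover have "(t i powr p) powr (2 / p) = (t i)\<^sup>2"
          using pos p by (simp add: powr_powr)
        ultimately show ?thesis
          by (simp only: c_def power_mult_distrib mult.commute)
      qed
      also have "\<dots> \<le> 2 / p * t i powr p + 2 / r * a i"
        using p r pos by (intro Youngs_inequality_0) (auto simp: r_def field_simps)
      finally show ?thesis .
    qed
    then have "(\<Sum>i\<in>?T. (c i)\<^sup>2) \<le> (\<Sum>i\<in>?T. 2 / p * t i powr p + 2 / r * a i)"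
      by (rule sum_mono)
    also have "\<dots> = 2 / p * (\<Sum>i\<in>?T. t i powr p) + 2 / r * (\<Sum>i\<in>?T. a i)"
      by (simp only: sum.distrib sum_distrib_left)
    also have "\<dots> \<le> 2 / p * 1 + 2 / r * 1"
      unfolding t_def using p r sum_a by (intro add_mono mult_left_mono p_ellipsoid_sum_le[OF x]) auto
    also have "\<dots> = 1"
      using r(2) by simp
    finally have "(\<Sum>i\<in>?T. (c i)\<^sup>2) \<le> 1" .
    then show ?thesis
      using c_eq by blast
  qed
  have "b i \<le> sqrt 2 * R" if "i \<in> ?T" for i
    by (rule power2_le_imp_le) (use b1[OF that] R in \<open>auto simp: power_mult_distrib\<close>)
  moreover have "0 \<le> b i" if "i \<in> ?T" for i
    using T[OF that] by (simp add: b_def)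
  ultimately show ?thesis
    by (intro exI[of _ b] conjI ballI sum_b c)
qed

text \<open>\<open>1 / 56000\<close> is \<open>1 / (2 * C)\<close> for the constant
  \<open>C = 28000\<close> of the theorem.\<close>

lemma ln_inverse_ge_1:
  assumes "0 < \<epsilon>" "\<epsilon> \<le> 1 / 56000"
  shows "1 \<le> sqrt (ln (1 / \<epsilon>))"
proof -
  have "exp 1 \<le> 1 / \<epsilon>"
  proof -
    have "\<epsilon> * 56000 \<le> 1"
      using assms by simp
    then have "56000 \<le> 1 / \<epsilon>"
      using assms(1) by (simp add: field_simps)
    then show ?thesis
      using exp_le by simp
  qed
  then have "1 \<le> ln (1 / \<epsilon>)"
    using assms(1) by (subst ln_ge_iff) auto
  then show ?thesis
    by simp
qed

section \<open>Random sections\<close>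

context
  fixes N n k :: nat
begin

private abbreviation "T \<equiv> {k+1..N}"
private abbreviation "d \<equiv> n - k + 1"

section \<open>One coordinate of the head\<close>

context
  fixes \<mu> :: "(nat \<Rightarrow> real) set measure"
  assumes haar: "haar_grassmannian N n \<mu>" and k: "1 \<le> k" "k \<le> n" "n < N"
begin

private abbreviation "W \<equiv> {k..N}"
private abbreviation "e \<equiv> \<lambda>i. if i = k then 1 else 0 :: real"
private abbreviation "v E \<equiv> coproj N W E e"
private abbreviation "nrm x \<equiv> L2_set x {1..N}"

interpretation \<mu>: prob_space \<mu>
  using haar by (simp add: haar_grassmannian_def)

private lemma sets_\<mu> [measurable_cong]: "sets \<mu> = sets (borel_grassmannian N n)"
  using haar by (simp add: haar_grassmannian_def)

private lemma space_\<mu>: "space \<mu> = grassmannian N n"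
  using sets_eq_imp_space_eq[OF sets_\<mu>] by simp

private lemma W: "W \<subseteq> {1..N}" and T: "finite T" "T \<noteq> {}" "T \<subseteq> {1..N}"
  using k by auto

private lemma v_props:
  assumes "E \<in> space \<mu>"
  shows "i \<notin> W \<Longrightarrow> v E i = 0" "z \<in> E \<Longrightarrow> ip {1..N} (v E) z = 0" "v E k = (nrm (v E))\<^sup>2"
proof -
  have E: "E \<in> grassmannian N n" using assms by (simp add: space_\<mu>)
  show "i \<notin> W \<Longrightarrow> v E i = 0"
    by (rule coproj_supp[OF E k(3) W])
  show "z \<in> E \<Longrightarrow> ip {1..N} (v E) z = 0"
    by (rule coproj_orthogonal[OF E k(3) W])
  have "ip {1..N} e (v E) = v E k"
    using k by (subst ip_unit) auto
  then show "v E k = (nrm (v E))\<^sup>2"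
    using ip_coproj_self[OF E k(3) W, of e] by (simp only: ip_self)
qed

lemma emeasure_reflect:
  assumes "a \<in> rn N" "B \<in> sets \<mu>"
  shows "emeasure \<mu> B = emeasure \<mu> {E \<in> space \<mu>. reflect {1..N} a ` E \<in> B}"
proof -
  have "emeasure \<mu> B = emeasure (distr \<mu> \<mu> (\<lambda>E. reflect {1..N} a ` E)) B"
    by (simp only: haar_grassmannian_reflect[OF haar k(3) assms(1)])
  also have "\<dots> = emeasure \<mu> ((\<lambda>E. reflect {1..N} a ` E) -` B \<inter> space \<mu>)"
    by (rule emeasure_distr[OF haar_grassmannian_reflect(2)[OF haar k(3) assms(1)] assms(2)])
  also have "(\<lambda>E. reflect {1..N} a ` E) -` B \<inter> space \<mu> = {E \<in> space \<mu>. reflect {1..N} a ` E \<in> B}"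
    by auto
  finally show ?thesis .
qed

private lemma reflect_space:
  assumes "a \<in> rn N" "E \<in> space \<mu>"
  shows "reflect {1..N} a ` E \<in> space \<mu>"
  using measurable_space[OF haar_grassmannian_reflect(2)[OF haar k(3) assms(1)] assms(2)] .

text \<open>By invariance any unit vector supported in \<open>W\<close> may replace
  \<open>e\<close>: the reflection that exchanges them is supported in \<open>W\<close>, so
  \<open>coproj\<close> is equivariant under it.\<close>

private lemma emeasure_coproj_unit:
  assumes x: "\<And>i. i \<notin> W \<Longrightarrow> x i = 0" "ip {1..N} x x = 1"
  shows "emeasure \<mu> {E \<in> space \<mu>. nrm (v E) \<le> t} = emeasure \<mu> {E \<in> space \<mu>. nrm (coproj N W E x) \<le> t}"
proof -
  define a where "a = (\<lambda>i. e i - x i)"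
  have a: "a i = 0" if "i \<notin> W" for i
    using that k x(1)[OF that] by (auto simp: a_def)
  have a_rn: "a \<in> rn N"
    unfolding rn_def using a W by blast
  have ek: "ip {1..N} e e = 1"
    using k by (subst ip_unit) auto
  have swap: "reflect {1..N} a e = x"
  proof
    fix i
    show "reflect {1..N} a e i = x i"
    proof (cases "i \<in> {1..N}")
      case True
      show ?thesis
        unfolding a_def by (rule reflect_swap) (use True ek x(2) in \<open>simp_all only: finite_atLeastAtMost\<close>)
    next
      case False
      then have "i \<notin> W" using W by blast
      then show ?thesis
        using a[of i] x(1)[of i] k by (auto simp: reflect_def)
    qed
  qed
  have "nrm (coproj N W (reflect {1..N} a ` E) x) = nrm (v E)" if "E \<in> space \<mu>" for E
  proof -
    have "coproj N W (reflect {1..N} a ` E) (reflect {1..N} a e) = reflect {1..N} a (v E)"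
      by (rule coproj_reflect[OF _ k(3) W a]) (use that space_\<mu> in simp_all)
    then show ?thesis
      by (simp only: swap L2_set_reflect)
  qed
  then have "{E \<in> space \<mu>. reflect {1..N} a ` E \<in> {E \<in> space \<mu>. nrm (coproj N W E x) \<le> t}} = {E \<in> space \<mu>. nrm (v E) \<le> t}"
    using reflect_space[OF a_rn] by auto
  moreover have "{E \<in> space \<mu>. nrm (coproj N W E x) \<le> t} \<in> sets \<mu>"
    by measurable
  ultimately show ?thesis
    using emeasure_reflect[OF a_rn, of "{E \<in> space \<mu>. nrm (coproj N W E x) \<le> t}"] by simp
qed

text \<open>Up to a constant factor, \<open>1 / \<beta>\<close> is the typical length of the
  projection of a unit vector of dimension \<open>N - k + 1\<close> onto a subspace of dimension
  \<open>d\<close>.\<close>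

private definition "\<beta> = 2 * exp (1 / 2) * sqrt (N - k + 1) / sqrt d"

private lemma \<beta>_pos: "0 < \<beta>"
  by (simp add: \<beta>_def)

text \<open>The probability does not change if \<open>e\<close> is replaced by a normalised Gaussian
  vector on \<open>W\<close>. With the integrals exchanged, \<open>E\<close> is fixed and the vector
  is random, which is the situation of \<open>coproj_gauss_small_ball\<close>.\<close>

private lemma small_v:
  assumes t: "0 < t"
  shows "emeasure \<mu> {E \<in> space \<mu>. nrm (v E) \<le> t} \<le> ennreal (4 / 3 * (\<beta> * t) ^ d)"
proof -
  interpret PG: pair_prob_space \<mu> "gauss W" ..
  have W': "finite W" "W \<noteq> {}" using k by auto
  define f where "f E x = (if nrm (coproj N W E x) \<le> t * L2_set x W then 1 else 0 :: ennreal)" for E x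
  have [measurable]: "(\<lambda>z. f (fst z) (snd z)) \<in> borel_measurable (\<mu> \<Otimes>\<^sub>M gauss W)"
    unfolding f_def by measurable
  have scaled: "emeasure \<mu> {E \<in> space \<mu>. nrm (v E) \<le> t} = (\<integral>\<^sup>+E. f E x \<partial>\<mu>)" if x: "L2_set x W \<noteq> 0" for x
  proof -
    define r where "r = L2_set x W"
    have r: "0 < r" using x by (simp add: r_def order.strict_iff_order)
    define y where "y = supp_restrict W (\<lambda>i. 1 / r * x i)"
    have "ip {1..N} y y = ip W (\<lambda>i. 1 / r * x i) y"
      unfolding y_def by (rule ip_supp_restrict_left[OF W])
    also have "\<dots> = ip W (\<lambda>i. 1 / r * x i) (\<lambda>i. 1 / r * x i)"
      by (intro ip_cong) (auto simp: y_def supp_restrict_def)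
    also have "\<dots> = 1"
      using r by (simp only: ip_linear) (simp add: ip_self r_def power2_eq_square)
    finally have y: "ip {1..N} y y = 1" .
    have "coproj N W E y = coproj N W E (\<lambda>i. 1 / r * x i)" for E
      by (rule coproj_cong) (simp add: y_def supp_restrict_def)
    then have "nrm (coproj N W E y) = 1 / r * nrm (coproj N W E x)" if "E \<in> space \<mu>" for E
      using that r coproj_mult[of E N n W "1 / r" x] k W L2_set_cmult[of "1 / r" "coproj N W E x" "{1..N}"]
      by (simp only: space_\<mu> zero_le_divide_1_iff)
    then have "nrm (coproj N W E y) \<le> t \<longleftrightarrow> nrm (coproj N W E x) \<le> t * r" if "E \<in> space \<mu>" for E
      using that r by (simp add: divide_le_eq)
    then have "{E \<in> space \<mu>. nrm (coproj N W E y) \<le> t} = {E \<in> space \<mu>. nrm (coproj N W E x) \<le> t * L2_set x W}"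
      unfolding r_def by blast
    moreover have "y i = 0" if "i \<notin> W" for i
      unfolding y_def supp_restrict_def using that by (rule if_not_P)
    then have "emeasure \<mu> {E \<in> space \<mu>. nrm (v E) \<le> t} = emeasure \<mu> {E \<in> space \<mu>. nrm (coproj N W E y) \<le> t}"
      by (rule emeasure_coproj_unit[OF _ y])
    ultimately have "emeasure \<mu> {E \<in> space \<mu>. nrm (v E) \<le> t} = emeasure \<mu> {E \<in> space \<mu>. nrm (coproj N W E x) \<le> t * L2_set x W}"
      by (simp only:)
    also have "\<dots> = (\<integral>\<^sup>+E. indicator {E \<in> space \<mu>. nrm (coproj N W E x) \<le> t * L2_set x W} E \<partial>\<mu>)"
      by (subst nn_integral_indicator) (auto intro!: measurable_sets_Collect borel_measurable_coproj[OF measurable_ident_sets[OF sets_\<mu>]])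
    also have "\<dots> = (\<integral>\<^sup>+E. f E x \<partial>\<mu>)"
      by (intro nn_integral_cong) (auto simp: f_def indicator_def)
    finally show ?thesis .
  qed
  have "emeasure \<mu> {E \<in> space \<mu>. nrm (v E) \<le> t} = (\<integral>\<^sup>+x. emeasure \<mu> {E \<in> space \<mu>. nrm (v E) \<le> t} \<partial>gauss W)"
    using gauss.emeasure_space_1[of W] by simp
  also have "\<dots> = (\<integral>\<^sup>+x. \<integral>\<^sup>+E. f E x \<partial>\<mu> \<partial>gauss W)"
  proof (rule nn_integral_cong_AE)
    show "AE x in gauss W. emeasure \<mu> {E \<in> space \<mu>. nrm (v E) \<le> t} = (\<integral>\<^sup>+E. f E x \<partial>\<mu>)"
      using AE_gauss_nonzero[OF W'] by eventually_elim (rule scaled)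
  qed
  also have "\<dots> = (\<integral>\<^sup>+E. \<integral>\<^sup>+x. f E x \<partial>gauss W \<partial>\<mu>)"
    by (rule PG.Fubini') (simp add: case_prod_beta)
  also have "\<dots> \<le> (\<integral>\<^sup>+E. ennreal (4 / 3 * (\<beta> * t) ^ d) \<partial>\<mu>)"
  proof (rule nn_integral_mono)
    fix E assume "E \<in> space \<mu>"
    then have E: "E \<in> grassmannian N n" by (simp add: space_\<mu>)
    then have ident: "(\<lambda>x. E) \<in> measurable (gauss W) (borel_grassmannian N n)" by simp
    have meas: "{x \<in> space (gauss W). nrm (coproj N W E x) \<le> t * L2_set x W} \<in> sets (gauss W)"
      using borel_measurable_coproj[OF ident] by measurable
    have "(\<integral>\<^sup>+x. f E x \<partial>gauss W) = (\<integral>\<^sup>+x. indicator {x \<in> space (gauss W). nrm (coproj N W E x) \<le> t * L2_set x W} x \<partial>gauss W)"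
      by (intro nn_integral_cong) (auto simp: f_def indicator_def)
    also have "\<dots> = emeasure (gauss W) {x \<in> space (gauss W). nrm (coproj N W E x) \<le> t * L2_set x W}"
      by (rule nn_integral_indicator[OF meas])
    also have "\<dots> \<le> ennreal (4 / 3 * (\<beta> * t) ^ d)"
    proof -
      have "2 * exp (1 / 2) * t * sqrt (N - k + 1) / sqrt d = \<beta> * t"
        by (simp add: \<beta>_def)
      then show ?thesis
        using coproj_gauss_small_ball[OF E k t] unfolding gauss.emeasure_eq_measure by (simp only: ennreal_leI)
    qed
    finally show "(\<integral>\<^sup>+x. f E x \<partial>gauss W) \<le> ennreal (4 / 3 * (\<beta> * t) ^ d)" .
  qed
  also have "\<dots> = ennreal (4 / 3 * (\<beta> * t) ^ d)"
    by (simp add: \<mu>.emeasure_space_1)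
  finally show ?thesis .
qed

private lemma v_zero_null: "emeasure \<mu> {E \<in> space \<mu>. nrm (v E) = 0} = 0"
proof -
  have "emeasure \<mu> {E \<in> space \<mu>. nrm (v E) = 0} \<le> ennreal (4 / 3 * (\<beta> * (1 / Suc j)) ^ d)" for j
    by (rule order_trans[OF emeasure_mono small_v]) auto
  moreover have "(\<lambda>j. ennreal (4 / 3 * (\<beta> * (1 / Suc j)) ^ d)) \<longlonglongrightarrow> ennreal (4 / 3 * (\<beta> * 0) ^ d)"
    by (intro tendsto_ennrealI tendsto_intros LIMSEQ_Suc lim_1_over_n)
  ultimately have "emeasure \<mu> {E \<in> space \<mu>. nrm (v E) = 0} \<le> ennreal (4 / 3 * (\<beta> * 0) ^ d)"
    by (intro LIMSEQ_le_const) auto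
  then show ?thesis by simp
qed

text \<open>Every \<open>x \<in> E\<close> is orthogonal to \<open>v E\<close>, and \<open>v E k = \<bar>v E\<bar>\<^sup>2\<close>; hence \<open>x k\<close> is, up to sign, the inner product of
  \<open>Y E\<close> with the tail of \<open>x\<close>.\<close>

private definition "Y E = (\<lambda>i\<in>T. v E i / (nrm (v E))\<^sup>2)"

private lemma measurable_Y [measurable]: "Y \<in> measurable \<mu> (borel_PiM T)"
  unfolding Y_def by measurable

text \<open>Supplies the hypothesis of \<open>rotation_invariant_law\<close> for \<open>Y\<close>.
  The reflection that exchanges \<open>s\<close> and \<open>t\<close> moves the tail only, so it
  fixes \<open>e\<close>, and \<open>v\<close> is carried along with \<open>E\<close>.\<close>

private lemma Y_char_invariant:
  assumes st: "ip T s s = ip T t t"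
  shows "(CLINT E|\<mu>. iexp (ip T s (Y E))) = (CLINT E|\<mu>. iexp (ip T t (Y E)))"
proof -
  define s' t' where "s' = supp_restrict T s" and "t' = supp_restrict T t"
  define a where "a = (\<lambda>i. s' i - t' i)"
  have a: "a i = 0" if "i \<notin> T" for i
    using that unfolding a_def s'_def t'_def supp_restrict_def by auto
  have a_rn: "a \<in> rn N"
    unfolding rn_def using a T by blast
  have extend: "ip {1..N} (supp_restrict T x) y = ip T x y" for x y
    by (rule ip_supp_restrict_left[OF T(3)])
  have norm_eq: "ip {1..N} s' s' = ip {1..N} t' t'"
  proof -
    have "ip {1..N} (supp_restrict T x) (supp_restrict T x) = ip T x x" for x
      unfolding extend by (intro ip_cong) (auto simp: supp_restrict_def)
    then show ?thesis
      using st by (simp only: s'_def t'_def)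
  qed
  have "ip {1..N} a e = 0"
    unfolding ip_commute[of _ a] using k a[of k] by (subst ip_unit) auto
  then have e_fixed: "reflect {1..N} a e = e"
    by (simp add: reflect_def)
  have "ip T s (Y (reflect {1..N} a ` E)) = ip T t (Y E)" if E: "E \<in> space \<mu>" for E
  proof -
    let ?U = "reflect {1..N} a"
    have v_U: "v (?U ` E) = ?U (v E)"
    proof -
      have "coproj N W (?U ` E) (?U e) = ?U (v E)"
        by (rule coproj_reflect[OF _ k(3) W]) (use E space_\<mu> a in auto)
      then show ?thesis
        by (simp only: e_fixed)
    qed
    have ip_Y: "ip T x (Y E') = ip {1..N} (supp_restrict T x) (v E') / (nrm (v E'))\<^sup>2" for x E'
      unfolding extend by (simp add: ip_def Y_def sum_divide_distrib)
    have "ip T s (Y (?U ` E)) = ip {1..N} s' (?U (v E)) / (nrm (v E))\<^sup>2"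
      unfolding ip_Y v_U L2_set_reflect s'_def ..
    also have "ip {1..N} s' (?U (v E)) = ip {1..N} t' (v E)"
      unfolding ip_reflect_left[symmetric]
    proof (rule ip_cong)
      show "?U s' i = t' i" if "i \<in> {1..N}" for i
        unfolding a_def by (rule reflect_swap[OF _ norm_eq that]) simp
    qed simp
    finally show ?thesis
      unfolding ip_Y t'_def .
  qed
  moreover have "(CLINT E|\<mu>. iexp (ip T s (Y E))) = (CLINT E|distr \<mu> \<mu> (\<lambda>E. reflect {1..N} a ` E). iexp (ip T s (Y E)))"
    by (simp only: haar_grassmannian_reflect[OF haar k(3) a_rn])
  moreover have "\<dots> = (CLINT E|\<mu>. iexp (ip T s (Y (reflect {1..N} a ` E))))"
    by (rule integral_distr[OF haar_grassmannian_reflect(2)[OF haar k(3) a_rn]]) measurable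
  ultimately show ?thesis
    by (simp cong: Bochner_Integration.integral_cong)
qed

text \<open>By \<open>rotation_invariant_law\<close>, \<open>h (Y E)\<close> is distributed like
  \<open>|Y E| * h x / |x|\<close> with an independent Gaussian \<open>x\<close>. As
  \<open>|Y E| \<le> 1 / |v E|\<close> for \<open>v E \<noteq> 0\<close>, the event forces
  \<open>|v E| \<le> h x / (s |x|)\<close>, a small ball for fixed \<open>x\<close>. The factor 32/3
  is 4/3 from \<open>small_v\<close> times 8 from
  \<open>normalized_homogeneous_moment\<close>.\<close>

private lemma tail_functional_bound:
  assumes [measurable]: "h \<in> borel_measurable (borel_PiM T)"
    and h: "\<And>x. 0 \<le> h x" "\<And>c x. 0 \<le> c \<Longrightarrow> h (\<lambda>i\<in>T. c * x i) = c * h x" and s: "0 < s"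
  shows "emeasure \<mu> {E \<in> space \<mu>. s \<le> h (Y E)} \<le>
    ennreal (32 / 3 * (10 / (sqrt d * s)) ^ d) * (\<integral>\<^sup>+x. ennreal (h x ^ d) \<partial>gauss T)"
proof -
  interpret PG: pair_prob_space \<mu> "gauss T" ..
  define f where "f E x = (if s \<le> L2_set (Y E) T / L2_set x T * h x then 1 else 0 :: ennreal)" for E x
  have [measurable]: "(\<lambda>E. Y E i) \<in> borel_measurable \<mu>" if "i \<in> T" for i
    using that by measurable
  have f_meas: "(\<lambda>z. f (fst z) (snd z)) \<in> borel_measurable (\<mu> \<Otimes>\<^sub>M gauss T)"
    unfolding f_def by measurable
  have B: "{y \<in> space (borel_PiM T). s \<le> h y} \<in> sets (borel_PiM T)"
    by measurable
  have "Y -` {y \<in> space (borel_PiM T). s \<le> h y} \<inter> space \<mu> = {E \<in> space \<mu>. s \<le> h (Y E)}"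
    using measurable_space[OF measurable_Y] by auto
  then have "emeasure \<mu> {E \<in> space \<mu>. s \<le> h (Y E)} = emeasure (distr \<mu> (borel_PiM T) Y) {y \<in> space (borel_PiM T). s \<le> h y}"
    by (simp only: emeasure_distr[OF measurable_Y B])
  also have "distr \<mu> (borel_PiM T) Y = distr (\<mu> \<Otimes>\<^sub>M gauss T) (borel_PiM T) (\<lambda>(E, x). \<lambda>i\<in>T. L2_set (Y E) T / L2_set x T * x i)"
    by (rule rotation_invariant_law[OF T(1,2) \<mu>.prob_space_axioms measurable_Y Y_char_invariant])
  also have "emeasure \<dots> {y \<in> space (borel_PiM T). s \<le> h y} =
      (\<integral>\<^sup>+y. (if s \<le> h y then 1 else 0) \<partial>distr (\<mu> \<Otimes>\<^sub>M gauss T) (borel_PiM T) (\<lambda>(E, x). \<lambda>i\<in>T. L2_set (Y E) T / L2_set x T * x i))"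
    by (subst nn_integral_indicator[symmetric], simp only: sets_distr B)
       (auto intro!: nn_integral_cong simp: indicator_def space_PiM)
  also have "\<dots> = (\<integral>\<^sup>+z. f (fst z) (snd z) \<partial>(\<mu> \<Otimes>\<^sub>M gauss T))"
  proof (subst nn_integral_distr)
    show "(\<integral>\<^sup>+z. (if s \<le> h (case z of (E, x) \<Rightarrow> \<lambda>i\<in>T. L2_set (Y E) T / L2_set x T * x i) then 1 else 0) \<partial>(\<mu> \<Otimes>\<^sub>M gauss T)) =
        (\<integral>\<^sup>+z. f (fst z) (snd z) \<partial>(\<mu> \<Otimes>\<^sub>M gauss T))"
      unfolding f_def case_prod_beta by (intro nn_integral_cong, subst h(2)) simp_all
  qed measurable
  also have "\<dots> = (\<integral>\<^sup>+x. \<integral>\<^sup>+E. f E x \<partial>\<mu> \<partial>gauss T)"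
    using PG.nn_integral_snd[OF f_meas] by (simp only: fst_conv snd_conv)
  also have "\<dots> \<le> (\<integral>\<^sup>+x. ennreal (4 / 3 * (\<beta> / s) ^ d) * ennreal ((h x / L2_set x T) ^ d) \<partial>gauss T)"
  proof (rule nn_integral_mono)
    fix x
    define r where "r = h x / L2_set x T"
    have r: "0 \<le> r" using h(1) by (simp add: r_def)
    show "(\<integral>\<^sup>+E. f E x \<partial>\<mu>) \<le> ennreal (4 / 3 * (\<beta> / s) ^ d) * ennreal ((h x / L2_set x T) ^ d)"
    proof (cases "r = 0")
      case True
      then have "f E x = 0" for E
        using s by (auto simp: f_def r_def)
      then show ?thesis by simp
    next
      case False
      with r have r_pos: "0 < r" by simp
      have "(\<integral>\<^sup>+E. f E x \<partial>\<mu>) \<le> (\<integral>\<^sup>+E. indicator {E \<in> space \<mu>. nrm (v E) \<le> r / s} E \<partial>\<mu>)"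
      proof (rule nn_integral_mono)
        fix E assume E: "E \<in> space \<mu>"
        have "nrm (v E) \<le> r / s" if "s \<le> L2_set (Y E) T * r"
        proof -
          have "L2_set (Y E) T = L2_set (\<lambda>i. 1 / (nrm (v E))\<^sup>2 * v E i) T"
            by (intro L2_set_cong) (auto simp: Y_def)
          also have "\<dots> = 1 / (nrm (v E))\<^sup>2 * L2_set (v E) T"
            by (intro L2_set_cmult) simp
          also have "\<dots> \<le> 1 / (nrm (v E))\<^sup>2 * nrm (v E)"
            using T by (intro mult_left_mono) (auto simp: L2_set_def intro!: sum_mono2)
          also have "\<dots> = 1 / nrm (v E)"
            by (simp add: power2_eq_square)
          finally have "s \<le> 1 / nrm (v E) * r"
            using that mult_right_mono[of "L2_set (Y E) T" "1 / nrm (v E)" r] r by linarith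
          moreover from this have "nrm (v E) \<noteq> 0"
            using s by auto
          then have "0 < nrm (v E)"
            by (simp add: order.strict_iff_order)
          ultimately show ?thesis
            using s by (simp add: field_simps)
        qed
        then show "f E x \<le> indicator {E \<in> space \<mu>. nrm (v E) \<le> r / s} E"
          using E by (auto simp: f_def r_def)
      qed
      also have "\<dots> = emeasure \<mu> {E \<in> space \<mu>. nrm (v E) \<le> r / s}"
        by (rule nn_integral_indicator) measurable
      also have "\<dots> \<le> ennreal (4 / 3 * (\<beta> * (r / s)) ^ d)"
        using r_pos s by (intro small_v) simp
      also have "\<dots> = ennreal (4 / 3 * (\<beta> / s) ^ d) * ennreal (r ^ d)"
        using r \<beta>_pos s by (subst ennreal_mult[symmetric]) (auto simp: power_mult_distrib power_divide)
      finally show ?thesis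
        by (simp only: r_def)
    qed
  qed
  also have "\<dots> = ennreal (4 / 3 * (\<beta> / s) ^ d) * (\<integral>\<^sup>+x. ennreal ((h x / L2_set x T) ^ d) \<partial>gauss T)"
    by (rule nn_integral_cmult) measurable
  also have "\<dots> \<le> ennreal (4 / 3 * (\<beta> / s) ^ d) * (ennreal (8 * (2 / sqrt (card T)) ^ d) * (\<integral>\<^sup>+x. ennreal (h x ^ d) \<partial>gauss T))"
    by (rule mult_left_mono[OF normalized_homogeneous_moment[OF T(1,2) assms(1) h] zero_le])
  also have "\<dots> = ennreal (32 / 3 * (\<beta> / s * (2 / sqrt (card T))) ^ d) * (\<integral>\<^sup>+x. ennreal (h x ^ d) \<partial>gauss T)"
  proof -
    have "4 / 3 * (\<beta> / s) ^ d * (8 * (2 / sqrt (card T)) ^ d) = 32 / 3 * ((\<beta> / s) ^ d * (2 / sqrt (card T)) ^ d)"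
      by (simp only: mult_ac)
    also have "\<dots> = 32 / 3 * (\<beta> / s * (2 / sqrt (card T))) ^ d"
      by (simp only: power_mult_distrib)
    finally have "ennreal (4 / 3 * (\<beta> / s) ^ d) * ennreal (8 * (2 / sqrt (card T)) ^ d) = ennreal (32 / 3 * (\<beta> / s * (2 / sqrt (card T))) ^ d)"
      using \<beta>_pos s by (subst ennreal_mult[symmetric]) auto
    then show ?thesis
      by (simp only: mult.assoc[symmetric])
  qed
  also have "\<dots> \<le> ennreal (32 / 3 * (10 / (sqrt d * s)) ^ d) * (\<integral>\<^sup>+x. ennreal (h x ^ d) \<partial>gauss T)"
  proof (intro mult_right_mono ennreal_leI mult_left_mono power_mono)
    \<comment> \<open>\<open>card T = N - k\<close> is at least 1, so the ratio of
      \<open>N - k + 1\<close> to it is at most 2. Together with \<open>32 * exp 1 \<le> 96\<close>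
      this gives the constant 10.\<close>
    have M: "0 < real (card T)" "real (N - k + 1) \<le> 2 * real (card T)"
      using k by auto
    have "(4 * exp (1 / 2) * sqrt 2 :: real)\<^sup>2 = 32 * exp 1"
      by (simp add: power_mult_distrib power2_eq_square exp_add[symmetric])
    also have "\<dots> \<le> 10\<^sup>2"
      using exp_le by simp
    finally have c: "4 * exp (1 / 2) * sqrt 2 \<le> (10 :: real)"
      by (rule power2_le_imp_le) simp
    have "sqrt (N - k + 1) \<le> sqrt 2 * sqrt (card T)"
      using M(2) by (simp flip: real_sqrt_mult)
    then have "4 * exp (1 / 2) * sqrt (N - k + 1) \<le> 4 * exp (1 / 2) * (sqrt 2 * sqrt (card T))"
      by (intro mult_left_mono) auto
    also have "\<dots> \<le> 10 * sqrt (card T)"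
      using c by (simp add: mult.assoc[symmetric] mult_right_mono)
    finally have "4 * exp (1 / 2) * sqrt (N - k + 1) / sqrt (card T) \<le> 10"
      using M(1) by (simp add: divide_le_eq)
    then have "4 * exp (1 / 2) * sqrt (N - k + 1) / sqrt (card T) / (sqrt d * s) \<le> 10 / (sqrt d * s)"
      using s by (intro divide_right_mono) auto
    then show "\<beta> / s * (2 / sqrt (card T)) \<le> 10 / (sqrt d * s)"
      by (simp add: \<beta>_def mult_ac)
  qed (use \<beta>_pos s in auto)
  finally show ?thesis .
qed

text \<open>Formulated for an arbitrary compact set because \<open>head_functional_bound\<close>
  applies it to a reflected copy of \<open>C\<close>. The function \<open>h\<close> dominates the
  support function of the tails.\<close>

lemma coordinate_bound:
  assumes C: "compact C" "C \<subseteq> rn N" and meas[measurable]: "h \<in> borel_measurable (borel_PiM T)"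
    and h: "\<And>x. 0 \<le> h x" "\<And>c x. 0 \<le> c \<Longrightarrow> h (\<lambda>i\<in>T. c * x i) = c * h x" and s: "0 < s"
    and supp: "\<And>x y. x \<in> C \<Longrightarrow> \<bar>ip T y x\<bar> \<le> h y"
  shows "{E \<in> space \<mu>. \<exists>x\<in>C. x \<in> E \<and> s \<le> x k} \<in> sets \<mu>"
    and "emeasure \<mu> {E \<in> space \<mu>. \<exists>x\<in>C. x \<in> E \<and> s \<le> x k} \<le>
      ennreal (32 / 3 * (10 / (sqrt d * s)) ^ d) * (\<integral>\<^sup>+x. ennreal (h x ^ d) \<partial>gauss T)"
proof -
  let ?A = "{E \<in> space \<mu>. \<exists>x\<in>C. x \<in> E \<and> s \<le> x k}"
  have "{E \<in> space \<mu>. \<exists>x\<in>C. x \<in> E \<and> 0 \<le> x k - s} \<in> sets \<mu>"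
    by (rule sets_ex_compact_mem[OF C k(3) measurable_ident_sets[OF sets_\<mu>]])
       (auto intro!: continuous_intros continuous_on_coordinate)
  then show "?A \<in> sets \<mu>"
    by simp
  \<comment> \<open>If \<open>v E = 0\<close>, then \<open>Y E\<close> vanishes by division by zero
    and says nothing about \<open>x k\<close>; this null set is split off.\<close>
  have "?A \<subseteq> {E \<in> space \<mu>. nrm (v E) = 0} \<union> {E \<in> space \<mu>. s \<le> h (Y E)}"
  proof safe
    fix E x assume E: "E \<in> space \<mu>" and x: "x \<in> C" "x \<in> E" "s \<le> x k" and h_less: "\<not> s \<le> h (Y E)"
    show "nrm (v E) = 0"
    proof (rule ccontr)
      assume nz: "nrm (v E) \<noteq> 0"
      let ?r = "(nrm (v E))\<^sup>2"
      have r: "0 < ?r" using nz by simp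
      have "0 = ip {1..N} (v E) x"
        using v_props(2)[OF E x(2)] by simp
      also have "\<dots> = ip W (v E) x"
        unfolding ip_def using W v_props(1)[OF E] by (intro sum.mono_neutral_right) auto
      also have "\<dots> = v E k * x k + ip T (v E) x"
        unfolding ip_def using k by (subst sum.atLeast_Suc_atMost) auto
      also have "\<dots> = ?r * x k + ip T (v E) x"
        by (simp only: v_props(3)[OF E])
      finally have "?r * x k = - ip T (v E) x"
        by simp
      moreover have "ip T (Y E) x = ip T (v E) x / ?r"
        by (simp add: ip_def Y_def sum_divide_distrib)
      then have "ip T (v E) x = ?r * ip T (Y E) x"
        using nz by simp
      ultimately have "?r * (x k + ip T (Y E) x) = 0"
        by (simp only: distrib_left)
      then have "x k + ip T (Y E) x = 0"
        using nz by simp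
      then have "x k = - ip T (Y E) x"
        by simp
      also have "\<dots> \<le> h (Y E)"
        using supp[OF x(1), of "Y E"] by simp
      finally show False
        using x(3) h_less by simp
    qed
  qed
  then have "emeasure \<mu> ?A \<le> emeasure \<mu> ({E \<in> space \<mu>. nrm (v E) = 0} \<union> {E \<in> space \<mu>. s \<le> h (Y E)})"
    by (rule emeasure_mono) measurable
  also have "\<dots> \<le> emeasure \<mu> {E \<in> space \<mu>. nrm (v E) = 0} + emeasure \<mu> {E \<in> space \<mu>. s \<le> h (Y E)}"
    by (rule emeasure_subadditive) measurable
  also have "\<dots> = emeasure \<mu> {E \<in> space \<mu>. s \<le> h (Y E)}"
    by (simp only: v_zero_null add_0)
  also have "\<dots> \<le> ennreal (32 / 3 * (10 / (sqrt d * s)) ^ d) * (\<integral>\<^sup>+x. ennreal (h x ^ d) \<partial>gauss T)"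
    by (rule tail_functional_bound[OF meas h s])
  finally show "emeasure \<mu> ?A \<le> \<dots>" .
qed

end

section \<open>The norm of the head and the radius of the section\<close>

context
  fixes \<mu> :: "(nat \<Rightarrow> real) set measure" and C :: "(nat \<Rightarrow> real) set"
    and h :: "(nat \<Rightarrow> real) \<Rightarrow> real"
  assumes haar: "haar_grassmannian N n \<mu>" and k: "1 \<le> k" "k \<le> n" "n < N"
    and C: "compact C" "C \<subseteq> rn N" and h_meas: "h \<in> borel_measurable (borel_PiM {k+1..N})"
    and h: "\<And>x. 0 \<le> h x" "\<And>c x. 0 \<le> c \<Longrightarrow> h (\<lambda>i\<in>{k+1..N}. c * x i) = c * h x"
    and supp: "\<And>x y. x \<in> C \<Longrightarrow> \<bar>ip {k+1..N} y x\<bar> \<le> h y"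
begin

private abbreviation "Hd \<equiv> {1..k}"
private abbreviation "I \<equiv> \<integral>\<^sup>+x. ennreal (h x ^ d) \<partial>gauss T"

interpretation \<mu>: prob_space \<mu>
  using haar by (simp add: haar_grassmannian_def)

private lemma sets_haar [measurable_cong]: "sets \<mu> = sets (borel_grassmannian N n)"
  using haar by (simp add: haar_grassmannian_def)

text \<open>A reflection of the head maps \<open>u\<close> to a multiple of \<open>e\<^sub>k\<close> and fixes the tail, so this is the bound for a single
  coordinate.\<close>

private lemma head_functional_bound:
  fixes s :: real
  assumes s: "0 < s"
  shows "emeasure \<mu> {E \<in> space \<mu>. \<exists>x\<in>C. x \<in> E \<and> s \<le> ip Hd u x} \<le>
    ennreal (32 / 3 * (10 * L2_set u Hd / (sqrt d * s)) ^ d) * I"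
proof (cases "L2_set u Hd = 0")
  case True
  then have "\<forall>i\<in>Hd. u i = 0"
    by (simp only: L2_set_eq_0_iff finite_atLeastAtMost)
  then have "ip Hd u x = 0" for x
    unfolding ip_def by (intro sum.neutral) simp
  then show ?thesis
    using s by simp
next
  case False
  define r where "r = L2_set u Hd"
  have r: "0 < r" using False by (simp add: r_def order.strict_iff_order)
  define u' where "u' = supp_restrict Hd u"
  define t where "t = (\<lambda>i. r * (if i = k then 1 else 0 :: real))"
  define a where "a = (\<lambda>i. u' i - t i)"
  let ?U = "reflect {1..N} a"
  have Hd: "Hd \<subseteq> {1..N}" using k by auto
  have a: "a i = 0" if "i \<notin> Hd" for i
    using that k unfolding a_def u'_def t_def supp_restrict_def by auto
  have a_rn: "a \<in> rn N"
    unfolding rn_def using a Hd by blast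
  have ip_u': "ip {1..N} u' y = ip Hd u y" for y
    unfolding u'_def by (rule ip_supp_restrict_left[OF Hd])
  have ip_t: "ip {1..N} t y = r * y k" for y
    unfolding t_def ip_mult_left using k by (subst ip_unit) auto
  have "ip {1..N} u' u' = ip Hd u u"
    unfolding ip_u' by (intro ip_cong) (auto simp: u'_def supp_restrict_def)
  also have "\<dots> = r * t k"
    by (simp add: ip_self r_def t_def power2_eq_square)
  also have "\<dots> = ip {1..N} t t"
    by (rule ip_t[symmetric])
  finally have norm_eq: "ip {1..N} u' u' = ip {1..N} t t" .
  have U_u': "?U u' i = t i" if "i \<in> {1..N}" for i
    unfolding a_def by (rule reflect_swap[OF _ norm_eq that]) simp
  have U_coord: "r * ?U x k = ip Hd u x" for x
  proof -
    have "r * ?U x k = ip {1..N} t (?U x)"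
      by (rule ip_t[symmetric])
    also have "\<dots> = ip {1..N} (?U u') (?U x)"
      by (intro ip_cong) (simp_all only: U_u')
    finally show ?thesis
      by (simp only: ip_reflect ip_u')
  qed
  let ?B = "{E \<in> space \<mu>. \<exists>x\<in>?U ` C. x \<in> E \<and> s / r \<le> x k}"
  have compact: "compact (?U ` C)"
  proof (rule compact_continuous_image[OF _ C(1)])
    have "continuous_on C (\<lambda>x. ?U x i)" for i
      unfolding reflect_def ip_def divide_inverse
      by (intro continuous_intros continuous_on_coordinate)
    then show "continuous_on C ?U"
      by (rule continuous_on_coordinatewise_then_product)
  qed
  have sub: "?U ` C \<subseteq> rn N"
    using C(2) reflect_rn[OF a_rn] by blast
  have "\<bar>ip T y x\<bar> \<le> h y" if x: "x \<in> ?U ` C" for x y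
  proof -
    from x obtain z where z: "z \<in> C" "x = ?U z" by blast
    have "ip T y (?U z) = ip T y z"
      by (intro ip_cong) (auto simp: reflect_def a)
    then show ?thesis
      using supp[OF z(1), of y] z(2) by simp
  qed
  note bound = coordinate_bound[OF haar k compact sub h_meas h divide_pos_pos[OF s r] this]
  have B: "?B \<in> sets \<mu>"
    by (rule bound(1))
  have "{E \<in> space \<mu>. \<exists>x\<in>C. x \<in> E \<and> s \<le> ip Hd u x} \<subseteq> {E \<in> space \<mu>. ?U ` E \<in> ?B}"
  proof safe
    fix E x assume E: "E \<in> space \<mu>" and x: "x \<in> C" "x \<in> E" "s \<le> ip Hd u x"
    show "?U ` E \<in> space \<mu>"
      by (rule measurable_space[OF haar_grassmannian_reflect(2)[OF haar k(3) a_rn] E])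
    have "s / r \<le> ?U x k"
      using x(3) r U_coord[of x] by (simp add: divide_le_eq mult.commute)
    then show "\<exists>x\<in>?U ` C. x \<in> ?U ` E \<and> s / r \<le> x k"
      using x by blast
  qed
  moreover have meas: "{E \<in> space \<mu>. ?U ` E \<in> ?B} \<in> sets \<mu>"
  proof -
    have "(\<lambda>E. ?U ` E) -` ?B \<inter> space \<mu> = {E \<in> space \<mu>. ?U ` E \<in> ?B}"
      by blast
    then show ?thesis
      using measurable_sets[OF haar_grassmannian_reflect(2)[OF haar k(3) a_rn] B] by (simp only:)
  qed
  ultimately have "emeasure \<mu> {E \<in> space \<mu>. \<exists>x\<in>C. x \<in> E \<and> s \<le> ip Hd u x} \<le> emeasure \<mu> {E \<in> space \<mu>. ?U ` E \<in> ?B}"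
    by (rule emeasure_mono)
  also have "\<dots> = emeasure \<mu> ?B"
    by (rule emeasure_reflect[OF haar k a_rn B, symmetric])
  also have "\<dots> \<le> ennreal (32 / 3 * (10 / (sqrt d * (s / r))) ^ d) * I"
    by (rule bound(2))
  also have "10 / (sqrt d * (s / r)) = 10 * L2_set u Hd / (sqrt d * s)"
    using r by (simp add: r_def)
  finally show ?thesis .
qed

text \<open>Collects the constants: \<open>exp 4 \<le> 81\<close> from \<open>exp 1 \<le> 3\<close>,
  \<open>32 / 3 \<le> 11 ^ d\<close>, and \<open>10 * sqrt (n + 1) \<le> 15 * sqrt n\<close> from
  \<open>n \<ge> 1\<close>. Their product is \<open>81 * 11 * 15 = 13365\<close>.\<close>

private lemma constant_bound:
  fixes s :: real
  assumes that: "0 < s"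
  shows "exp (4 * real d) * (32 / 3 * (10 * sqrt (n + 1) / (sqrt d * (sqrt d * s))) ^ d) \<le> (14000 * sqrt n / (d * s)) ^ d"
proof -
  have e: "exp (4 * real d) \<le> 81 ^ d"
  proof -
    have "exp (4 * real d) = exp 4 ^ d"
      using exp_of_nat_mult[of d "4::real"] by (simp only: mult.commute[of 4])
    also have "\<dots> = (exp 1 ^ 4) ^ d"
      using exp_of_nat_mult[of 4 "1::real"] by simp
    also have "\<dots> \<le> (3 ^ 4) ^ d"
      using exp_le by (intro power_mono) auto
    finally show ?thesis by simp
  qed
  have c: "32 / 3 \<le> (11 :: real) ^ d"
  proof -
    have A: "(11 :: real) ^ 1 \<le> 11 ^ d"
      by (intro power_increasing) auto
    show ?thesis
      by (rule order_trans[OF _ A]) simp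
  qed
  have "sqrt (n + 1) \<le> sqrt (9 / 4 * real n)"
    using k by (intro real_sqrt_le_mono) simp
  also have "sqrt (9 / 4 * real n) = 3 / 2 * sqrt n"
    by (simp add: real_sqrt_mult real_sqrt_divide)
  finally have m: "sqrt (n + 1) \<le> 3 / 2 * sqrt n" .
  have "10 * sqrt (n + 1) / (sqrt d * (sqrt d * s)) = 10 * sqrt (n + 1) / (d * s)"
    by (simp add: mult.assoc[symmetric])
  also have "\<dots> \<le> 15 * sqrt n / (d * s)"
    using m that by (intro divide_right_mono) auto
  finally have "(10 * sqrt (n + 1) / (sqrt d * (sqrt d * s))) ^ d \<le> (15 * sqrt n / (d * s)) ^ d"
    using that by (intro power_mono) auto
  then have "exp (4 * real d) * (32 / 3 * (10 * sqrt (n + 1) / (sqrt d * (sqrt d * s))) ^ d) \<le>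
      81 ^ d * (11 ^ d * (15 * sqrt n / (d * s)) ^ d)"
    using e c that by (intro mult_mono) auto
  also have "\<dots> = (13365 * sqrt n / (d * s)) ^ d"
    by (simp only: power_mult_distrib[symmetric]) simp
  also have "\<dots> \<le> (14000 * sqrt n / (d * s)) ^ d"
    using that by (intro power_mono divide_right_mono mult_right_mono) auto
  finally show ?thesis .
qed

text \<open>If the head of some \<open>x\<close> is long, then its inner product with a Gaussian vector \<open>u\<close> is large with probability at
  least \<open>exp (- 4 d)\<close>; the head functional bound is averaged over \<open>u\<close>.\<close>

private lemma head_norm_bound:
  fixes s :: real
  assumes s: "0 < s"
  shows "emeasure \<mu> {E \<in> space \<mu>. \<exists>x\<in>C. x \<in> E \<and> s \<le> L2_set x Hd} \<le> ennreal ((14000 * sqrt n / (d * s)) ^ d) * I"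
proof -
  interpret PG: pair_prob_space \<mu> "gauss Hd" ..
  let ?A = "{E \<in> space \<mu>. \<exists>x\<in>C. x \<in> E \<and> s \<le> L2_set x Hd}"
  let ?B = "\<lambda>u. {E \<in> space \<mu>. \<exists>x\<in>C. x \<in> E \<and> sqrt d * s \<le> ip Hd u x}"
  \<comment> \<open>The joint event in \<open>E\<close> and \<open>u\<close>, with the inequality in
    the form in which \<open>sets_ex_compact_mem\<close> gives measurability on the product
    space.\<close>
  let ?D = "{z \<in> space (\<mu> \<Otimes>\<^sub>M gauss Hd). \<exists>x\<in>C. x \<in> fst z \<and> 0 \<le> ip Hd (snd z) x - sqrt d * s}"
  have ident: "(\<lambda>E. E) \<in> measurable \<mu> (borel_grassmannian N n)"
    by (rule measurable_ident_sets[OF sets_haar])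
  have "{E \<in> space \<mu>. \<exists>x\<in>C. x \<in> E \<and> 0 \<le> L2_set x Hd - s} \<in> sets \<mu>"
    unfolding L2_set_def
    by (rule sets_ex_compact_mem[OF C k(3) ident]) (auto intro!: continuous_intros continuous_on_coordinate)
  then have A: "?A \<in> sets \<mu>" by simp
  have fst_meas: "fst \<in> measurable (\<mu> \<Otimes>\<^sub>M gauss Hd) (borel_grassmannian N n)"
    using measurable_compose[OF measurable_fst ident] by simp
  have D: "?D \<in> sets (\<mu> \<Otimes>\<^sub>M gauss Hd)"
  proof (rule sets_ex_compact_mem[OF C k(3) fst_meas])
    have "(\<lambda>u. u i) \<in> borel_measurable (gauss Hd)" if "i \<in> Hd" for i
      using that by measurable
    then have "(\<lambda>z. snd z i) \<in> borel_measurable (\<mu> \<Otimes>\<^sub>M gauss Hd)" if "i \<in> Hd" for i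
      using that by (intro measurable_compose[OF measurable_snd]) auto
    then show "(\<lambda>z. ip Hd (snd z) x - sqrt d * s) \<in> borel_measurable (\<mu> \<Otimes>\<^sub>M gauss Hd)" for x
      unfolding ip_def by (intro borel_measurable_diff borel_measurable_sum borel_measurable_times) auto
    show "continuous_on C (\<lambda>x. ip Hd (snd z) x - sqrt d * s)" for z :: "(nat \<Rightarrow> real) set \<times> (nat \<Rightarrow> real)"
      unfolding ip_def by (intro continuous_intros continuous_on_coordinate)
  qed
  have halfspace: "ennreal (exp (- 4 * real d)) \<le> (\<integral>\<^sup>+u. indicator ?D (E, u) \<partial>gauss Hd)" if "E \<in> ?A" for E
  proof -
    obtain x where x: "x \<in> C" "x \<in> E" "s \<le> L2_set x Hd" and E: "E \<in> space \<mu>"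
      using \<open>E \<in> ?A\<close> by blast
    let ?H = "{u \<in> space (gauss Hd). sqrt d * L2_set x Hd \<le> ip Hd x u}"
    have H: "?H \<in> sets (gauss Hd)"
      by measurable
    have "exp (- 4 * real d) \<le> measure (gauss Hd) ?H"
      by (rule gauss_halfspace) (use x(3) s in auto)
    then have "ennreal (exp (- 4 * real d)) \<le> emeasure (gauss Hd) ?H"
      by (simp only: gauss.emeasure_eq_measure ennreal_leI)
    also have "\<dots> = (\<integral>\<^sup>+u. indicator ?H u \<partial>gauss Hd)"
      by (rule nn_integral_indicator[OF H, symmetric])
    also have "\<dots> \<le> (\<integral>\<^sup>+u. indicator ?D (E, u) \<partial>gauss Hd)"
    proof (rule nn_integral_mono)
      fix u
      have "(E, u) \<in> ?D" if u: "u \<in> ?H"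
      proof -
        have "sqrt d * s \<le> sqrt d * L2_set x Hd"
          using x(3) by (intro mult_left_mono) auto
        moreover have "sqrt d * L2_set x Hd \<le> ip Hd u x"
          using u unfolding ip_commute[of Hd u x] by blast
        ultimately have "0 \<le> ip Hd u x - sqrt d * s"
          by linarith
        then show ?thesis
          using x E u by (auto simp: space_pair_measure)
      qed
      then show "indicator ?H u \<le> (indicator ?D (E, u) :: ennreal)"
        by (simp add: indicator_def)
    qed
    finally show ?thesis .
  qed
  have "ennreal (exp (- 4 * real d)) * emeasure \<mu> ?A = (\<integral>\<^sup>+E. ennreal (exp (- 4 * real d)) * indicator ?A E \<partial>\<mu>)"
    by (rule nn_integral_cmult_indicator[OF A, symmetric])
  also have "\<dots> \<le> (\<integral>\<^sup>+E. \<integral>\<^sup>+u. indicator ?D (E, u) \<partial>gauss Hd \<partial>\<mu>)"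
  proof (rule nn_integral_mono)
    fix E
    show "ennreal (exp (- 4 * real d)) * indicator ?A E \<le> (\<integral>\<^sup>+u. indicator ?D (E, u) \<partial>gauss Hd)"
    proof (cases "E \<in> ?A")
      case True
      then show ?thesis
        by (simp only: indicator_simps mult_1_right halfspace)
    next
      case False
      then have "indicator ?A E = (0 :: ennreal)"
        by (rule indicator_simps)
      then show ?thesis
        by (simp only: mult_zero_right) (rule zero_le)
    qed
  qed
  also have "\<dots> = (\<integral>\<^sup>+u. \<integral>\<^sup>+E. indicator ?D (E, u) \<partial>\<mu> \<partial>gauss Hd)"
    by (rule PG.Fubini'[symmetric]) (use D in simp)
  also have "\<dots> \<le> (\<integral>\<^sup>+u. ennreal (32 / 3 * (10 / (sqrt d * (sqrt d * s))) ^ d) * I * ennreal (L2_set u Hd ^ d) \<partial>gauss Hd)"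
  proof (rule nn_integral_mono)
    fix u assume u: "u \<in> space (gauss Hd)"
    have sec: "{E \<in> space \<mu>. \<exists>x\<in>C. x \<in> E \<and> 0 \<le> ip Hd u x - sqrt d * s} \<in> sets \<mu>"
      unfolding ip_def
      by (rule sets_ex_compact_mem[OF C k(3) ident]) (auto intro!: continuous_intros continuous_on_coordinate)
    have "(\<integral>\<^sup>+E. indicator ?D (E, u) \<partial>\<mu>) = (\<integral>\<^sup>+E. indicator (?B u) E \<partial>\<mu>)"
      using u by (intro nn_integral_cong) (auto simp: indicator_def space_pair_measure)
    also have "\<dots> = emeasure \<mu> (?B u)"
      by (rule nn_integral_indicator) (use sec in simp)
    also have "\<dots> \<le> ennreal (32 / 3 * (10 * L2_set u Hd / (sqrt d * (sqrt d * s))) ^ d) * I"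
      by (rule head_functional_bound) (use s in simp)
    also have "32 / 3 * (10 * L2_set u Hd / (sqrt d * (sqrt d * s))) ^ d =
        32 / 3 * (10 / (sqrt d * (sqrt d * s))) ^ d * L2_set u Hd ^ d"
      by (simp only: power_mult_distrib[symmetric] mult.assoc times_divide_eq_left)
    also have "ennreal \<dots> = ennreal (32 / 3 * (10 / (sqrt d * (sqrt d * s))) ^ d) * ennreal (L2_set u Hd ^ d)"
      using s by (intro ennreal_mult) auto
    finally show "(\<integral>\<^sup>+E. indicator ?D (E, u) \<partial>\<mu>) \<le>
        ennreal (32 / 3 * (10 / (sqrt d * (sqrt d * s))) ^ d) * I * ennreal (L2_set u Hd ^ d)"
      by (simp only: mult.assoc mult.commute[of I])
  qed
  also have "\<dots> = ennreal (32 / 3 * (10 / (sqrt d * (sqrt d * s))) ^ d) * I * (\<integral>\<^sup>+u. ennreal (L2_set u Hd ^ d) \<partial>gauss Hd)"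
    by (rule nn_integral_cmult) measurable
  also have "\<dots> \<le> ennreal (32 / 3 * (10 / (sqrt d * (sqrt d * s))) ^ d) * I * ennreal (sqrt (card Hd + d) ^ d)"
    by (intro mult_left_mono gauss_L2_moment) auto
  also have "\<dots> = ennreal (32 / 3 * (10 * sqrt (n + 1) / (sqrt d * (sqrt d * s))) ^ d) * I"
  proof -
    have "card Hd + d = n + 1" using k by simp
    then have "ennreal (32 / 3 * (10 / (sqrt d * (sqrt d * s))) ^ d) * ennreal (sqrt (card Hd + d) ^ d) =
        ennreal (32 / 3 * (10 / (sqrt d * (sqrt d * s))) ^ d * sqrt (n + 1) ^ d)"
      using s by (subst ennreal_mult) auto
    also have "32 / 3 * (10 / (sqrt d * (sqrt d * s))) ^ d * sqrt (n + 1) ^ d =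
        32 / 3 * (10 * sqrt (n + 1) / (sqrt d * (sqrt d * s))) ^ d"
      by (simp only: power_mult_distrib[symmetric] mult.assoc times_divide_eq_left)
    finally show ?thesis
      by (simp only: mult.assoc mult.commute[of I]) (simp only: mult.assoc[symmetric])
  qed
  finally have "ennreal (exp (4 * real d)) * (ennreal (exp (- 4 * real d)) * emeasure \<mu> ?A) \<le>
      ennreal (exp (4 * real d)) * (ennreal (32 / 3 * (10 * sqrt (n + 1) / (sqrt d * (sqrt d * s))) ^ d) * I)"
    by (rule mult_left_mono) simp
  moreover have "ennreal (exp (4 * real d)) * ennreal (exp (- 4 * real d)) = 1"
  proof -
    have "exp (4 * real d) * exp (- 4 * real d) = 1"
      by (simp only: exp_add[symmetric] mult_minus_left add.right_inverse exp_zero)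
    then show ?thesis
      by (simp only: ennreal_mult[symmetric] exp_ge_zero ennreal_1)
  qed
  ultimately have "emeasure \<mu> ?A \<le> ennreal (exp (4 * real d)) * ennreal (32 / 3 * (10 * sqrt (n + 1) / (sqrt d * (sqrt d * s))) ^ d) * I"
    by (simp only: mult.assoc[symmetric] mult_1)
  also have "ennreal (exp (4 * real d)) * ennreal (32 / 3 * (10 * sqrt (n + 1) / (sqrt d * (sqrt d * s))) ^ d) =
      ennreal (exp (4 * real d) * (32 / 3 * (10 * sqrt (n + 1) / (sqrt d * (sqrt d * s))) ^ d))"
    using s by (intro ennreal_mult[symmetric]) auto
  also have "\<dots> * I \<le> ennreal ((14000 * sqrt n / (d * s)) ^ d) * I"
    by (intro mult_right_mono ennreal_leI constant_bound s) simp
  finally show ?thesis .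
qed

text \<open>If the section contains a point of norm above \<open>B\<close>, the head of that point
  is longer than \<open>\<Lambda> * sqrt n / (d * \<epsilon>)\<close>. At this level
  \<open>head_norm_bound\<close> and the moment bound \<open>\<Lambda> ^ d\<close> combine to
  \<open>(14000 * \<epsilon>) ^ d\<close>.\<close>

theorem section_radius_bound:
  fixes R \<Lambda> \<epsilon> B :: real
  assumes zero: "(\<lambda>_. 0) \<in> C" and R: "\<And>x. x \<in> C \<Longrightarrow> L2_set x T \<le> R"
    and \<Lambda>: "0 \<le> \<Lambda>" "I \<le> ennreal (\<Lambda> ^ d)" and \<epsilon>: "0 < \<epsilon>"
    and B: "R + \<Lambda> * sqrt n / (d * \<epsilon>) \<le> B"
  shows "1 - (14000 * \<epsilon>) ^ d \<le> measure \<mu> {E \<in> space \<mu>. section_radius N E C \<le> B}"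
proof -
  let ?G = "{E \<in> space \<mu>. section_radius N E C \<le> B}"
  let ?A = "\<lambda>j. {E \<in> space \<mu>. \<exists>x\<in>C. x \<in> E \<and> B + 1 / Suc j \<le> L2_set x {1..N}}"
  \<comment> \<open>The strict inequality \<open>B < |x|\<close> is exhausted by the closed
    conditions \<open>B + 1 / Suc j \<le> |x|\<close>, which \<open>sets_ex_compact_mem\<close> can
    handle. The extra term also keeps \<open>s j\<close> positive when
    \<open>\<Lambda> = 0\<close>.\<close>
  define s where "s j = \<Lambda> * sqrt n / (d * \<epsilon>) + 1 / Suc j" for j :: nat
  let ?A' = "\<lambda>j. {E \<in> space \<mu>. \<exists>x\<in>C. x \<in> E \<and> s j \<le> L2_set x Hd}"
  have s: "0 < s j" for j
    unfolding s_def using \<Lambda>(1) \<epsilon> by (intro add_nonneg_pos) auto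
  have ident: "(\<lambda>E. E) \<in> measurable \<mu> (borel_grassmannian N n)"
    by (rule measurable_ident_sets[OF sets_haar])
  have norm_set: "{E \<in> space \<mu>. \<exists>x\<in>C. x \<in> E \<and> r \<le> L2_set x J} \<in> sets \<mu>" for r J
  proof -
    have "{E \<in> space \<mu>. \<exists>x\<in>C. x \<in> E \<and> 0 \<le> L2_set x J - r} \<in> sets \<mu>"
      unfolding L2_set_def
      by (rule sets_ex_compact_mem[OF C k(3) ident]) (auto intro!: continuous_intros continuous_on_coordinate)
    then show ?thesis by simp
  qed
  have bdd: "bdd_above ((\<lambda>x. L2_set x {1..N}) ` (E \<inter> C))" for E
  proof -
    have "continuous_on C (\<lambda>x. L2_set x {1..N})"
      unfolding L2_set_def by (intro continuous_intros continuous_on_coordinate)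
    then have "bdd_above ((\<lambda>x. L2_set x {1..N}) ` C)"
      by (intro bounded_imp_bdd_above compact_imp_bounded compact_continuous_image C(1))
    then show ?thesis
      by (rule bdd_above_mono) auto
  qed
  have space: "space \<mu> = grassmannian N n"
    using sets_eq_imp_space_eq[OF sets_haar] by simp
  have radius_le: "section_radius N E C \<le> B \<longleftrightarrow> (\<forall>x\<in>E \<inter> C. L2_set x {1..N} \<le> B)" if "E \<in> space \<mu>" for E
  proof
    assume "section_radius N E C \<le> B"
    then show "\<forall>x\<in>E \<inter> C. L2_set x {1..N} \<le> B"
      unfolding section_radius_def using cSUP_upper[OF _ bdd] by (meson order_trans)
  next
    assume *: "\<forall>x\<in>E \<inter> C. L2_set x {1..N} \<le> B"
    have "subspace E"
      using that by (simp add: space grassmannian_def)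
    then have "0 \<in> E"
      by (rule subspace_0)
    then have "(\<lambda>_. 0) \<in> E"
      by (simp only: zero_fun_def)
    then show "section_radius N E C \<le> B"
      unfolding section_radius_def using zero * by (intro cSUP_least) auto
  qed
  have compl: "space \<mu> - ?G = (\<Union>j. ?A j)"
  proof (intro equalityI subsetI)
    fix E assume "E \<in> space \<mu> - ?G"
    then have E: "E \<in> space \<mu>" and "\<not> (\<forall>x\<in>E \<inter> C. L2_set x {1..N} \<le> B)"
      using radius_le[of E] by blast+
    then obtain x where x: "x \<in> E" "x \<in> C" "B < L2_set x {1..N}"
      by (meson IntD1 IntD2 not_le)
    obtain j where "1 / real (Suc j) < L2_set x {1..N} - B"
      using nat_approx_posE[of "L2_set x {1..N} - B"] x(3) by auto
    then show "E \<in> (\<Union>j. ?A j)"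
      using E x by (intro UN_I[of j] CollectI conjI bexI[of _ x]) auto
  next
    fix E assume "E \<in> (\<Union>j. ?A j)"
    then obtain j x where x: "E \<in> space \<mu>" "x \<in> E" "x \<in> C" "B + 1 / Suc j \<le> L2_set x {1..N}"
      by blast
    have "0 < 1 / real (Suc j)" by simp
    with x(4) have "B < L2_set x {1..N}" by linarith
    then show "E \<in> space \<mu> - ?G"
      using x radius_le[of E] by (auto simp: not_le)
  qed
  have A_sub: "?A j \<subseteq> ?A' j" for j
  proof safe
    fix E x assume x: "x \<in> C" "x \<in> E" "B + 1 / Suc j \<le> L2_set x {1..N}"
    have "L2_set x {1..N} \<le> L2_set x Hd + L2_set x T"
    proof -
      have "{1..N} = Hd \<union> T" "Hd \<inter> T = {}" using k by auto
      then have "(\<Sum>i\<in>{1..N}. (x i)\<^sup>2) = (L2_set x Hd)\<^sup>2 + (L2_set x T)\<^sup>2"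
        by (simp add: sum.union_disjoint L2_set_def sum_nonneg)
      then show ?thesis
        unfolding L2_set_def[of x "{1..N}"] by (simp add: sqrt_sum_squares_le_sum)
    qed
    then have "s j \<le> L2_set x Hd"
      using x(3) R[OF x(1)] B by (simp add: s_def)
    then show "\<exists>x\<in>C. x \<in> E \<and> s j \<le> L2_set x Hd"
      using x by blast
  qed
  have A'_le: "emeasure \<mu> (?A' j) \<le> ennreal ((14000 * \<epsilon>) ^ d)" for j
  proof -
    have "emeasure \<mu> (?A' j) \<le> ennreal ((14000 * sqrt n / (d * s j)) ^ d) * I"
      by (rule head_norm_bound[OF s])
    also have "\<dots> \<le> ennreal ((14000 * sqrt n / (d * s j)) ^ d) * ennreal (\<Lambda> ^ d)"
      by (intro mult_left_mono \<Lambda>) simp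
    also have "\<dots> = ennreal ((14000 * (\<Lambda> * sqrt n / (d * s j))) ^ d)"
      using s[of j] \<Lambda>(1) by (subst ennreal_mult[symmetric]) (auto simp: power_mult_distrib[symmetric] mult_ac)
    also have "\<dots> \<le> ennreal ((14000 * \<epsilon>) ^ d)"
    proof (intro ennreal_leI power_mono mult_left_mono)
      have d: "0 < real d" by simp
      have "\<Lambda> * sqrt n / (d * \<epsilon>) \<le> s j"
        by (simp add: s_def)
      then have "\<Lambda> * sqrt n \<le> s j * (d * \<epsilon>)"
        using d \<epsilon> by (simp only: pos_divide_le_eq mult_pos_pos)
      then show "\<Lambda> * sqrt n / (d * s j) \<le> \<epsilon>"
        using d s[of j] by (simp only: pos_divide_le_eq mult_pos_pos) (simp only: mult_ac)
    qed (use s[of j] \<Lambda>(1) in auto)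
    finally show ?thesis .
  qed
  have "incseq ?A"
  proof (rule incseq_SucI, safe)
    fix j E x assume x: "x \<in> C" "x \<in> E" "B + 1 / Suc j \<le> L2_set x {1..N}"
    have "1 / real (Suc (Suc j)) \<le> 1 / real (Suc j)"
      by (intro divide_left_mono) auto
    then show "\<exists>x\<in>C. x \<in> E \<and> B + 1 / Suc (Suc j) \<le> L2_set x {1..N}"
      using x by (intro bexI[of _ x]) auto
  qed
  then have "emeasure \<mu> (\<Union>j. ?A j) = (SUP j. emeasure \<mu> (?A j))"
    by (intro SUP_emeasure_incseq[symmetric]) (auto simp: norm_set)
  also have "\<dots> \<le> ennreal ((14000 * \<epsilon>) ^ d)"
    by (intro SUP_least order_trans[OF emeasure_mono[OF A_sub norm_set] A'_le])
  finally have "measure \<mu> (space \<mu> - ?G) \<le> (14000 * \<epsilon>) ^ d"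
    unfolding compl using \<epsilon> by (simp add: \<mu>.emeasure_eq_measure)
  moreover have "?G \<in> sets \<mu>"
  proof -
    have "space \<mu> - ?G \<in> sets \<mu>"
      unfolding compl using norm_set by auto
    then have "space \<mu> - (space \<mu> - ?G) \<in> sets \<mu>"
      by auto
    moreover have "space \<mu> - (space \<mu> - ?G) = ?G"
      by auto
    ultimately show ?thesis by simp
  qed
  then have "measure \<mu> (space \<mu> - ?G) = 1 - measure \<mu> ?G"
    by (rule \<mu>.prob_compl)
  ultimately show ?thesis
    by simp
qed

end

lemma p_ellipsoid_probability:
  fixes h :: "(nat \<Rightarrow> real) \<Rightarrow> real" and p R \<Lambda> \<epsilon> B :: real
  assumes haar: "haar_grassmannian N n \<mu>" and k: "1 \<le> k" "k \<le> n" "n < N"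
    and p: "1 \<le> p" and \<sigma>: "\<And>i. i \<in> {1..N} \<Longrightarrow> 0 \<le> \<sigma> i"
    and h_meas: "h \<in> borel_measurable (borel_PiM {k+1..N})"
    and h: "\<And>x. 0 \<le> h x" "\<And>c x. 0 \<le> c \<Longrightarrow> h (\<lambda>i\<in>{k+1..N}. c * x i) = c * h x"
    and supp: "\<And>x y. x \<in> p_ellipsoid N p \<sigma> \<Longrightarrow> (\<Sum>i\<in>{k+1..N}. \<bar>y i\<bar> * \<bar>x i\<bar>) \<le> h y"
    and R: "\<And>x. x \<in> p_ellipsoid N p \<sigma> \<Longrightarrow> L2_set x {k+1..N} \<le> R"
    and \<Lambda>: "0 \<le> \<Lambda>" "(\<integral>\<^sup>+x. ennreal (h x ^ (n - k + 1)) \<partial>gauss {k+1..N}) \<le> ennreal (\<Lambda> ^ (n - k + 1))"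
    and \<epsilon>: "0 < \<epsilon>" and B: "R + \<Lambda> * sqrt n / (real (n - k + 1) * \<epsilon>) \<le> B"
  shows "1 - (14000 * \<epsilon>) ^ (n - k + 1) \<le> measure \<mu> {E \<in> space \<mu>. section_radius N E (p_ellipsoid N p \<sigma>) \<le> B}"
proof (rule section_radius_bound[OF haar k compact_p_ellipsoid p_ellipsoid_subset_rn h_meas h _ zero_mem_p_ellipsoid R \<Lambda> \<epsilon> B])
  show "\<bar>ip {k+1..N} y x\<bar> \<le> h y" if "x \<in> p_ellipsoid N p \<sigma>" for x y
  proof -
    have "\<bar>ip {k+1..N} y x\<bar> \<le> (\<Sum>i\<in>{k+1..N}. \<bar>y i\<bar> * \<bar>x i\<bar>)"
      unfolding ip_def abs_mult[symmetric] by (rule sum_abs)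
    then show ?thesis
      using supp[OF that, of y] by simp
  qed
qed (use p \<sigma> in auto)

section \<open>The three ranges of \<open>p\<close>\<close>

context
  fixes \<mu> :: "(nat \<Rightarrow> real) set measure" and \<sigma> :: "nat \<Rightarrow> real" and \<epsilon> :: real
  assumes haar: "haar_grassmannian N n \<mu>" and k: "1 \<le> k" "k \<le> n" "n < N"
    and \<sigma>: "\<And>i. i \<in> {1..N} \<Longrightarrow> 0 \<le> \<sigma> i" and mono: "antimono_on {1..N} \<sigma>"
    and \<epsilon>: "0 < \<epsilon>" "\<epsilon> \<le> 1 / 56000"
begin

private abbreviation "L \<equiv> sqrt (ln (1 / \<epsilon>))"

private lemma T_nonneg: "i \<in> T \<Longrightarrow> 0 \<le> \<sigma> i"
  using \<sigma> k by auto

private lemma T_le: "i \<in> T \<Longrightarrow> \<sigma> i \<le> \<sigma> (k + 1)"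
  using monotone_onD[OF mono, of "k + 1" i] k by auto

private lemma R_nonneg: "0 \<le> \<sigma> (k + 1)"
  using k by (intro \<sigma>) auto

text \<open>With \<open>X = sqrt (n / d) / \<epsilon>\<close> this gives
  \<open>1 \<le> X \<le> L * X\<close>. Hence the radius of the tail and the part of
  \<open>\<Lambda>\<close> that carries \<open>sqrt d\<close> are both absorbed into the first
  summand of the bounds.\<close>

private lemma ratio:
  shows "1 \<le> sqrt (n / d) / \<epsilon>" and "1 \<le> L" and "sqrt d * sqrt n / (d * \<epsilon>) = sqrt (n / d) / \<epsilon>"
    and "sqrt (n / d) / \<epsilon> \<le> L * (sqrt (n / d) / \<epsilon>)"
proof -
  have "real d \<le> n" using k by simp
  then have "1 \<le> sqrt (n / d)" by simp
  then have "1 * 1 \<le> sqrt (n / d) * (1 / \<epsilon>)"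
    using \<epsilon> by (intro mult_mono) (auto simp: le_divide_eq)
  then show a: "1 \<le> sqrt (n / d) / \<epsilon>" by simp
  show L: "1 \<le> L"
    by (rule ln_inverse_ge_1[OF \<epsilon>])
  have *: "sqrt x * sqrt y / (x * \<epsilon>) = sqrt (y / x) / \<epsilon>" if "0 < x" for x y :: real
    using that real_sqrt_mult_self[of x] \<epsilon>(1) by (simp add: real_sqrt_divide divide_simps del: real_sqrt_mult_self)
  show "sqrt d * sqrt n / (d * \<epsilon>) = sqrt (n / d) / \<epsilon>"
    by (rule *) simp
  show "sqrt (n / d) / \<epsilon> \<le> L * (sqrt (n / d) / \<epsilon>)"
    using mult_right_mono[OF L, of "sqrt (n / d) / \<epsilon>"] a by simp
qed

private lemma first_summand_eq:
  "8 * sqrt 2 * (L * (sqrt (n / d) / \<epsilon>) * R) = 8 * L / \<epsilon> * sqrt (2 * real n / d) * R" for R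
proof -
  have "8 * sqrt 2 * (l * (sqrt (n / x) / \<epsilon>) * R) = 8 * l / \<epsilon> * sqrt (2 * real n / x) * R" for l x
    by (simp add: real_sqrt_mult real_sqrt_divide mult_ac)
  then show ?thesis .
qed

text \<open>By Hoelder's inequality \<open>h\<close> dominates the support function of the tail. Its
  exponent is \<open>q \<ge> 2\<close>, so \<open>gauss_lq_moment\<close> applies, and
  \<open>\<Lambda>\<close> comes from \<open>q S^2 + d R^2 \<le> \<Lambda>^2\<close>. Tails have
  norm at most \<open>\<sigma> (k + 1)\<close> because \<open>t^2 \<le> t powr p\<close> for
  \<open>0 \<le> t \<le> 1\<close>.\<close>

private lemma case_p_le_2:
  fixes p :: real
  assumes p: "1 < p" "p \<le> 2"
  shows "1 - (14000 * \<epsilon>) ^ d \<le> measure \<mu> {E \<in> space \<mu>. section_radius N E (p_ellipsoid N p \<sigma>) \<le>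
    8 * L / \<epsilon> * sqrt (2 * real n / d) * \<sigma> (k + 1) +
    2 * sqrt (conj_exponent p * real n) / (\<epsilon> * d) * (\<Sum>i\<in>T. \<sigma> i powr conj_exponent p) powr (1 / conj_exponent p)}"
proof -
  define q where "q = conj_exponent p"
  have q: "2 \<le> q" "1 / p + 1 / q = 1"
    using p conj_exponent[OF p(1)] by (auto simp: q_def conj_exponent_def le_divide_eq)
  define S where "S = (\<Sum>i\<in>T. \<sigma> i powr q) powr (1 / q)"
  define R where "R = \<sigma> (k + 1)"
  have R: "0 \<le> R" using R_nonneg by (simp add: R_def)
  have S: "0 \<le> S" by (simp add: S_def)
  define h where "h y = (\<Sum>i\<in>T. \<sigma> i powr q * \<bar>y i\<bar> powr q) powr (1 / q)" for y :: "nat \<Rightarrow> real"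
  define \<Lambda> where "\<Lambda> = sqrt q * S + sqrt d * R"
  have z: "(\<sigma> i * \<bar>y i\<bar>) powr q = \<sigma> i powr q * \<bar>y i\<bar> powr q" if "i \<in> T" for i and y :: "nat \<Rightarrow> real"
    using T_nonneg[OF that] by (simp add: powr_mult)
  have "1 - (14000 * \<epsilon>) ^ d \<le> measure \<mu> {E \<in> space \<mu>. section_radius N E (p_ellipsoid N p \<sigma>) \<le>
      8 * L / \<epsilon> * sqrt (2 * real n / d) * R + 2 * sqrt (q * real n) / (\<epsilon> * d) * S}"
  proof (rule p_ellipsoid_probability[OF haar k _ \<sigma>, where h = h and R = R and \<Lambda> = \<Lambda>])
    show "h \<in> borel_measurable (borel_PiM T)"
      unfolding h_def by measurable
    show "0 \<le> h x" for x by (simp add: h_def)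
    show "h (\<lambda>i\<in>T. c * x i) = c * h x" if "0 \<le> c" for c x
    proof -
      have "(\<Sum>i\<in>T. \<sigma> i powr q * \<bar>(\<lambda>i\<in>T. c * x i) i\<bar> powr q) = c powr q * (\<Sum>i\<in>T. \<sigma> i powr q * \<bar>x i\<bar> powr q)"
        unfolding sum_distrib_left using that by (intro sum.cong refl) (simp add: abs_mult powr_mult)
      then show ?thesis
        using that q by (simp only: h_def powr_mult) (simp add: powr_powr)
    qed
    show "(\<Sum>i\<in>T. \<bar>y i\<bar> * \<bar>x i\<bar>) \<le> h y" if x: "x \<in> p_ellipsoid N p \<sigma>" for x y
    proof -
      have "(\<Sum>i\<in>T. \<bar>y i\<bar> * \<bar>x i\<bar>) = (\<Sum>i\<in>T. \<bar>x i\<bar> / \<sigma> i * (\<sigma> i * \<bar>y i\<bar>))"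
      proof (intro sum.cong refl)
        fix i assume "i \<in> T"
        then have "\<bar>x i\<bar> = \<sigma> i * (\<bar>x i\<bar> / \<sigma> i)"
          using x p \<sigma> k by (intro p_ellipsoid_coord_le(2)) auto
        then have "\<bar>y i\<bar> * \<bar>x i\<bar> = \<bar>y i\<bar> * (\<sigma> i * (\<bar>x i\<bar> / \<sigma> i))"
          by (rule arg_cong)
        then show "\<bar>y i\<bar> * \<bar>x i\<bar> = \<bar>x i\<bar> / \<sigma> i * (\<sigma> i * \<bar>y i\<bar>)"
          by (simp only: mult_ac)
      qed
      also have "\<dots> \<le> (\<Sum>i\<in>T. (\<sigma> i * \<bar>y i\<bar>) powr q) powr (1 / q)"
        using p q T_nonneg k by (intro Hoelder_unit_ball[where p = p] p_ellipsoid_sum_le[OF x]) auto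
      also have "\<dots> = h y"
        unfolding h_def by (simp only: z cong: sum.cong)
      finally show ?thesis .
    qed
    show "L2_set x T \<le> R" if x: "x \<in> p_ellipsoid N p \<sigma>" for x
    proof -
      have "(\<Sum>i\<in>T. (x i)\<^sup>2) \<le> (\<Sum>i\<in>T. R\<^sup>2 * (\<bar>x i\<bar> / \<sigma> i) powr p)"
      proof (rule sum_mono)
        fix i assume i: "i \<in> T"
        let ?t = "\<bar>x i\<bar> / \<sigma> i"
        have i': "i \<in> {1..N}" using i k by auto
        have t: "0 \<le> ?t" "?t \<le> 1" "\<bar>x i\<bar> = \<sigma> i * ?t"
          using T_nonneg[OF i] p_ellipsoid_coord_le[OF x _ i' \<sigma>] p by auto
        have "?t\<^sup>2 \<le> ?t powr p"
        proof (cases "?t = 0")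
          case False
          then have "0 < ?t" using t(1) by linarith
          then have "?t\<^sup>2 = ?t powr 2" by simp
          also have "\<dots> \<le> ?t powr p"
            using p t by (intro powr_mono') auto
          finally show ?thesis .
        next
          case True
          then have "?t\<^sup>2 = 0" by (simp only:) simp
          then show ?thesis
            using powr_ge_zero[of ?t p] by linarith
        qed
        then have "(\<sigma> i)\<^sup>2 * ?t\<^sup>2 \<le> R\<^sup>2 * ?t powr p"
          using T_nonneg[OF i] T_le[OF i] by (intro mult_mono power_mono) (auto simp: R_def)
        moreover have "(x i)\<^sup>2 = (\<sigma> i)\<^sup>2 * ?t\<^sup>2"
          unfolding power_mult_distrib[symmetric] t(3)[symmetric] by simp
        ultimately show "(x i)\<^sup>2 \<le> R\<^sup>2 * ?t powr p"
          by (simp only:)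
      qed
      also have "\<dots> = R\<^sup>2 * (\<Sum>i\<in>T. (\<bar>x i\<bar> / \<sigma> i) powr p)"
        by (simp only: sum_distrib_left)
      also have "\<dots> \<le> R\<^sup>2 * 1"
        using k by (intro mult_left_mono p_ellipsoid_sum_le[OF x]) auto
      finally show ?thesis
        unfolding L2_set_def using R by (intro real_le_lsqrt) (auto simp: sum_nonneg)
    qed
    show "0 \<le> \<Lambda>"
      using q S R by (simp add: \<Lambda>_def)
    show "(\<integral>\<^sup>+x. ennreal (h x ^ d) \<partial>gauss T) \<le> ennreal (\<Lambda> ^ d)"
    proof -
      have "h x ^ d = (\<Sum>i\<in>T. \<sigma> i powr q * \<bar>x i\<bar> powr q) powr (real d / q)" for x
        unfolding h_def by (rule powr_inverse_power) simp
      then have "(\<integral>\<^sup>+x. ennreal (h x ^ d) \<partial>gauss T) =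
          (\<integral>\<^sup>+x. ennreal ((\<Sum>i\<in>T. \<sigma> i powr q * \<bar>x i\<bar> powr q) powr (real d / q)) \<partial>gauss T)"
        by (simp only:)
      also have "\<dots> \<le> ennreal (((q - 1) * (\<Sum>i\<in>T. \<sigma> i powr q) powr (2 / q) + real d * R\<^sup>2) powr (real d / 2))"
        using q T_nonneg T_le by (intro gauss_lq_moment) (auto simp: R_def)
      also have "\<dots> \<le> ennreal (\<Lambda> ^ d)"
      proof (rule ennreal_leI)
        have "(\<Sum>i\<in>T. \<sigma> i powr q) powr (2 / q) = S\<^sup>2"
          unfolding S_def power2_eq_square by (simp flip: powr_add)
        moreover have "(q - 1) * S\<^sup>2 \<le> q * S\<^sup>2"
          by (intro mult_right_mono) auto
        moreover have "q * S\<^sup>2 + real d * R\<^sup>2 \<le> \<Lambda>\<^sup>2"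
          unfolding \<Lambda>_def power2_sum using q S R by (simp add: power_mult_distrib)
        ultimately have "(q - 1) * (\<Sum>i\<in>T. \<sigma> i powr q) powr (2 / q) + real d * R\<^sup>2 \<le> \<Lambda>\<^sup>2"
          by simp
        then have "((q - 1) * (\<Sum>i\<in>T. \<sigma> i powr q) powr (2 / q) + real d * R\<^sup>2) powr (real d / 2) \<le> (\<Lambda>\<^sup>2) powr (real d / 2)"
          using q by (intro powr_mono2) auto
        also have "(\<Lambda>\<^sup>2) powr (real d / 2) = \<Lambda> ^ d"
          by (rule power2_powr_half[OF \<open>0 \<le> \<Lambda>\<close>]) simp
        finally show "((q - 1) * (\<Sum>i\<in>T. \<sigma> i powr q) powr (2 / q) + real d * R\<^sup>2) powr (real d / 2) \<le> \<Lambda> ^ d" .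
      qed
      finally show ?thesis .
    qed
    show "R + \<Lambda> * sqrt n / (real d * \<epsilon>) \<le> 8 * L / \<epsilon> * sqrt (2 * real n / d) * R + 2 * sqrt (q * real n) / (\<epsilon> * d) * S"
    proof -
      define X where "X = sqrt (n / d) / \<epsilon>"
      define Q where "Q = sqrt (q * real n) / (\<epsilon> * d)"
      have X: "1 \<le> X" "X \<le> L * X"
        using ratio by (simp_all only: X_def)
      then have Z: "1 \<le> L * X" by linarith
      have Q: "0 \<le> Q" using q \<epsilon> by (simp add: Q_def)
      have "\<Lambda> * sqrt n / (real d * \<epsilon>) = Q * S + sqrt d * sqrt n / (d * \<epsilon>) * R"
      proof -
        have "(sqrt q * S + sqrt x * R) * sqrt n / (x * \<epsilon>) = sqrt (q * n) / (\<epsilon> * x) * S + sqrt x * sqrt n / (x * \<epsilon>) * R" for x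
          by (simp add: real_sqrt_mult add_divide_distrib algebra_simps)
        then show ?thesis
          unfolding \<Lambda>_def Q_def .
      qed
      also have "\<dots> = Q * S + X * R"
        unfolding ratio(3) X_def ..
      finally have "R + \<Lambda> * sqrt n / (real d * \<epsilon>) = 1 * R + X * R + Q * S"
        by simp
      also have "\<dots> \<le> (L * X) * R + (L * X) * R + 2 * Q * S"
        using X Z R Q S by (intro add_mono mult_right_mono) auto
      also have "\<dots> = 2 * 1 * (L * X * R) + 2 * Q * S"
        by simp
      also have "\<dots> \<le> 8 * sqrt 2 * (L * X * R) + 2 * Q * S"
        using X Z R Q S by (intro add_mono mult_mono) auto
      also have "\<dots> = 8 * L / \<epsilon> * sqrt (2 * real n / d) * R + 2 * sqrt (q * real n) / (\<epsilon> * d) * S"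
        unfolding X_def Q_def first_summand_eq by simp
      finally show ?thesis .
    qed
  qed (use p \<epsilon> in auto)
  then show ?thesis
    by (simp only: R_def S_def q_def)
qed

text \<open>The conjugate exponent is now below 2, outside the range of
  \<open>gauss_lq_moment\<close>. The tail is therefore enclosed in the Euclidean ellipsoid with the
  semi-axes \<open>b i\<close> of \<open>p_ellipsoid_weights\<close>, whose support function
  \<open>h\<close> falls under the case \<open>q = 2\<close>.\<close>

private lemma case_p_gt_2:
  fixes p :: real
  assumes p: "2 < p"
  shows "1 - (14000 * \<epsilon>) ^ d \<le> measure \<mu> {E \<in> space \<mu>. section_radius N E (p_ellipsoid N p \<sigma>) \<le>
    8 * L / \<epsilon> * sqrt (2 * real n / d) * (\<Sum>i\<in>T. \<sigma> i powr (2 * p / (p - 2))) powr ((p - 2) / (2 * p)) +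
    2 * sqrt (real n) / (\<epsilon> * d) * (\<Sum>i\<in>{n+1..N}. \<sigma> i powr conj_exponent p) powr (1 / conj_exponent p)}"
proof -
  define R where "R = (\<Sum>i\<in>T. \<sigma> i powr (2 * p / (p - 2))) powr (1 / (2 * p / (p - 2)))"
  define Q where "Q = (\<Sum>i\<in>{n+1..N}. \<sigma> i powr conj_exponent p) powr (1 / conj_exponent p)"
  have nonneg: "\<forall>i\<in>{1..N}. 0 \<le> \<sigma> i"
    using \<sigma> by blast
  obtain b where "\<forall>i\<in>T. 0 \<le> b i \<and> b i \<le> sqrt 2 * R"
    and sum_b: "(\<Sum>i\<in>T. (b i)\<^sup>2) \<le> 2 * real (n - k) * R\<^sup>2 + 2 * Q\<^sup>2"
    and c: "\<forall>x\<in>p_ellipsoid N p \<sigma>. \<exists>c. (\<forall>i\<in>T. 0 \<le> c i \<and> \<bar>x i\<bar> = b i * c i) \<and> (\<Sum>i\<in>T. (c i)\<^sup>2) \<le> 1"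
    using p_ellipsoid_weights[OF p k(1,2) nonneg, folded R_def Q_def] by (elim exE conjE) (rule that)
  then have b: "\<And>i. i \<in> T \<Longrightarrow> 0 \<le> b i" "\<And>i. i \<in> T \<Longrightarrow> b i \<le> sqrt 2 * R"
    by blast+
  have R: "0 \<le> R" and Q: "0 \<le> Q"
    by (auto simp: R_def Q_def)
  define h where "h y = L2_set (\<lambda>i. b i * y i) T" for y :: "nat \<Rightarrow> real"
  \<comment> \<open>The sum of the \<open>(b i)^2\<close> plus \<open>d (sqrt 2 R)^2\<close> is at
    most \<open>4 d R^2 + 2 Q^2\<close>, since \<open>n - k \<le> d\<close>; this in turn is at most
    \<open>\<Lambda>^2\<close>.\<close>
  define \<Lambda> where "\<Lambda> = 2 * sqrt d * R + sqrt 2 * Q"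
  have h_powr: "h y = (\<Sum>i\<in>T. b i powr 2 * \<bar>y i\<bar> powr 2) powr (1 / 2)" for y
  proof -
    have "(\<Sum>i\<in>T. b i powr 2 * \<bar>y i\<bar> powr 2) = (\<Sum>i\<in>T. (b i * y i)\<^sup>2)"
      using b(1) by (intro sum.cong refl) (simp add: power_mult_distrib)
    then show ?thesis
      unfolding h_def L2_set_def by (simp only: powr_half_sqrt sum_nonneg zero_le_power2)
  qed
  have "1 - (14000 * \<epsilon>) ^ d \<le> measure \<mu> {E \<in> space \<mu>. section_radius N E (p_ellipsoid N p \<sigma>) \<le>
      8 * L / \<epsilon> * sqrt (2 * real n / d) * R + 2 * sqrt (real n) / (\<epsilon> * d) * Q}"
  proof (rule p_ellipsoid_probability[OF haar k _ \<sigma>, where h = h and R = "sqrt 2 * R" and \<Lambda> = \<Lambda>])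
    show "h \<in> borel_measurable (borel_PiM T)"
      unfolding h_def L2_set_def by measurable
    show "0 \<le> h x" for x by (simp add: h_def)
    show "h (\<lambda>i\<in>T. c * x i) = c * h x" if "0 \<le> c" for c x
    proof -
      have "h (\<lambda>i\<in>T. c * x i) = L2_set (\<lambda>i. c * (b i * x i)) T"
        unfolding h_def by (rule L2_set_cong) simp_all
      then show ?thesis
        by (simp only: h_def L2_set_right_distrib[OF that])
    qed
    show "(\<Sum>i\<in>T. \<bar>y i\<bar> * \<bar>x i\<bar>) \<le> h y" if x: "x \<in> p_ellipsoid N p \<sigma>" for x y
    proof -
      obtain c where c: "\<forall>i\<in>T. 0 \<le> c i \<and> \<bar>x i\<bar> = b i * c i" "(\<Sum>i\<in>T. (c i)\<^sup>2) \<le> 1"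
        using bspec[OF c x] by (elim exE conjE) (rule that)
      have "(\<Sum>i\<in>T. \<bar>y i\<bar> * \<bar>x i\<bar>) = (\<Sum>i\<in>T. \<bar>b i * y i\<bar> * \<bar>c i\<bar>)"
        using c(1) b(1) by (intro sum.cong refl) (simp add: abs_mult)
      also have "\<dots> \<le> L2_set (\<lambda>i. b i * y i) T * L2_set c T"
        by (rule L2_set_mult_ineq)
      also have "\<dots> \<le> L2_set (\<lambda>i. b i * y i) T * 1"
        using c(2) by (intro mult_left_mono) (auto simp: L2_set_def sum_nonneg)
      finally show ?thesis by (simp add: h_def)
    qed
    show "L2_set x T \<le> sqrt 2 * R" if x: "x \<in> p_ellipsoid N p \<sigma>" for x
    proof -
      obtain c where c: "\<forall>i\<in>T. 0 \<le> c i \<and> \<bar>x i\<bar> = b i * c i" "(\<Sum>i\<in>T. (c i)\<^sup>2) \<le> 1"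
        using bspec[OF c x] by (elim exE conjE) (rule that)
      have "L2_set x T = L2_set (\<lambda>i. b i * c i) T"
      proof -
        have "(x i)\<^sup>2 = (b i * c i)\<^sup>2" if "i \<in> T" for i
          using c(1) that by (metis power2_abs)
        then show ?thesis
          unfolding L2_set_def by (simp only: cong: sum.cong)
      qed
      also have "\<dots> \<le> L2_set (\<lambda>i. sqrt 2 * R * c i) T"
        using c(1) b by (intro L2_set_mono mult_right_mono mult_nonneg_nonneg) auto
      also have "\<dots> = sqrt 2 * R * L2_set c T"
        using R by (intro L2_set_right_distrib[symmetric]) simp
      also have "\<dots> \<le> sqrt 2 * R * 1"
        using c(2) R by (intro mult_left_mono) (auto simp: L2_set_def)
      finally show ?thesis by simp
    qed
    show "0 \<le> \<Lambda>"
      using Q R by (simp add: \<Lambda>_def)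
    show "(\<integral>\<^sup>+x. ennreal (h x ^ d) \<partial>gauss T) \<le> ennreal (\<Lambda> ^ d)"
    proof -
      have "h x ^ d = (\<Sum>i\<in>T. b i powr 2 * \<bar>x i\<bar> powr 2) powr (real d / 2)" for x
        unfolding h_powr by (rule powr_inverse_power) simp
      then have "(\<integral>\<^sup>+x. ennreal (h x ^ d) \<partial>gauss T) =
          (\<integral>\<^sup>+x. ennreal ((\<Sum>i\<in>T. b i powr 2 * \<bar>x i\<bar> powr 2) powr (real d / 2)) \<partial>gauss T)"
        by (simp only:)
      also have "\<dots> \<le> ennreal (((2 - 1) * (\<Sum>i\<in>T. b i powr 2) powr (2 / 2) + real d * (sqrt 2 * R)\<^sup>2) powr (real d / 2))"
        using b by (intro gauss_lq_moment) auto
      also have "\<dots> \<le> ennreal (\<Lambda> ^ d)"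
      proof (rule ennreal_leI)
        have "(2 - 1) * (\<Sum>i\<in>T. b i powr 2) powr (2 / 2) = (\<Sum>i\<in>T. (b i)\<^sup>2)"
          using b(1) by (simp add: sum_nonneg)
        moreover have "real (n - k) * R\<^sup>2 \<le> real d * R\<^sup>2"
          by (intro mult_right_mono) auto
        moreover have "4 * (real d * R\<^sup>2) + 2 * Q\<^sup>2 \<le> \<Lambda>\<^sup>2"
        proof -
          have "4 * (x * R\<^sup>2) + 2 * Q\<^sup>2 \<le> (2 * sqrt x * R + sqrt 2 * Q)\<^sup>2" if "0 \<le> x" for x
            unfolding power2_sum using Q R that by (simp add: power_mult_distrib)
          then show ?thesis
            unfolding \<Lambda>_def by simp_all
        qed
        moreover have "real d * (sqrt 2 * R)\<^sup>2 = 2 * (real d * R\<^sup>2)"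
          by (simp add: power_mult_distrib)
        ultimately have "(2 - 1) * (\<Sum>i\<in>T. b i powr 2) powr (2 / 2) + real d * (sqrt 2 * R)\<^sup>2 \<le> \<Lambda>\<^sup>2"
          using sum_b by linarith
        then have "((2 - 1) * (\<Sum>i\<in>T. b i powr 2) powr (2 / 2) + real d * (sqrt 2 * R)\<^sup>2) powr (real d / 2) \<le> (\<Lambda>\<^sup>2) powr (real d / 2)"
          by (intro powr_mono2) auto
        also have "(\<Lambda>\<^sup>2) powr (real d / 2) = \<Lambda> ^ d"
          by (rule power2_powr_half[OF \<open>0 \<le> \<Lambda>\<close>]) simp
        finally show "((2 - 1) * (\<Sum>i\<in>T. b i powr 2) powr (2 / 2) + real d * (sqrt 2 * R)\<^sup>2) powr (real d / 2) \<le> \<Lambda> ^ d" .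
      qed
      finally show ?thesis .
    qed
    show "sqrt 2 * R + \<Lambda> * sqrt n / (real d * \<epsilon>) \<le> 8 * L / \<epsilon> * sqrt (2 * real n / d) * R + 2 * sqrt (real n) / (\<epsilon> * d) * Q"
    proof -
      define X where "X = sqrt (n / d) / \<epsilon>"
      define Y where "Y = sqrt (real n) / (\<epsilon> * d)"
      have X: "1 \<le> X" "X \<le> L * X"
        using ratio by (simp_all only: X_def)
      then have Z: "1 \<le> L * X" by linarith
      have Y: "0 \<le> Y" using \<epsilon> by (simp add: Y_def)
      have "\<Lambda> * sqrt n / (real d * \<epsilon>) = sqrt 2 * (Y * Q) + 2 * (sqrt d * sqrt n / (d * \<epsilon>) * R)"
      proof -
        have "(2 * sqrt x * R + sqrt 2 * Q) * sqrt n / (x * \<epsilon>) =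
            sqrt 2 * (sqrt n / (\<epsilon> * x) * Q) + 2 * (sqrt x * sqrt n / (x * \<epsilon>) * R)" for x
          by (simp add: add_divide_distrib algebra_simps)
        then show ?thesis
          unfolding \<Lambda>_def Y_def .
      qed
      also have "\<dots> = sqrt 2 * (Y * Q) + 2 * (X * R)"
        unfolding ratio(3) X_def ..
      finally have "sqrt 2 * R + \<Lambda> * sqrt n / (real d * \<epsilon>) = sqrt 2 * (1 * R) + 2 * (X * R) + sqrt 2 * (Y * Q)"
        by simp
      also have "\<dots> \<le> sqrt 2 * (L * X * R) + 2 * (L * X * R) + 2 * (Y * Q)"
        using X Z R Q Y by (intro add_mono mult_mono mult_right_mono mult_left_mono) (auto intro: real_le_lsqrt)
      also have "\<dots> = (sqrt 2 + 2) * (L * X * R) + 2 * (Y * Q)"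
        by (simp only: distrib_right)
      also have "\<dots> \<le> 8 * sqrt 2 * (L * X * R) + 2 * (Y * Q)"
      proof -
        have "sqrt 2 + 2 \<le> 8 * sqrt (2 :: real)"
        proof -
          have "1 \<le> sqrt (2 :: real)" by simp
          then show ?thesis by linarith
        qed
        then show ?thesis
          using X Z R Q Y by (intro add_mono mult_right_mono) auto
      qed
      also have "\<dots> = 8 * L / \<epsilon> * sqrt (2 * real n / d) * R + 2 * sqrt (real n) / (\<epsilon> * d) * Q"
        unfolding X_def Y_def first_summand_eq by simp
      finally show ?thesis .
    qed
  qed (use p \<epsilon> in auto)
  then show ?thesis
    by (simp only: R_def Q_def divide_divide_eq_right mult_1)
qed

text \<open>The moment bound loses a factor 2 in front of the supremum, which is absorbed into \<open>\<epsilon>\<close>.\<close>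

private lemma case_p_eq_1:
  "1 - (14000 * (2 * \<epsilon>)) ^ d \<le> measure \<mu> {E \<in> space \<mu>. section_radius N E (p_ellipsoid N 1 \<sigma>) \<le>
    4 * L / \<epsilon> * sqrt (real n / d) * \<sigma> (k + 1) +
    2 * sqrt (real n) / (\<epsilon> * d) * (SUP i\<in>T. \<sigma> i * sqrt (ln (2 * real (i - k))))}"
proof -
  define M where "M = (SUP i\<in>T. \<sigma> i * sqrt (ln (2 * real (i - k))))"
  define R where "R = \<sigma> (k + 1)"
  define h where "h y = Max ((\<lambda>i. \<sigma> i * \<bar>y i\<bar>) ` T)" for y :: "nat \<Rightarrow> real"
  define \<Lambda> where "\<Lambda> = 2 * (2 * M + R * sqrt (1 + d))"
  have T: "T \<noteq> {}" "k + 1 \<in> T" using k by auto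
  have R: "0 \<le> R" using R_nonneg by (simp add: R_def)
  have M_upper: "\<sigma> i * sqrt (ln (2 * real (i - k))) \<le> M" if "i \<in> T" for i
    unfolding M_def using that by (intro cSUP_upper bdd_above_finite) auto
  have M: "0 \<le> M"
    using T_nonneg[OF T(2)] by (intro order_trans[OF _ M_upper[OF T(2)]]) auto
  have h_upper: "\<sigma> i * \<bar>y i\<bar> \<le> h y" if "i \<in> T" for i y
    unfolding h_def using that by (intro Max_ge) auto
  have h_nonneg: "0 \<le> h y" for y
    using T_nonneg[OF T(2)] by (intro order_trans[OF _ h_upper[OF T(2)]]) auto
  show ?thesis
    unfolding M_def[symmetric] R_def[symmetric]
  proof (rule p_ellipsoid_probability[OF haar k _ \<sigma>, where h = h and R = R and \<Lambda> = \<Lambda>])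
    show "h \<in> borel_measurable (borel_PiM T)"
      unfolding h_def by measurable
    show "0 \<le> h x" for x by (rule h_nonneg)
    show "h (\<lambda>i\<in>T. c * x i) = c * h x" if "0 \<le> c" for c x
    proof -
      have "c * h x = Max ((\<lambda>y. c * y) ` (\<lambda>i. \<sigma> i * \<bar>x i\<bar>) ` T)"
        unfolding h_def using T that by (intro mono_Max_commute monoI mult_left_mono) auto
      also have "(\<lambda>y. c * y) ` (\<lambda>i. \<sigma> i * \<bar>x i\<bar>) ` T = (\<lambda>i. \<sigma> i * \<bar>(\<lambda>i\<in>T. c * x i) i\<bar>) ` T"
        unfolding image_image using that by (intro image_cong refl) (simp add: abs_mult)
      finally show ?thesis by (simp add: h_def)
    qed
    show "(\<Sum>i\<in>T. \<bar>y i\<bar> * \<bar>x i\<bar>) \<le> h y" if x: "x \<in> p_ellipsoid N 1 \<sigma>" for x y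
    proof -
      have "(\<Sum>i\<in>T. \<bar>y i\<bar> * \<bar>x i\<bar>) \<le> (\<Sum>i\<in>T. h y * (\<bar>x i\<bar> / \<sigma> i) powr 1)"
      proof (rule sum_mono)
        fix i assume i: "i \<in> T"
        then have i': "i \<in> {1..N}" using k by auto
        have t: "0 \<le> \<bar>x i\<bar> / \<sigma> i" using T_nonneg[OF i] by simp
        have "\<bar>y i\<bar> * \<bar>x i\<bar> = \<bar>y i\<bar> * (\<sigma> i * (\<bar>x i\<bar> / \<sigma> i))"
          by (rule arg_cong[OF p_ellipsoid_coord_le(2)[OF x _ i' \<sigma>]]) auto
        also have "\<dots> = (\<sigma> i * \<bar>y i\<bar>) * (\<bar>x i\<bar> / \<sigma> i)"
          by (simp only: mult_ac)
        also have "\<dots> \<le> h y * (\<bar>x i\<bar> / \<sigma> i)"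
          by (rule mult_right_mono[OF h_upper[OF i] t])
        finally show "\<bar>y i\<bar> * \<bar>x i\<bar> \<le> h y * (\<bar>x i\<bar> / \<sigma> i) powr 1"
          by (simp only: powr_one[OF t])
      qed
      also have "\<dots> = h y * (\<Sum>i\<in>T. (\<bar>x i\<bar> / \<sigma> i) powr 1)"
        by (simp only: sum_distrib_left)
      also have "\<dots> \<le> h y * 1"
        using k by (intro mult_left_mono p_ellipsoid_sum_le[OF x] h_nonneg) auto
      finally show ?thesis by simp
    qed
    show "L2_set x T \<le> R" if x: "x \<in> p_ellipsoid N 1 \<sigma>" for x
    proof -
      have "L2_set x T \<le> (\<Sum>i\<in>T. \<bar>x i\<bar>)"
        by (rule L2_set_le_sum_abs)
      also have "\<dots> \<le> (\<Sum>i\<in>T. R * (\<bar>x i\<bar> / \<sigma> i) powr 1)"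
      proof (rule sum_mono)
        fix i assume i: "i \<in> T"
        then have i': "i \<in> {1..N}" using k by auto
        have t: "0 \<le> \<bar>x i\<bar> / \<sigma> i" using T_nonneg[OF i] by simp
        have "\<bar>x i\<bar> = \<sigma> i * (\<bar>x i\<bar> / \<sigma> i)"
          by (rule p_ellipsoid_coord_le(2)[OF x _ i' \<sigma>]) auto
        also have "\<dots> \<le> R * (\<bar>x i\<bar> / \<sigma> i)"
          unfolding R_def by (rule mult_right_mono[OF T_le[OF i] t])
        finally show "\<bar>x i\<bar> \<le> R * (\<bar>x i\<bar> / \<sigma> i) powr 1"
          by (simp only: powr_one[OF t])
      qed
      also have "\<dots> = R * (\<Sum>i\<in>T. (\<bar>x i\<bar> / \<sigma> i) powr 1)"
        by (simp only: sum_distrib_left)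
      also have "\<dots> \<le> R * 1"
        using k by (intro mult_left_mono p_ellipsoid_sum_le[OF x] R) auto
      finally show ?thesis by simp
    qed
    show "0 \<le> \<Lambda>"
      using M R by (simp add: \<Lambda>_def)
    show "(\<integral>\<^sup>+x. ennreal (h x ^ d) \<partial>gauss T) \<le> ennreal (\<Lambda> ^ d)"
      unfolding h_def \<Lambda>_def
      by (rule gauss_weighted_max_moment) (use k T_nonneg T_le M_upper in \<open>auto simp: R_def\<close>)
    show "R + \<Lambda> * sqrt n / (real d * (2 * \<epsilon>)) \<le> 4 * L / \<epsilon> * sqrt (real n / d) * R + 2 * sqrt (real n) / (\<epsilon> * d) * M"
    proof -
      define X where "X = sqrt (n / d) / \<epsilon>"
      define Y where "Y = sqrt (real n) / (\<epsilon> * d)"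
      have X: "1 \<le> X" "X \<le> L * X"
        using ratio by (simp_all only: X_def)
      then have Z: "1 \<le> L * X" by linarith
      have Y: "0 \<le> Y" using \<epsilon> by (simp add: Y_def)
      \<comment> \<open>Hence \<open>\<Lambda> \<le> 4 M + 4 sqrt d R\<close>, and the division by
        \<open>2 * \<epsilon>\<close> leaves the coefficient 2 in front of both terms.\<close>
      have "sqrt (1 + real d) \<le> 2 * sqrt d"
        by (intro real_le_lsqrt) (auto simp: power_mult_distrib)
      then have "\<Lambda> \<le> 4 * M + 4 * (sqrt d * R)"
        unfolding \<Lambda>_def using mult_left_mono[OF _ R, of "sqrt (1 + real d)" "2 * sqrt d"] by (simp add: mult_ac)
      then have "\<Lambda> * (sqrt n / (real d * (2 * \<epsilon>))) \<le> (4 * M + 4 * (sqrt d * R)) * (sqrt n / (real d * (2 * \<epsilon>)))"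
        using \<epsilon> by (intro mult_right_mono) auto
      also have "\<dots> = 2 * (Y * M) + 2 * (sqrt d * sqrt n / (d * \<epsilon>) * R)"
      proof -
        have "(4 * M + 4 * (sqrt x * R)) * (sqrt n / (x * (2 * \<epsilon>))) =
            2 * (sqrt n / (\<epsilon> * x) * M) + 2 * (sqrt x * sqrt n / (x * \<epsilon>) * R)" for x
          by (simp add: add_divide_distrib algebra_simps)
        then show ?thesis
          unfolding Y_def .
      qed
      also have "\<dots> = 2 * (Y * M) + 2 * (X * R)"
        unfolding ratio(3) X_def ..
      finally have "R + \<Lambda> * sqrt n / (real d * (2 * \<epsilon>)) \<le> 1 * R + 2 * (X * R) + 2 * (Y * M)"
        by simp
      also have "\<dots> \<le> L * X * R + 2 * (L * X * R) + 2 * (Y * M)"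
        using X Z R Y M by (intro add_mono mult_right_mono mult_left_mono) auto
      also have "\<dots> \<le> 4 * (L * X * R) + 2 * (Y * M)"
        using X Z R by simp
      also have "\<dots> = 4 * L / \<epsilon> * sqrt (real n / d) * R + 2 * sqrt (real n) / (\<epsilon> * d) * M"
        by (simp add: X_def Y_def)
      finally show ?thesis .
    qed
  qed (use \<epsilon> in auto)
qed

text \<open>For a given \<open>p\<close> exactly one of the three premises holds, so the event is a
  single inequality. The constant 28000 is the one of \<open>case_p_eq_1\<close>; the other two
  ranges come with 14000.\<close>

lemma p_ellipsoid_section_radius:
  fixes p :: real
  assumes p: "1 \<le> p"
  shows "1 - (28000 * \<epsilon>) ^ (n - k + 1) \<le> measure \<mu> {E \<in> space \<mu>.
        (2 < p \<longrightarrow>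
          section_radius N E (p_ellipsoid N p \<sigma>) \<le>
            8 * sqrt (ln (1 / \<epsilon>)) / \<epsilon> * sqrt (2 * real n / real (n - k + 1)) *
              (\<Sum>i = k + 1..N. \<sigma> i powr (2 * p / (p - 2))) powr ((p - 2) / (2 * p)) +
            2 * sqrt (real n) / (\<epsilon> * real (n - k + 1)) *
              (\<Sum>i = n + 1..N. \<sigma> i powr conj_exponent p) powr (1 / conj_exponent p)) \<and>
        (1 < p \<and> p \<le> 2 \<longrightarrow>
          section_radius N E (p_ellipsoid N p \<sigma>) \<le>
            8 * sqrt (ln (1 / \<epsilon>)) / \<epsilon> * sqrt (2 * real n / real (n - k + 1)) * \<sigma> (k + 1) +
            2 * sqrt (conj_exponent p * real n) / (\<epsilon> * real (n - k + 1)) *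
              (\<Sum>i = k + 1..N. \<sigma> i powr conj_exponent p) powr (1 / conj_exponent p)) \<and>
        (p = 1 \<longrightarrow>
          section_radius N E (p_ellipsoid N 1 \<sigma>) \<le>
            4 * sqrt (ln (1 / \<epsilon>)) / \<epsilon> * sqrt (real n / real (n - k + 1)) * \<sigma> (k + 1) +
            2 * sqrt (real n) / (\<epsilon> * real (n - k + 1)) *
              (SUP i\<in>{k + 1..N}. \<sigma> i * sqrt (ln (2 * real (i - k)))))}"
proof -
  have pow: "1 - (28000 * \<epsilon>) ^ d \<le> 1 - (14000 * \<epsilon>) ^ d"
    using \<epsilon> by (intro diff_left_mono power_mono) auto
  consider "2 < p" | "1 < p" "p \<le> 2" | "p = 1"
    using p by linarith
  then show ?thesis
  proof cases
    case 1
    then have c: "2 < p \<longleftrightarrow> True" "1 < p \<and> p \<le> 2 \<longleftrightarrow> False" "p = 1 \<longleftrightarrow> False"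
      by auto
    show ?thesis
      using order_trans[OF pow case_p_gt_2[OF 1]] unfolding c by (simp only: simp_thms)
  next
    case 2
    then have c: "2 < p \<longleftrightarrow> False" "1 < p \<and> p \<le> 2 \<longleftrightarrow> True" "p = 1 \<longleftrightarrow> False"
      by auto
    show ?thesis
      using order_trans[OF pow case_p_le_2[OF 2]] unfolding c by (simp only: simp_thms)
  next
    case 3
    then have c: "2 < p \<longleftrightarrow> False" "1 < p \<and> p \<le> 2 \<longleftrightarrow> False" "p = 1 \<longleftrightarrow> True"
      by auto
    have "14000 * (2 * \<epsilon>) = 28000 * \<epsilon>" by simp
    then show ?thesis
      using case_p_eq_1 unfolding c by (simp only: simp_thms)
  qed
qed

end

end

theorem corollary3p2:
  shows "\<exists>C C\<^sub>1 \<gamma> :: real. 2 \<le> C \<and> 2 \<le> C\<^sub>1 \<and> 0 < \<gamma> \<and> \<gamma> < 1 \<and>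
    (\<forall>(k::nat) (n::nat) (N::nat) (\<epsilon>::real) (p::real) (\<sigma>::nat \<Rightarrow> real) (\<mu>::(nat \<Rightarrow> real) set measure).
      1 \<le> k \<longrightarrow> k \<le> n \<longrightarrow> n < N \<longrightarrow> 0 < \<epsilon> \<longrightarrow> \<epsilon> \<le> 1 / (2 * C) \<longrightarrow> 1 \<le> p \<longrightarrow>
      (\<forall>i\<in>{1..N}. 0 \<le> \<sigma> i) \<longrightarrow> antimono_on {1..N} \<sigma> \<longrightarrow> haar_grassmannian N n \<mu> \<longrightarrow>
      measure \<mu> {E \<in> space \<mu>.
        (2 < p \<longrightarrow>
          section_radius N E (p_ellipsoid N p \<sigma>) \<le>
            8 * sqrt (ln (1 / \<epsilon>)) / \<epsilon> * sqrt (2 * real n / real (n - k + 1)) *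
              (\<Sum>i = k + 1..N. \<sigma> i powr (2 * p / (p - 2))) powr ((p - 2) / (2 * p)) +
            2 * sqrt (real n) / (\<epsilon> * real (n - k + 1)) *
              (\<Sum>i = n + 1..N. \<sigma> i powr conj_exponent p) powr (1 / conj_exponent p)) \<and>
        (1 < p \<and> p \<le> 2 \<longrightarrow>
          section_radius N E (p_ellipsoid N p \<sigma>) \<le>
            8 * sqrt (ln (1 / \<epsilon>)) / \<epsilon> * sqrt (2 * real n / real (n - k + 1)) * \<sigma> (k + 1) +
            2 * sqrt (conj_exponent p * real n) / (\<epsilon> * real (n - k + 1)) *
              (\<Sum>i = k + 1..N. \<sigma> i powr conj_exponent p) powr (1 / conj_exponent p)) \<and>
        (p = 1 \<longrightarrow>
          section_radius N E (p_ellipsoid N 1 \<sigma>) \<le>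
            C\<^sub>1 * sqrt (ln (1 / \<epsilon>)) / \<epsilon> * sqrt (real n / real (n - k + 1)) * \<sigma> (k + 1) +
            2 * sqrt (real n) / (\<epsilon> * real (n - k + 1)) *
              (SUP i\<in>{k + 1..N}. \<sigma> i * sqrt (ln (2 * real (i - k)))))}
      \<ge> 1 - 3 * (C * \<epsilon>) ^ (n - k + 1) - real k * exp (- \<gamma> * real n))"
\<comment> \<open>\<open>28000\<close> is \<open>14000 * 2\<close>, with the factor 2 from the case
  \<open>p = 1\<close>, and \<open>4\<close> is the coefficient in \<open>case_p_eq_1\<close>. The
  term with \<gamma> is nonnegative whatever \<gamma> is, so \<open>1 / 2\<close> is an arbitrary
  choice.\<close>
proof (rule exI[of _ 28000], rule exI[of _ 4], rule exI[of _ "1 / 2"], intro conjI allI impI, goal_cases)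
  case prems: (5 k n N \<epsilon> p \<sigma> \<mu>)
  have "0 \<le> real k * exp (- (1 / 2) * real n)" "0 \<le> (28000 * \<epsilon>) ^ (n - k + 1)"
    using prems(4) by (intro mult_nonneg_nonneg zero_le_power; simp)+
  then have weaken: "1 - 3 * (28000 * \<epsilon>) ^ (n - k + 1) - real k * exp (- (1 / 2) * real n) \<le> 1 - (28000 * \<epsilon>) ^ (n - k + 1)"
    by linarith
  have \<epsilon>: "\<epsilon> \<le> 1 / 56000"
    using prems(5) by simp
  show ?case
    by (rule order_trans[OF weaken p_ellipsoid_section_radius[OF prems(9,1-3) _ prems(8,4) \<epsilon> prems(6)]])
       (use prems(7) in blast)
qed auto

end
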